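(* Let $n\ge 1$, let $(\mathcal C,\mathbb E,\mathfrak s)$ be an $n$-exangulated category and let $\mathcal A\subseteq\mathcal C$ be an $n$-extension closed additive subcategory. Let $\mathbb F$ be the restriction of $\mathbb E$ to $\mathcal A^{\mathrm{op}}\times\mathcal A$ and let $\mathfrak t$ be the induced realisation of $\mathbb F$ (defined in the context). Then $(\mathcal A,\mathbb F,\mathfrak t)$ is an $n$-exangulated category, and $(\mathscr I_{\mathcal A},\Theta_{\mathcal A})\colon(\mathcal A,\mathbb F,\mathfrak t)\to(\mathcal C,\mathbb E,\mathfrak s)$ is a fully faithful $n$-exangulated functor, where $\mathscr I_{\mathcal A}\colon\mathcal A\to\mathcal C$ is the inclusion and $\Theta_{\mathcal A}\colon\mathbb F(-,-)\Rightarrow\mathbb E(\mathscr I_{\mathcal A}-,\mathscr I_{\mathcal A}-)$ is the natural isomorphism given by the identity maps $\mathbb F(C,A)=\mathbb E(C,A)$.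
   Context: **Complexes.** For an additive category $\mathcal D$, $\mathbf C^{n+2}_{\mathcal D}$ is the category of complexes $X_\bullet\colon X_0\xrightarrow{d^X_0}X_1\to\cdots\to X_n\xrightarrow{d^X_n}X_{n+1}$ over $\mathcal D$ concentrated in degrees $0,\dots,n+1$, with chain maps $f_\bullet=(f_0,\dots,f_{n+1})$. For $A,C\in\mathcal D$, $\mathbf C^{n+2}_{(\mathcal D;A,C)}$ is its subcategory of complexes with $X_0=A$, $X_{n+1}=C$ and chain maps with $f_0=\mathrm{id}_A$, $f_{n+1}=\mathrm{id}_C$; two of its morphisms are homotopic if their difference is null-homotopic as a chain map, and $[X_\bullet]_{\mathcal D}$ is the resulting homotopy equivalence class of $X_\bullet$ in $\mathbf C^{n+2}_{(\mathcal D;A,C)}$. For $X\in\mathcal D$ and $0\le i\le n$, $\mathrm{triv}_i(X)_\bullet$ has $X$ in degrees $i,i+1$ with differential $\mathrm{id}_X$ between them and $0$ elsewhere. **Extensions.** Let $\mathbb G\colon\mathcal D^{\mathrm{op}}\times\mathcal D\to\mathsf{Ab}$ be biadditive. For $\delta\in\mathbb G(C,A)$, $a\colon A\to B$, $c\colon D\to C$ write $a_*\delta=\mathbb G(C,a)(\delta)$ and $c^*\delta=\mathbb G(c,A)(\delta)$. For $\delta\in\mathbb G(C,A)$, $\rho\in\mathbb G(D,B)$, a morphism $(a,c)\colon\delta\to\rho$ is a pair $a\colon A\to B$, $c\colon C\to D$ with $a_*\delta=c^*\rho$. An $n$-exangle is a pair $\langle X_\bullet,\delta\rangle$ with $X_\bullet\in\mathbf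 C^{n+2}_{\mathcal D}$, $\delta\in\mathbb G(X_{n+1},X_0)$, $(d^X_0)_*\delta=0$, $(d^X_n)^*\delta=0$, such that for all $X\in\mathcal D$ the sequences $\mathcal D(X,X_0)\to\cdots\to\mathcal D(X,X_{n+1})\to\mathbb G(X,X_0)$ (last map $f\mapsto f^*\delta$) and $\mathcal D(X_{n+1},X)\to\cdots\to\mathcal D(X_0,X)\to\mathbb G(X_{n+1},X)$ (last map $g\mapsto g_*\delta$) are exact. **Exact realisation.** An exact realisation $\mathfrak r$ of $\mathbb G$ assigns to each $\delta\in\mathbb G(C,A)$ a homotopy equivalence class $\mathfrak r(\delta)$ of an object of $\mathbf C^{n+2}_{(\mathcal D;A,C)}$ such that: (R0) if $[X_\bullet]_{\mathcal D}=\mathfrak r(\delta)$, $[Y_\bullet]_{\mathcal D}=\mathfrak r(\rho)$ and $(a,c)\colon\delta\to\rho$ is a morphism of extensions, there is a chain map $f_\bullet\colon X_\bullet\to Y_\bullet$ (a lift of $(a,c)$) with $f_0=a$, $f_{n+1}=c$; (R1) if $\mathfrak r(\delta)=[X_\bullet]_{\mathcal D}$ then $\langle X_\bullet,\delta\rangle$ is an $n$-exangle; (R2) for all $A,C\in\mathcal D$, $\mathfrak r$ sends $0\in\mathbb G(0,A)$ to $[\mathrm{triv}_0(A)_\bullet]_{\mathcal D}$ and $0\in\mathbb G(C,0)$ to $[\mathrm{triv}_n(C)_\bullet]_{\mathcal D}$. If $\mathfrak r(\delta)=[X_\bullet]_{\mathcal D}$, then $\langle X_\bullet,\delta\rangle$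 is called $\mathfrak r$-distinguished, $X_\bullet$ an $\mathfrak r$-conflation, $d^X_0$ an $\mathfrak r$-inflation and $d^X_n$ an $\mathfrak r$-deflation. **$n$-exangulated category.** A triple $(\mathcal D,\mathbb G,\mathfrak r)$ with $\mathcal D$ additive, $\mathbb G$ biadditive and $\mathfrak r$ an exact realisation of $\mathbb G$ such that: (EA1) $\mathfrak r$-inflations are closed under composition; (EA1$^{\mathrm{op}}$) $\mathfrak r$-deflations are closed under composition; (EA2) for $c\colon X_{n+1}\to Y_{n+1}$ and $\mathfrak r$-distinguished $\langle X_\bullet,c^*\rho\rangle$, $\langle Y_\bullet,\rho\rangle$ with $A:=X_0=Y_0$, there is a lift $f_\bullet$ of $(\mathrm{id}_A,c)$ such that $\langle M^f_\bullet,(d^X_0)_*\rho\rangle$ is $\mathfrak r$-distinguished, where $M^f_\bullet$ is the complex $X_1\to X_2\oplus Y_1\to\cdots\to X_{n+1}\oplus Y_n\to Y_{n+1}$ with differentials $\begin{bmatrix}-d^X_1\\ f_1\end{bmatrix}$, then $\begin{bmatrix}-d^X_{i}&0\\ f_{i}&d^Y_{i-1}\end{bmatrix}$ for $i=2,\dots,n$, then $\begin{bmatrix}f_{n+1}&d^Y_n\end{bmatrix}$; (EA2$^{\mathrm{op}}$) for $a\colon X_0\to Y_0$ and $\mathfrak r$-distinguished $\langle X_\bullet,\delta\rangle$, $\langle Y_\bullet,a_*\delta\rangle$ with $C:=X_{n+1}=Y_{n+1}$, there is a lift $f_\bullet$ of $(a,\mathrm{id}_C)$ such that $\langle N^f_\bullet,(d^Y_n)^*\delta\rangle$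 is $\mathfrak r$-distinguished, where $N^f_\bullet$ is the complex $X_0\to X_1\oplus Y_0\to\cdots\to X_n\oplus Y_{n-1}\to Y_n$ with differentials $\begin{bmatrix}d^X_0\\ f_0\end{bmatrix}$, then $\begin{bmatrix}d^X_i&0\\ f_i&-d^Y_{i-1}\end{bmatrix}$ for $i=1,\dots,n-1$, then $\begin{bmatrix}f_n&-d^Y_{n-1}\end{bmatrix}$. **Functors.** An $n$-exangulated functor $(\mathscr F,\Gamma)\colon(\mathcal D,\mathbb G,\mathfrak r)\to(\mathcal D',\mathbb G',\mathfrak r')$ is an additive functor $\mathscr F\colon\mathcal D\to\mathcal D'$ with a natural transformation $\Gamma\colon\mathbb G(-,-)\Rightarrow\mathbb G'(\mathscr F-,\mathscr F-)$ such that $[X_\bullet]_{\mathcal D}=\mathfrak r(\delta)$ implies $[\mathscr F(X_\bullet)]_{\mathcal D'}=\mathfrak r'(\Gamma_{(C,A)}(\delta))$ for all $\delta\in\mathbb G(C,A)$. **Subcategories.** An additive subcategory is a full subcategory closed under isomorphisms and finite direct sums and containing $0$ (not necessarily closed under direct summands). An additive subcategory $\mathcal A$ of $(\mathcal C,\mathbb E,\mathfrak s)$ is $n$-extension closed if for all $A,C\in\mathcal A$ and $\delta\in\mathbb E(C,A)$ there is an $\mathfrak s$-distinguished $n$-exangle $\langle X_\bullet,\delta\rangle$ with $X_i\in\mathcal A$ for $i=0,\dots,n+1$. **Induced structure.** $\mathbb F(C,A)=\mathbb E(C,A)$ for $A,C\in\mathcal A$, and for $\delta\in\mathbb F(C,A)$,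 $\mathfrak t(\delta):=[X_\bullet]_{\mathcal A}$ where $\langle X_\bullet,\delta\rangle$ is any $\mathfrak s$-distinguished $n$-exangle with all $X_i\in\mathcal A$ (this is well defined). *)

theory Defs
  imports "HOL-Algebra.Coset"
begin

text \<open>
  Abelian groups are commutative groups of \<^theory>\<open>HOL-Algebra.Group\<close>, hence written
  multiplicatively: in a group of morphisms or extensions the group operation is the sum,
  the unit is \<open>0\<close>, and \<open>inv\<close> is the negative.
  All data are only meaningful on the objects in \<open>obj D\<close> and the morphisms between them;
  every axiom and every predicate below inspects nothing else.
\<close>

section \<open>Additive categories\<close>

text \<open>
  The carrier of \<open>Hom D A B\<close> is the set of morphisms from \<open>A\<close> to \<open>B\<close>, and \<open>g \<cdot> f\<close> is
  \<open>g\<close> after \<open>f\<close>. The zero object and the direct sums are chosen, with \<open>dsum D A B\<close>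
  coming with its injections and projections.
\<close>

record ('o, 'm) category_data =
  obj :: "'o set"
  Hom :: "'o \<Rightarrow> 'o \<Rightarrow> 'm monoid"
  idn :: "'o \<Rightarrow> 'm"
  cmp :: "'m \<Rightarrow> 'm \<Rightarrow> 'm"  (infixr "\<cdot>\<index>" 75)
  zob :: 'o
  dsum :: "'o \<Rightarrow> 'o \<Rightarrow> 'o"
  inj1 :: "'o \<Rightarrow> 'o \<Rightarrow> 'm"
  inj2 :: "'o \<Rightarrow> 'o \<Rightarrow> 'm"
  prj1 :: "'o \<Rightarrow> 'o \<Rightarrow> 'm"
  prj2 :: "'o \<Rightarrow> 'o \<Rightarrow> 'm"

abbreviation mor :: "('o, 'm) category_data \<Rightarrow> 'o \<Rightarrow> 'o \<Rightarrow> 'm set"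
  where "mor D A B \<equiv> carrier (Hom D A B)"

abbreviation zmor :: "('o, 'm) category_data \<Rightarrow> 'o \<Rightarrow> 'o \<Rightarrow> 'm"
  where "zmor D A B \<equiv> \<one>\<^bsub>Hom D A B\<^esub>"

locale preadditive_category =
  fixes D :: "('o, 'm) category_data" (structure)
  assumes mor_disjoint:
      "\<lbrakk>A \<in> obj D; B \<in> obj D; A' \<in> obj D; B' \<in> obj D; f \<in> mor D A B; f \<in> mor D A' B'\<rbrakk>
        \<Longrightarrow> A = A' \<and> B = B'"
    and idn_mor: "A \<in> obj D \<Longrightarrow> idn D A \<in> mor D A A"
    and cmp_mor:
      "\<lbrakk>A \<in> obj D; B \<in> obj D; C \<in> obj D; f \<in> mor D A B; g \<in> mor D B C\<rbrakk>
        \<Longrightarrow> g \<cdot> f \<in> mor D A C"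
    and cmp_idn: "\<lbrakk>A \<in> obj D; B \<in> obj D; f \<in> mor D A B\<rbrakk> \<Longrightarrow> f \<cdot> idn D A = f"
    and idn_cmp: "\<lbrakk>A \<in> obj D; B \<in> obj D; f \<in> mor D A B\<rbrakk> \<Longrightarrow> idn D B \<cdot> f = f"
    and cmp_assoc:
      "\<lbrakk>A \<in> obj D; B \<in> obj D; C \<in> obj D; C' \<in> obj D;
        f \<in> mor D A B; g \<in> mor D B C; h \<in> mor D C C'\<rbrakk>
        \<Longrightarrow> (h \<cdot> g) \<cdot> f = h \<cdot> (g \<cdot> f)"
    and Hom_comm_group: "\<lbrakk>A \<in> obj D; B \<in> obj D\<rbrakk> \<Longrightarrow> comm_group (Hom D A B)"
    and cmp_left_hom:
      "\<lbrakk>A \<in> obj D; B \<in> obj D; C \<in> obj D; g \<in> mor D B C\<rbrakk>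
        \<Longrightarrow> (\<lambda>f. g \<cdot> f) \<in> hom (Hom D A B) (Hom D A C)"
    and cmp_right_hom:
      "\<lbrakk>A \<in> obj D; B \<in> obj D; C \<in> obj D; f \<in> mor D A B\<rbrakk>
        \<Longrightarrow> (\<lambda>g. g \<cdot> f) \<in> hom (Hom D B C) (Hom D A C)"

locale additive_category = preadditive_category +
  assumes zob_obj: "zob D \<in> obj D"
    and mor_zob: "A \<in> obj D \<Longrightarrow> mor D A (zob D) = {zmor D A (zob D)}"
    and zob_mor: "A \<in> obj D \<Longrightarrow> mor D (zob D) A = {zmor D (zob D) A}"
    and dsum_obj: "\<lbrakk>A \<in> obj D; B \<in> obj D\<rbrakk> \<Longrightarrow> dsum D A B \<in> obj D"
    and inj1_mor: "\<lbrakk>A \<in> obj D; B \<in> obj D\<rbrakk> \<Longrightarrow> inj1 D A B \<in> mor D A (dsum D A B)"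
    and inj2_mor: "\<lbrakk>A \<in> obj D; B \<in> obj D\<rbrakk> \<Longrightarrow> inj2 D A B \<in> mor D B (dsum D A B)"
    and prj1_mor: "\<lbrakk>A \<in> obj D; B \<in> obj D\<rbrakk> \<Longrightarrow> prj1 D A B \<in> mor D (dsum D A B) A"
    and prj2_mor: "\<lbrakk>A \<in> obj D; B \<in> obj D\<rbrakk> \<Longrightarrow> prj2 D A B \<in> mor D (dsum D A B) B"
    and prj1_inj1: "\<lbrakk>A \<in> obj D; B \<in> obj D\<rbrakk> \<Longrightarrow> prj1 D A B \<cdot> inj1 D A B = idn D A"
    and prj2_inj2: "\<lbrakk>A \<in> obj D; B \<in> obj D\<rbrakk> \<Longrightarrow> prj2 D A B \<cdot> inj2 D A B = idn D B"
    and prj1_inj2: "\<lbrakk>A \<in> obj D; B \<in> obj D\<rbrakk> \<Longrightarrow> prj1 D A B \<cdot> inj2 D A B = zmor D B A"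
    and prj2_inj1: "\<lbrakk>A \<in> obj D; B \<in> obj D\<rbrakk> \<Longrightarrow> prj2 D A B \<cdot> inj1 D A B = zmor D A B"
    and dsum_idn:
      "\<lbrakk>A \<in> obj D; B \<in> obj D\<rbrakk>
        \<Longrightarrow> (inj1 D A B \<cdot> prj1 D A B) \<otimes>\<^bsub>Hom D (dsum D A B) (dsum D A B)\<^esub> (inj2 D A B \<cdot> prj2 D A B)
            = idn D (dsum D A B)"

definition isomorphic :: "('o, 'm) category_data \<Rightarrow> 'o \<Rightarrow> 'o \<Rightarrow> bool"
  where "isomorphic D A B \<longleftrightarrow>
    (\<exists>f \<in> mor D A B. \<exists>g \<in> mor D B A. cmp D g f = idn D A \<and> cmp D f g = idn D B)"

text \<open>
  Matrices of morphisms: \<open>mcol D A B B' u v\<close> is the column \<open>A \<rightarrow> B \<oplus> B'\<close> with entries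
  \<open>u, v\<close>; \<open>mrow D A A' B u v\<close> is the row \<open>A \<oplus> A' \<rightarrow> B\<close>; and \<open>mmat D A A' B B' p q u v\<close>
  is the matrix \<open>A \<oplus> A' \<rightarrow> B \<oplus> B'\<close> with rows \<open>(p, q)\<close> and \<open>(u, v)\<close>.
\<close>

definition mcol :: "('o, 'm) category_data \<Rightarrow> 'o \<Rightarrow> 'o \<Rightarrow> 'o \<Rightarrow> 'm \<Rightarrow> 'm \<Rightarrow> 'm"
  where "mcol D A B B' u v =
    cmp D (inj1 D B B') u \<otimes>\<^bsub>Hom D A (dsum D B B')\<^esub> cmp D (inj2 D B B') v"

definition mrow :: "('o, 'm) category_data \<Rightarrow> 'o \<Rightarrow> 'o \<Rightarrow> 'o \<Rightarrow> 'm \<Rightarrow> 'm \<Rightarrow> 'm"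
  where "mrow D A A' B u v =
    cmp D u (prj1 D A A') \<otimes>\<^bsub>Hom D (dsum D A A') B\<^esub> cmp D v (prj2 D A A')"

definition mmat ::
    "('o, 'm) category_data \<Rightarrow> 'o \<Rightarrow> 'o \<Rightarrow> 'o \<Rightarrow> 'o \<Rightarrow> 'm \<Rightarrow> 'm \<Rightarrow> 'm \<Rightarrow> 'm \<Rightarrow> 'm"
  where "mmat D A A' B B' p q u v =
    mcol D (dsum D A A') B B' (mrow D A A' B p q) (mrow D A A' B' u v)"

section \<open>Complexes\<close>

text \<open>
  A complex in degrees \<open>0, \<dots>, n + 1\<close> is encoded by functions on \<^typ>\<open>nat\<close>, of which only
  the objects of index at most \<open>n + 1\<close> and the differentials \<open>df X i\<close> from degree \<open>i\<close> to
  degree \<open>i + 1\<close>, for \<open>i \<le> n\<close>, are relevant; likewise for chain maps \<open>f\<close> and the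
  components \<open>f i\<close> with \<open>i \<le> n + 1\<close>.
\<close>

record ('o, 'm) cpx =
  ob :: "nat \<Rightarrow> 'o"
  df :: "nat \<Rightarrow> 'm"

definition is_complex :: "nat \<Rightarrow> ('o, 'm) category_data \<Rightarrow> ('o, 'm) cpx \<Rightarrow> bool"
  where "is_complex n D X \<longleftrightarrow>
    (\<forall>i \<le> n + 1. ob X i \<in> obj D) \<and>
    (\<forall>i \<le> n. df X i \<in> mor D (ob X i) (ob X (i + 1))) \<and>
    (\<forall>i < n. cmp D (df X (i + 1)) (df X i) = zmor D (ob X i) (ob X (i + 2)))"

definition complexes_between ::
    "nat \<Rightarrow> ('o, 'm) category_data \<Rightarrow> 'o \<Rightarrow> 'o \<Rightarrow> ('o, 'm) cpx set"
  where "complexes_between n D A C =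
    {X. is_complex n D X \<and> ob X 0 = A \<and> ob X (n + 1) = C}"

definition chain_map ::
    "nat \<Rightarrow> ('o, 'm) category_data \<Rightarrow> ('o, 'm) cpx \<Rightarrow> ('o, 'm) cpx \<Rightarrow> (nat \<Rightarrow> 'm) \<Rightarrow> bool"
  where "chain_map n D X Y f \<longleftrightarrow>
    (\<forall>i \<le> n + 1. f i \<in> mor D (ob X i) (ob Y i)) \<and>
    (\<forall>i \<le> n. cmp D (f (i + 1)) (df X i) = cmp D (df Y i) (f i))"

definition null_homotopic ::
    "nat \<Rightarrow> ('o, 'm) category_data \<Rightarrow> ('o, 'm) cpx \<Rightarrow> ('o, 'm) cpx \<Rightarrow> (nat \<Rightarrow> 'm) \<Rightarrow> bool"
  where "null_homotopic n D X Y k \<longleftrightarrow>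
    (\<exists>h. (\<forall>i. 1 \<le> i \<and> i \<le> n + 1 \<longrightarrow> h i \<in> mor D (ob X i) (ob Y (i - 1))) \<and>
         (\<forall>i \<le> n + 1. k i =
            (if i = 0 then zmor D (ob X i) (ob Y i) else cmp D (df Y (i - 1)) (h i))
            \<otimes>\<^bsub>Hom D (ob X i) (ob Y i)\<^esub>
            (if i = n + 1 then zmor D (ob X i) (ob Y i) else cmp D (h (i + 1)) (df X i))))"

definition homotopic ::
    "nat \<Rightarrow> ('o, 'm) category_data \<Rightarrow> ('o, 'm) cpx \<Rightarrow> ('o, 'm) cpx
      \<Rightarrow> (nat \<Rightarrow> 'm) \<Rightarrow> (nat \<Rightarrow> 'm) \<Rightarrow> bool"
  where "homotopic n D X Y f g \<longleftrightarrow>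
    null_homotopic n D X Y
      (\<lambda>i. f i \<otimes>\<^bsub>Hom D (ob X i) (ob Y i)\<^esub> inv\<^bsub>Hom D (ob X i) (ob Y i)\<^esub> g i)"

definition chain_map_between ::
    "nat \<Rightarrow> ('o, 'm) category_data \<Rightarrow> 'o \<Rightarrow> 'o \<Rightarrow> ('o, 'm) cpx \<Rightarrow> ('o, 'm) cpx
      \<Rightarrow> (nat \<Rightarrow> 'm) \<Rightarrow> bool"
  where "chain_map_between n D A C X Y f \<longleftrightarrow>
    chain_map n D X Y f \<and> f 0 = idn D A \<and> f (n + 1) = idn D C"

definition homotopy_equivalent ::
    "nat \<Rightarrow> ('o, 'm) category_data \<Rightarrow> 'o \<Rightarrow> 'o \<Rightarrow> ('o, 'm) cpx \<Rightarrow> ('o, 'm) cpx \<Rightarrow> bool"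
  where "homotopy_equivalent n D A C X Y \<longleftrightarrow>
    (\<exists>f g. chain_map_between n D A C X Y f \<and> chain_map_between n D A C Y X g \<and>
      homotopic n D X X (\<lambda>i. cmp D (g i) (f i)) (\<lambda>i. idn D (ob X i)) \<and>
      homotopic n D Y Y (\<lambda>i. cmp D (f i) (g i)) (\<lambda>i. idn D (ob Y i)))"

definition homotopy_class ::
    "nat \<Rightarrow> ('o, 'm) category_data \<Rightarrow> 'o \<Rightarrow> 'o \<Rightarrow> ('o, 'm) cpx \<Rightarrow> ('o, 'm) cpx set"
  where "homotopy_class n D A C X =
    {Y \<in> complexes_between n D A C. homotopy_equivalent n D A C X Y}"

definition triv :: "('o, 'm) category_data \<Rightarrow> nat \<Rightarrow> 'o \<Rightarrow> ('o, 'm) cpx"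
  where "triv D i A =
    (let T = (\<lambda>j. if j = i \<or> j = i + 1 then A else zob D) in
      \<lparr>ob = T, df = (\<lambda>j. if j = i then idn D A else zmor D (T j) (T (j + 1)))\<rparr>)"

text \<open>The mapping cones \<open>M\<^sup>f\<close> and \<open>N\<^sup>f\<close>, indexed from \<open>0\<close>.\<close>

definition coneM ::
    "nat \<Rightarrow> ('o, 'm) category_data \<Rightarrow> ('o, 'm) cpx \<Rightarrow> ('o, 'm) cpx \<Rightarrow> (nat \<Rightarrow> 'm) \<Rightarrow> ('o, 'm) cpx"
  where "coneM n D X Y f =
    \<lparr>ob = (\<lambda>i. if i = 0 then ob X 1
               else if i \<le> n then dsum D (ob X (i + 1)) (ob Y i)
               else ob Y (n + 1)),
     df = (\<lambda>i. if i = 0 then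
                 mcol D (ob X 1) (ob X 2) (ob Y 1) (inv\<^bsub>Hom D (ob X 1) (ob X 2)\<^esub> df X 1) (f 1)
               else if i < n then
                 mmat D (ob X (i + 1)) (ob Y i) (ob X (i + 2)) (ob Y (i + 1))
                   (inv\<^bsub>Hom D (ob X (i + 1)) (ob X (i + 2))\<^esub> df X (i + 1))
                   (zmor D (ob Y i) (ob X (i + 2)))
                   (f (i + 1)) (df Y i)
               else
                 mrow D (ob X (n + 1)) (ob Y n) (ob Y (n + 1)) (f (n + 1)) (df Y n))\<rparr>"

definition coneN ::
    "nat \<Rightarrow> ('o, 'm) category_data \<Rightarrow> ('o, 'm) cpx \<Rightarrow> ('o, 'm) cpx \<Rightarrow> (nat \<Rightarrow> 'm) \<Rightarrow> ('o, 'm) cpx"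
  where "coneN n D X Y f =
    \<lparr>ob = (\<lambda>i. if i = 0 then ob X 0
               else if i \<le> n then dsum D (ob X i) (ob Y (i - 1))
               else ob Y n),
     df = (\<lambda>i. if i = 0 then
                 mcol D (ob X 0) (ob X 1) (ob Y 0) (df X 0) (f 0)
               else if i < n then
                 mmat D (ob X i) (ob Y (i - 1)) (ob X (i + 1)) (ob Y i)
                   (df X i) (zmor D (ob Y (i - 1)) (ob X (i + 1)))
                   (f i) (inv\<^bsub>Hom D (ob Y (i - 1)) (ob Y i)\<^esub> df Y (i - 1))
               else
                 mrow D (ob X n) (ob Y (n - 1)) (ob Y n)
                   (f n) (inv\<^bsub>Hom D (ob Y (n - 1)) (ob Y n)\<^esub> df Y (n - 1)))\<rparr>"

section \<open>Extensions\<close>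

text \<open>
  A bifunctor, contravariant in the first and covariant in the second argument, with
  values in abelian groups: \<open>ext G C A\<close> is its value at \<open>(C, A)\<close> and \<open>act G c a\<close> its value
  at the pair of morphisms \<open>(c, a)\<close>.
\<close>

record ('o, 'm, 'e) bifunctor_data =
  ext :: "'o \<Rightarrow> 'o \<Rightarrow> 'e monoid"
  act :: "'m \<Rightarrow> 'm \<Rightarrow> 'e \<Rightarrow> 'e"

definition push ::
    "('o, 'm) category_data \<Rightarrow> ('o, 'm, 'e) bifunctor_data \<Rightarrow> 'o \<Rightarrow> 'm \<Rightarrow> 'e \<Rightarrow> 'e"
  where "push D G C a = act G (idn D C) a"

definition pull ::
    "('o, 'm) category_data \<Rightarrow> ('o, 'm, 'e) bifunctor_data \<Rightarrow> 'o \<Rightarrow> 'm \<Rightarrow> 'e \<Rightarrow> 'e"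
  where "pull D G A c = act G c (idn D A)"

locale biadditive_functor = additive_category D
  for D :: "('o, 'm) category_data" (structure) +
  fixes G :: "('o, 'm, 'e) bifunctor_data"
  assumes ext_comm_group: "\<lbrakk>C \<in> obj D; A \<in> obj D\<rbrakk> \<Longrightarrow> comm_group (ext G C A)"
    and act_hom:
      "\<lbrakk>A \<in> obj D; B \<in> obj D; C \<in> obj D; C' \<in> obj D; a \<in> mor D A B; c \<in> mor D C' C\<rbrakk>
        \<Longrightarrow> act G c a \<in> hom (ext G C A) (ext G C' B)"
    and act_idn:
      "\<lbrakk>A \<in> obj D; C \<in> obj D; \<delta> \<in> carrier (ext G C A)\<rbrakk>
        \<Longrightarrow> act G (idn D C) (idn D A) \<delta> = \<delta>"
    and act_cmp:
      "\<lbrakk>A \<in> obj D; A' \<in> obj D; A'' \<in> obj D; C \<in> obj D; C' \<in> obj D; C'' \<in> obj D;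
        a \<in> mor D A A'; a' \<in> mor D A' A''; c \<in> mor D C' C; c' \<in> mor D C'' C';
        \<delta> \<in> carrier (ext G C A)\<rbrakk>
        \<Longrightarrow> act G (c \<cdot> c') (a' \<cdot> a) \<delta> = act G c' a' (act G c a \<delta>)"
    and push_add:
      "\<lbrakk>A \<in> obj D; B \<in> obj D; C \<in> obj D; a \<in> mor D A B; a' \<in> mor D A B;
        \<delta> \<in> carrier (ext G C A)\<rbrakk>
        \<Longrightarrow> push D G C (a \<otimes>\<^bsub>Hom D A B\<^esub> a') \<delta> = push D G C a \<delta> \<otimes>\<^bsub>ext G C B\<^esub> push D G C a' \<delta>"
    and pull_add:
      "\<lbrakk>A \<in> obj D; C \<in> obj D; C' \<in> obj D; c \<in> mor D C' C; c' \<in> mor D C' C;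
        \<delta> \<in> carrier (ext G C A)\<rbrakk>
        \<Longrightarrow> pull D G A (c \<otimes>\<^bsub>Hom D C' C\<^esub> c') \<delta> = pull D G A c \<delta> \<otimes>\<^bsub>ext G C' A\<^esub> pull D G A c' \<delta>"

text \<open>\<open>(a, c)\<close> is a morphism from \<open>\<delta> \<in> ext G C A\<close> to \<open>\<rho> \<in> ext G C' B\<close>.\<close>

definition ext_morphism ::
    "('o, 'm) category_data \<Rightarrow> ('o, 'm, 'e) bifunctor_data \<Rightarrow> 'o \<Rightarrow> 'o \<Rightarrow> 'e \<Rightarrow> 'o \<Rightarrow> 'o \<Rightarrow> 'e
      \<Rightarrow> 'm \<Rightarrow> 'm \<Rightarrow> bool"
  where "ext_morphism D G C A \<delta> C' B \<rho> a c \<longleftrightarrow>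
    a \<in> mor D A B \<and> c \<in> mor D C C' \<and> push D G C a \<delta> = pull D G B c \<rho>"

definition n_exangle ::
    "nat \<Rightarrow> ('o, 'm) category_data \<Rightarrow> ('o, 'm, 'e) bifunctor_data \<Rightarrow> ('o, 'm) cpx \<Rightarrow> 'e \<Rightarrow> bool"
  where "n_exangle n D G X \<delta> \<longleftrightarrow>
    is_complex n D X \<and> \<delta> \<in> carrier (ext G (ob X (n + 1)) (ob X 0)) \<and>
    push D G (ob X (n + 1)) (df X 0) \<delta> = \<one>\<^bsub>ext G (ob X (n + 1)) (ob X 1)\<^esub> \<and>
    pull D G (ob X 0) (df X n) \<delta> = \<one>\<^bsub>ext G (ob X n) (ob X 0)\<^esub> \<and>
    (\<forall>W \<in> obj D.
      (\<forall>i < n. (\<lambda>g. cmp D (df X i) g) ` mor D W (ob X i) =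
         kernel (Hom D W (ob X (i + 1))) (Hom D W (ob X (i + 2))) (\<lambda>g. cmp D (df X (i + 1)) g)) \<and>
      (\<lambda>g. cmp D (df X n) g) ` mor D W (ob X n) =
         kernel (Hom D W (ob X (n + 1))) (ext G W (ob X 0)) (\<lambda>f. pull D G (ob X 0) f \<delta>) \<and>
      (\<forall>i < n. (\<lambda>g. cmp D g (df X (i + 1))) ` mor D (ob X (i + 2)) W =
         kernel (Hom D (ob X (i + 1)) W) (Hom D (ob X i) W) (\<lambda>g. cmp D g (df X i))) \<and>
      (\<lambda>g. cmp D g (df X 0)) ` mor D (ob X 1) W =
         kernel (Hom D (ob X 0) W) (ext G (ob X (n + 1)) W) (\<lambda>g. push D G (ob X (n + 1)) g \<delta>))"

section \<open>n-exangulated categories\<close>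

text \<open>
  The class assigned to \<open>\<delta> \<in> ext G C A\<close> is \<open>r C A \<delta>\<close>; the end terms are explicit because
  groups of extensions for different end terms may overlap.
\<close>

type_synonym ('o, 'm, 'e) realisation = "'o \<Rightarrow> 'o \<Rightarrow> 'e \<Rightarrow> ('o, 'm) cpx set"

definition realises ::
    "nat \<Rightarrow> ('o, 'm) category_data \<Rightarrow> ('o, 'm, 'e) realisation \<Rightarrow> 'o \<Rightarrow> 'o \<Rightarrow> 'e
      \<Rightarrow> ('o, 'm) cpx \<Rightarrow> bool"
  where "realises n D r C A \<delta> X \<longleftrightarrow>
    X \<in> complexes_between n D A C \<and> homotopy_class n D A C X = r C A \<delta>"

locale exact_realisation = biadditive_functor D G
  for n :: nat and D :: "('o, 'm) category_data" (structure)
    and G :: "('o, 'm, 'e) bifunctor_data" +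
  fixes r :: "('o, 'm, 'e) realisation"
  assumes realised:
      "\<lbrakk>A \<in> obj D; C \<in> obj D; \<delta> \<in> carrier (ext G C A)\<rbrakk> \<Longrightarrow> \<exists>X. realises n D r C A \<delta> X"
    and R0:
      "\<lbrakk>A \<in> obj D; B \<in> obj D; C \<in> obj D; C' \<in> obj D;
        \<delta> \<in> carrier (ext G C A); \<rho> \<in> carrier (ext G C' B);
        realises n D r C A \<delta> X; realises n D r C' B \<rho> Y; ext_morphism D G C A \<delta> C' B \<rho> a c\<rbrakk>
        \<Longrightarrow> \<exists>f. chain_map n D X Y f \<and> f 0 = a \<and> f (n + 1) = c"
    and R1:
      "\<lbrakk>A \<in> obj D; C \<in> obj D; \<delta> \<in> carrier (ext G C A); realises n D r C A \<delta> X\<rbrakk>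
        \<Longrightarrow> n_exangle n D G X \<delta>"
    and R2_left:
      "A \<in> obj D \<Longrightarrow>
        r (zob D) A \<one>\<^bsub>ext G (zob D) A\<^esub> = homotopy_class n D A (zob D) (triv D 0 A)"
    and R2_right:
      "C \<in> obj D \<Longrightarrow>
        r C (zob D) \<one>\<^bsub>ext G C (zob D)\<^esub> = homotopy_class n D (zob D) C (triv D n C)"

definition distinguished ::
    "nat \<Rightarrow> ('o, 'm) category_data \<Rightarrow> ('o, 'm, 'e) bifunctor_data \<Rightarrow> ('o, 'm, 'e) realisation
      \<Rightarrow> ('o, 'm) cpx \<Rightarrow> 'e \<Rightarrow> bool"
  where "distinguished n D G r X \<delta> \<longleftrightarrow>
    \<delta> \<in> carrier (ext G (ob X (n + 1)) (ob X 0)) \<and> realises n D r (ob X (n + 1)) (ob X 0) \<delta> X"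

definition conflation ::
    "nat \<Rightarrow> ('o, 'm) category_data \<Rightarrow> ('o, 'm, 'e) bifunctor_data \<Rightarrow> ('o, 'm, 'e) realisation
      \<Rightarrow> ('o, 'm) cpx \<Rightarrow> bool"
  where "conflation n D G r X \<longleftrightarrow> (\<exists>\<delta>. distinguished n D G r X \<delta>)"

definition inflation ::
    "nat \<Rightarrow> ('o, 'm) category_data \<Rightarrow> ('o, 'm, 'e) bifunctor_data \<Rightarrow> ('o, 'm, 'e) realisation
      \<Rightarrow> 'm \<Rightarrow> bool"
  where "inflation n D G r f \<longleftrightarrow> (\<exists>X. conflation n D G r X \<and> df X 0 = f)"

definition deflation ::
    "nat \<Rightarrow> ('o, 'm) category_data \<Rightarrow> ('o, 'm, 'e) bifunctor_data \<Rightarrow> ('o, 'm, 'e) realisation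
      \<Rightarrow> 'm \<Rightarrow> bool"
  where "deflation n D G r f \<longleftrightarrow> (\<exists>X. conflation n D G r X \<and> df X n = f)"

locale n_exangulated_category = exact_realisation n D G r
  for n :: nat and D :: "('o, 'm) category_data" (structure)
    and G :: "('o, 'm, 'e) bifunctor_data" and r :: "('o, 'm, 'e) realisation" +
  assumes EA1:
      "\<lbrakk>A \<in> obj D; B \<in> obj D; C \<in> obj D; f \<in> mor D A B; g \<in> mor D B C;
        inflation n D G r f; inflation n D G r g\<rbrakk> \<Longrightarrow> inflation n D G r (g \<cdot> f)"
    and EA1_op:
      "\<lbrakk>A \<in> obj D; B \<in> obj D; C \<in> obj D; f \<in> mor D A B; g \<in> mor D B C;
        deflation n D G r f; deflation n D G r g\<rbrakk> \<Longrightarrow> deflation n D G r (g \<cdot> f)"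
    and EA2:
      "\<lbrakk>ob X 0 = ob Y 0; c \<in> mor D (ob X (n + 1)) (ob Y (n + 1));
        distinguished n D G r X (pull D G (ob Y 0) c \<rho>); distinguished n D G r Y \<rho>\<rbrakk>
        \<Longrightarrow> \<exists>f. chain_map n D X Y f \<and> f 0 = idn D (ob X 0) \<and> f (n + 1) = c \<and>
              distinguished n D G r (coneM n D X Y f) (push D G (ob Y (n + 1)) (df X 0) \<rho>)"
    and EA2_op:
      "\<lbrakk>ob X (n + 1) = ob Y (n + 1); a \<in> mor D (ob X 0) (ob Y 0);
        distinguished n D G r X \<delta>; distinguished n D G r Y (push D G (ob X (n + 1)) a \<delta>)\<rbrakk>
        \<Longrightarrow> \<exists>f. chain_map n D X Y f \<and> f 0 = a \<and> f (n + 1) = idn D (ob X (n + 1)) \<and>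
              distinguished n D G r (coneN n D X Y f) (pull D G (ob X 0) (df Y n) \<delta>)"

section \<open>Functors\<close>

record ('o, 'm, 'p, 'k) functor_data =
  fob :: "'o \<Rightarrow> 'p"
  fmor :: "'m \<Rightarrow> 'k"

locale additive_functor = D: additive_category D + D': additive_category D'
  for D :: "('o, 'm) category_data" and D' :: "('p, 'k) category_data" +
  fixes F :: "('o, 'm, 'p, 'k) functor_data"
  assumes fob_obj: "A \<in> obj D \<Longrightarrow> fob F A \<in> obj D'"
    and fmor_hom:
      "\<lbrakk>A \<in> obj D; B \<in> obj D\<rbrakk> \<Longrightarrow> fmor F \<in> hom (Hom D A B) (Hom D' (fob F A) (fob F B))"
    and fmor_idn: "A \<in> obj D \<Longrightarrow> fmor F (idn D A) = idn D' (fob F A)"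
    and fmor_cmp:
      "\<lbrakk>A \<in> obj D; B \<in> obj D; C \<in> obj D; f \<in> mor D A B; g \<in> mor D B C\<rbrakk>
        \<Longrightarrow> fmor F (cmp D g f) = cmp D' (fmor F g) (fmor F f)"

definition fcpx :: "('o, 'm, 'p, 'k) functor_data \<Rightarrow> ('o, 'm) cpx \<Rightarrow> ('p, 'k) cpx"
  where "fcpx F X = \<lparr>ob = (\<lambda>i. fob F (ob X i)), df = (\<lambda>i. fmor F (df X i))\<rparr>"

definition fully_faithful ::
    "('o, 'm) category_data \<Rightarrow> ('p, 'k) category_data \<Rightarrow> ('o, 'm, 'p, 'k) functor_data \<Rightarrow> bool"
  where "fully_faithful D D' F \<longleftrightarrow>
    (\<forall>A \<in> obj D. \<forall>B \<in> obj D. bij_betw (fmor F) (mor D A B) (mor D' (fob F A) (fob F B)))"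

text \<open>Natural transformations from \<open>G(-,-)\<close> to \<open>G'(F-,F-)\<close>.\<close>

definition ext_transformation ::
    "('o, 'm) category_data \<Rightarrow> ('o, 'm, 'e) bifunctor_data \<Rightarrow> ('p, 'k, 'd) bifunctor_data
      \<Rightarrow> ('o, 'm, 'p, 'k) functor_data \<Rightarrow> ('o \<Rightarrow> 'o \<Rightarrow> 'e \<Rightarrow> 'd) \<Rightarrow> bool"
  where "ext_transformation D G G' F \<Gamma> \<longleftrightarrow>
    (\<forall>C \<in> obj D. \<forall>A \<in> obj D. \<Gamma> C A \<in> hom (ext G C A) (ext G' (fob F C) (fob F A))) \<and>
    (\<forall>A \<in> obj D. \<forall>B \<in> obj D. \<forall>C \<in> obj D. \<forall>C' \<in> obj D.
      \<forall>a \<in> mor D A B. \<forall>c \<in> mor D C' C. \<forall>\<delta> \<in> carrier (ext G C A).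
        \<Gamma> C' B (act G c a \<delta>) = act G' (fmor F c) (fmor F a) (\<Gamma> C A \<delta>))"

definition ext_isomorphism ::
    "('o, 'm) category_data \<Rightarrow> ('o, 'm, 'e) bifunctor_data \<Rightarrow> ('p, 'k, 'd) bifunctor_data
      \<Rightarrow> ('o, 'm, 'p, 'k) functor_data \<Rightarrow> ('o \<Rightarrow> 'o \<Rightarrow> 'e \<Rightarrow> 'd) \<Rightarrow> bool"
  where "ext_isomorphism D G G' F \<Gamma> \<longleftrightarrow>
    ext_transformation D G G' F \<Gamma> \<and>
    (\<forall>C \<in> obj D. \<forall>A \<in> obj D. \<Gamma> C A \<in> iso (ext G C A) (ext G' (fob F C) (fob F A)))"

locale n_exangulated_functor =
  D: n_exangulated_category n D G r + D': n_exangulated_category n D' G' r' +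
  additive_functor D D' F
  for n :: nat
    and D :: "('o, 'm) category_data" and G :: "('o, 'm, 'e) bifunctor_data"
    and r :: "('o, 'm, 'e) realisation"
    and D' :: "('p, 'k) category_data" and G' :: "('p, 'k, 'd) bifunctor_data"
    and r' :: "('p, 'k, 'd) realisation"
    and F :: "('o, 'm, 'p, 'k) functor_data" +
  fixes \<Gamma> :: "'o \<Rightarrow> 'o \<Rightarrow> 'e \<Rightarrow> 'd"
  assumes transformation: "ext_transformation D G G' F \<Gamma>"
    and preserves_realisation:
      "\<lbrakk>A \<in> obj D; C \<in> obj D; \<delta> \<in> carrier (ext G C A); realises n D r C A \<delta> X\<rbrakk>
        \<Longrightarrow> realises n D' r' (fob F C) (fob F A) (\<Gamma> C A \<delta>) (fcpx F X)"

section \<open>Extension closed subcategories\<close>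

definition additive_subcategory :: "('o, 'm) category_data \<Rightarrow> 'o set \<Rightarrow> bool"
  where "additive_subcategory D \<A> \<longleftrightarrow>
    \<A> \<subseteq> obj D \<and> zob D \<in> \<A> \<and> (\<forall>A \<in> \<A>. \<forall>B \<in> \<A>. dsum D A B \<in> \<A>) \<and>
    (\<forall>A \<in> \<A>. \<forall>B \<in> obj D. isomorphic D A B \<longrightarrow> B \<in> \<A>)"

definition n_extension_closed ::
    "nat \<Rightarrow> ('o, 'm) category_data \<Rightarrow> ('o, 'm, 'e) bifunctor_data \<Rightarrow> ('o, 'm, 'e) realisation
      \<Rightarrow> 'o set \<Rightarrow> bool"
  where "n_extension_closed n D G r \<A> \<longleftrightarrow>
    (\<forall>A \<in> \<A>. \<forall>C \<in> \<A>. \<forall>\<delta> \<in> carrier (ext G C A).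
      \<exists>X. ob X 0 = A \<and> ob X (n + 1) = C \<and> distinguished n D G r X \<delta> \<and>
          (\<forall>i \<le> n + 1. ob X i \<in> \<A>))"

text \<open>
  Only the set of objects changes: by the convention above, the morphisms, the zero object
  and the direct sums of the full subcategory are those of \<open>D\<close> on the smaller set of
  objects. In the same way the bifunctor data \<open>G\<close>, read over \<open>full_subcategory D \<A>\<close>,
  are the restriction of \<open>G\<close>.
\<close>

definition full_subcategory :: "('o, 'm) category_data \<Rightarrow> 'o set \<Rightarrow> ('o, 'm) category_data"
  where "full_subcategory D \<A> = D\<lparr>obj := \<A>\<rparr>"

definition induced_realisation ::
    "nat \<Rightarrow> ('o, 'm) category_data \<Rightarrow> ('o, 'm, 'e) bifunctor_data \<Rightarrow> ('o, 'm, 'e) realisation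
      \<Rightarrow> 'o set \<Rightarrow> ('o, 'm, 'e) realisation"
  where "induced_realisation n D G r \<A> C A \<delta> =
    homotopy_class n (full_subcategory D \<A>) A C
      (SOME X. ob X 0 = A \<and> ob X (n + 1) = C \<and> distinguished n D G r X \<delta> \<and>
          (\<forall>i \<le> n + 1. ob X i \<in> \<A>))"

definition inclusion_functor :: "('o, 'm, 'o, 'm) functor_data"
  where "inclusion_functor = \<lparr>fob = (\<lambda>A. A), fmor = (\<lambda>f. f)\<rparr>"

definition inclusion_transformation :: "'o \<Rightarrow> 'o \<Rightarrow> 'e \<Rightarrow> 'e"
  where "inclusion_transformation C A \<delta> = \<delta>"

end

theory Submission
  imports Defs
begin

text \<open>
Every datum of the induced structure is the given one restricted to \<open>\<A>\<close>, and a conflation of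
the induced structure is exactly a conflation with all its terms in \<open>\<A>\<close>
(\<open>sub_distinguished_iff\<close>). So nearly every axiom is inherited. For the mapping cone axioms it
matters that the terms of a cone are direct sums of the given terms, hence in \<open>\<A>\<close> again. What
needs an argument is that a composite \<open>g \<cdot> f\<close> of inflations with conflations \<open>X\<close>, \<open>Y\<close> in \<open>\<A>\<close> is
an inflation with a conflation in \<open>\<A>\<close>. It has some conflation \<open>W\<close>, with extension \<open>\<tau>\<close>, but
neither the end term nor the middle terms of \<open>W\<close> need lie in \<open>\<A>\<close>, which is not assumed to be
closed under direct summands.

Let \<open>Z\<close> realise \<open>(d\<^sub>1\<^sup>X)\<^sub>*\<rho>\<close> in \<open>\<A>\<close>, where \<open>\<rho>\<close> is the extension of \<open>Y\<close>. The cone of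
a chain map \<open>X \<rightarrow> W\<close> over the identity of \<open>X\<^sub>0\<close> starts with \<open>X\<^sub>1\<close>, and its exactness
compares the end term of \<open>W\<close> with \<open>Z\<^sub>n\<close>.

For \<open>n = 1\<close> the comparison is an isomorphism: the cone and the dual cone of a chain map
\<open>Y \<rightarrow> Z\<close> are conflations which begin, up to an automorphism of the middle term, with the same
morphism \<open>X\<^sub>1 \<rightarrow> Y\<^sub>1 \<oplus> X\<^sub>2\<close>. So the end term of \<open>W\<close> is isomorphic to \<open>Z\<^sub>1\<close>, and \<open>W\<close> lies in
\<open>\<A>\<close> (\<open>end_in_subcategory\<close>).

For \<open>n \<ge> 2\<close> it only gives morphisms \<open>v\<close> and \<open>v'\<close> between \<open>Z\<^sub>n \<oplus> X\<^bsub>n+1\<^esub>\<close> and the end term of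
\<open>W\<close> such that \<open>v \<cdot> v'\<close> fixes \<open>\<tau>\<close> (\<open>extension_retract\<close>). Realise \<open>v\<^sup>*\<tau>\<close> by \<open>K\<close> in \<open>\<A>\<close>. Then
\<open>g \<cdot> f\<close> and \<open>d\<^sub>0\<^sup>K\<close> factor through each other. The term \<open>K\<^sub>1\<close> can now be exchanged for
\<open>Y\<^sub>1\<close>, at the price of adding \<open>Y\<^sub>1\<close> to the term in degree 2 and \<open>K\<^sub>1\<close> to the term in degree 3
(\<open>inflation_exchange\<close>). The new conflation begins with \<open>g \<cdot> f\<close> and lies in \<open>\<A>\<close>.

Two general facts are used throughout. The kernel of \<open>(d\<^sub>0\<^sup>X)\<^sub>*\<close> on extensions consists of the
pullbacks of the extension of \<open>X\<close> (\<open>ext_exact\<close>). And two complexes which are exact after applying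
contravariant Hom functors and which map to each other over the identities of their ends are
homotopy equivalent (\<open>homotopy_equivalentI_right_exact\<close>); this recognises conflations.

Deflations are treated by applying the result on inflations to the opposite category, which is
again \<open>n\<close>-exangulated (\<open>op_n_exangulated_category\<close>).
\<close>

section \<open>Arrows of a preadditive category\<close>

context preadditive_category
begin

text \<open>
  Hom sets of distinct pairs of objects are disjoint, so a morphism has a well-defined domain and
  codomain. With these as functions, the side conditions of the category laws become
  equations between objects which rewriting can discharge; the laws themselves then serve as
  rewrite rules, without objects that would have to be guessed.
\<close>

definition arr :: "'m \<Rightarrow> 'o \<Rightarrow> 'o \<Rightarrow> bool"
  where "arr f A B \<longleftrightarrow> A \<in> obj D \<and> B \<in> obj D \<and> f \<in> mor D A B"

definition ar :: "'m \<Rightarrow> bool"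
  where "ar f \<longleftrightarrow> (\<exists>A B. arr f A B)"

definition dm :: "'m \<Rightarrow> 'o"
  where "dm f = (THE A. \<exists>B. arr f A B)"

definition cd :: "'m \<Rightarrow> 'o"
  where "cd f = (THE B. \<exists>A. arr f A B)"

text \<open>
  The hom group of a sum is read off from the first summand. The result is meaningful only for
  parallel arrows.
\<close>

definition plus :: "'m \<Rightarrow> 'm \<Rightarrow> 'm"  (infixl "\<oplus>" 65)
  where "f \<oplus> g = f \<otimes>\<^bsub>Hom D (dm f) (cd f)\<^esub> g"

definition minus :: "'m \<Rightarrow> 'm \<Rightarrow> 'm"  (infixl "\<ominus>" 65)
  where "f \<ominus> g = f \<otimes>\<^bsub>Hom D (dm f) (cd f)\<^esub> inv\<^bsub>Hom D (dm f) (cd f)\<^esub> g"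

lemma arr_unique: "arr f A B \<Longrightarrow> arr f A' B' \<Longrightarrow> A = A' \<and> B = B'"
  unfolding arr_def using mor_disjoint by blast

lemma arr_iff [simp]: "arr f A B \<longleftrightarrow> ar f \<and> dm f = A \<and> cd f = B"
proof
  assume f: "arr f A B"
  have "dm f = A" unfolding dm_def using f arr_unique by blast
  moreover have "cd f = B" unfolding cd_def using f arr_unique by blast
  ultimately show "ar f \<and> dm f = A \<and> cd f = B" using f unfolding ar_def by blast
next
  assume "ar f \<and> dm f = A \<and> cd f = B"
  moreover from this obtain A' B' where f: "arr f A' B'" unfolding ar_def by blast
  have "dm f = A'" unfolding dm_def using f arr_unique by blast
  moreover have "cd f = B'" unfolding cd_def using f arr_unique by blast
  ultimately show "arr f A B" using f by simp
qed

lemma arrI: "A \<in> obj D \<Longrightarrow> B \<in> obj D \<Longrightarrow> f \<in> mor D A B \<Longrightarrow> arr f A B"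
  unfolding arr_def by simp

lemma ar_dest:
  assumes "ar f"
  shows "dm f \<in> obj D" "cd f \<in> obj D" "f \<in> mor D (dm f) (cd f)"
proof -
  have "arr f (dm f) (cd f)" using assms by simp
  then show "dm f \<in> obj D" "cd f \<in> obj D" "f \<in> mor D (dm f) (cd f)"
    unfolding arr_def by blast+
qed

lemma mor_iff: "A \<in> obj D \<Longrightarrow> B \<in> obj D \<Longrightarrow> f \<in> mor D A B \<longleftrightarrow> ar f \<and> dm f = A \<and> cd f = B"
  by (metis arr_iff arr_def)

lemma ar_cmp [simp]:
  assumes "ar f" "ar g" "dm g = cd f"
  shows "ar (g \<cdot> f)" "dm (g \<cdot> f) = dm f" "cd (g \<cdot> f) = cd g"
proof -
  have "arr (g \<cdot> f) (dm f) (cd g)"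
    unfolding arr_def using assms cmp_mor ar_dest by metis
  then show "ar (g \<cdot> f)" "dm (g \<cdot> f) = dm f" "cd (g \<cdot> f) = cd g" by simp_all
qed

lemma ar_idn [simp]:
  assumes "A \<in> obj D"
  shows "ar (idn D A)" "dm (idn D A) = A" "cd (idn D A) = A"
  using assms idn_mor mor_iff by blast+

lemma group_dest:
  assumes "ar f"
  shows "comm_group (Hom D (dm f) (cd f))"
  using assms ar_dest Hom_comm_group by blast

lemma ar_zmor [simp]:
  assumes "A \<in> obj D" "B \<in> obj D"
  shows "ar (zmor D A B)" "dm (zmor D A B) = A" "cd (zmor D A B) = B"
proof -
  have "zmor D A B \<in> mor D A B"
    using Hom_comm_group[OF assms] comm_group_def group.is_monoid monoid.one_closed by blast
  then show "ar (zmor D A B)" "dm (zmor D A B) = A" "cd (zmor D A B) = B"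
    using assms mor_iff by blast+
qed

lemma ar_plus [simp]:
  assumes "ar f" "ar g" "dm g = dm f" "cd g = cd f"
  shows "ar (f \<oplus> g)" "dm (f \<oplus> g) = dm f" "cd (f \<oplus> g) = cd f"
proof -
  interpret H: comm_group "Hom D (dm f) (cd f)" using group_dest[OF assms(1)] .
  have "arr (f \<oplus> g) (dm f) (cd f)"
    unfolding plus_def arr_def using assms ar_dest by (metis H.m_closed)
  then show "ar (f \<oplus> g)" "dm (f \<oplus> g) = dm f" "cd (f \<oplus> g) = cd f" by simp_all
qed

lemma ar_minus [simp]:
  assumes "ar f" "ar g" "dm g = dm f" "cd g = cd f"
  shows "ar (f \<ominus> g)" "dm (f \<ominus> g) = dm f" "cd (f \<ominus> g) = cd f"
proof -
  interpret H: comm_group "Hom D (dm f) (cd f)" using group_dest[OF assms(1)] .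
  have "arr (f \<ominus> g) (dm f) (cd f)"
    unfolding minus_def arr_def using assms ar_dest by (metis H.m_closed H.inv_closed)
  then show "ar (f \<ominus> g)" "dm (f \<ominus> g) = dm f" "cd (f \<ominus> g) = cd f" by simp_all
qed

lemma cmp_assoc' [simp]:
  assumes "ar f" "ar g" "ar h" "dm g = cd f" "dm h = cd g"
  shows "(h \<cdot> g) \<cdot> f = h \<cdot> (g \<cdot> f)"
  using assms cmp_assoc ar_dest by metis

lemma idn_cmp' [simp]: "ar f \<Longrightarrow> cd f = A \<Longrightarrow> idn D A \<cdot> f = f"
  using idn_cmp ar_dest by blast

lemma cmp_idn' [simp]: "ar f \<Longrightarrow> dm f = A \<Longrightarrow> f \<cdot> idn D A = f"
  using cmp_idn ar_dest by blast

lemma plus_zmor [simp]: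
  assumes "ar f" "dm f = A" "cd f = B"
  shows "f \<oplus> zmor D A B = f" "zmor D A B \<oplus> f = f" "f \<ominus> zmor D A B = f"
proof -
  interpret H: comm_group "Hom D A B" using group_dest[OF assms(1)] assms by simp
  have "f \<in> mor D A B" "A \<in> obj D" "B \<in> obj D" using ar_dest assms by auto
  then show "f \<oplus> zmor D A B = f" "zmor D A B \<oplus> f = f" "f \<ominus> zmor D A B = f"
    unfolding plus_def minus_def using assms by auto
qed

lemma
  assumes "ar f" "ar g" "dm g = dm f" "cd g = cd f"
  shows plus_commute: "f \<oplus> g = g \<oplus> f"
    and minus_self: "f \<ominus> f = zmor D (dm f) (cd f)"
proof -
  interpret H: comm_group "Hom D (dm f) (cd f)" using group_dest[OF assms(1)] assms by simp
  have m: "f \<in> mor D (dm f) (cd f)" "g \<in> mor D (dm f) (cd f)" using ar_dest assms by metis+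
  then show "f \<oplus> g = g \<oplus> f" "f \<ominus> f = zmor D (dm f) (cd f)"
    unfolding plus_def minus_def using assms H.m_comm by simp_all
qed

lemma
  assumes "ar f" "ar g" "ar h" "dm g = dm f" "cd g = cd f" "dm h = dm f" "cd h = cd f"
  shows plus_assoc: "(f \<oplus> g) \<oplus> h = f \<oplus> (g \<oplus> h)"
    and plus_left_commute: "g \<oplus> (f \<oplus> h) = f \<oplus> (g \<oplus> h)"
    and plus_minus_right: "f \<oplus> (g \<ominus> h) = (f \<oplus> g) \<ominus> h"
    and plus_minus_left: "(g \<ominus> h) \<oplus> f = (g \<oplus> f) \<ominus> h"
    and minus_minus_left: "(f \<ominus> g) \<ominus> h = f \<ominus> (g \<oplus> h)"
    and minus_minus_right: "f \<ominus> (g \<ominus> h) = (f \<oplus> h) \<ominus> g"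
    and eq_minus_iff: "f = g \<ominus> h \<longleftrightarrow> f \<oplus> h = g"
    and minus_eq_iff: "g \<ominus> h = f \<longleftrightarrow> g = f \<oplus> h"
proof -
  let ?H = "Hom D (dm f) (cd f)"
  interpret H: comm_group ?H using group_dest[OF assms(1)] assms by simp
  have m [simp]: "f \<in> carrier ?H" "g \<in> carrier ?H" "h \<in> carrier ?H"
    using ar_dest(3)[OF assms(1)] ar_dest(3)[OF assms(2)] ar_dest(3)[OF assms(3)] assms by simp_all
  have t: "dm x = dm f" "cd x = cd f" if "x \<in> carrier ?H" for x
    using that mor_iff ar_dest(1,2)[OF assms(1)] by blast+
  have p: "x \<oplus> y = x \<otimes>\<^bsub>?H\<^esub> y" "x \<ominus> y = x \<otimes>\<^bsub>?H\<^esub> inv\<^bsub>?H\<^esub> y"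
    if "x \<in> carrier ?H" "y \<in> carrier ?H" for x y
    using t[OF that(1)] by (simp_all add: plus_def minus_def)
  show "(f \<oplus> g) \<oplus> h = f \<oplus> (g \<oplus> h)" "g \<oplus> (f \<oplus> h) = f \<oplus> (g \<oplus> h)"
    by (simp_all add: p H.m_ac)
  show "f \<oplus> (g \<ominus> h) = (f \<oplus> g) \<ominus> h" "(g \<ominus> h) \<oplus> f = (g \<oplus> f) \<ominus> h"
    "(f \<ominus> g) \<ominus> h = f \<ominus> (g \<oplus> h)" "f \<ominus> (g \<ominus> h) = (f \<oplus> h) \<ominus> g"
    by (simp_all add: p H.m_ac H.inv_mult)
  show "f = g \<ominus> h \<longleftrightarrow> f \<oplus> h = g"
    by (auto simp add: p H.inv_solve_right)
  then show "g \<ominus> h = f \<longleftrightarrow> g = f \<oplus> h" by metis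
qed

lemma cmp_plus [simp]:
  assumes "ar f" "ar g" "ar h" "dm g = dm f" "cd g = cd f" "dm h = cd f"
  shows "h \<cdot> (f \<oplus> g) = h \<cdot> f \<oplus> h \<cdot> g"
  using ar_dest[OF assms(1)] ar_dest[OF assms(2)] ar_dest[OF assms(3)] assms
    cmp_left_hom[THEN hom_mult, of "dm f" "cd f" "cd h" h f g]
  by (simp add: plus_def)

lemma plus_cmp [simp]:
  assumes "ar f" "ar g" "ar h" "dm g = dm f" "cd g = cd f" "cd h = dm f"
  shows "(f \<oplus> g) \<cdot> h = f \<cdot> h \<oplus> g \<cdot> h"
  using ar_dest[OF assms(1)] ar_dest[OF assms(2)] ar_dest[OF assms(3)] assms
    cmp_right_hom[THEN hom_mult, of "dm h" "dm f" "cd f" h f g]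
  by (simp add: plus_def)

lemma minus_plus_cancel [simp]:
  assumes "ar f" "ar g" "dm g = dm f" "cd g = cd f"
  shows "(f \<ominus> g) \<oplus> g = f"
proof -
  have "f \<ominus> g = f \<ominus> g \<longleftrightarrow> f = (f \<ominus> g) \<oplus> g"
    by (rule minus_eq_iff) (simp_all add: assms)
  then show ?thesis by metis
qed

lemma cmp_minus [simp]:
  assumes "ar f" "ar g" "ar h" "dm g = dm f" "cd g = cd f" "dm h = cd f"
  shows "h \<cdot> (f \<ominus> g) = h \<cdot> f \<ominus> h \<cdot> g"
proof -
  have "h \<cdot> (f \<ominus> g) \<oplus> h \<cdot> g = h \<cdot> ((f \<ominus> g) \<oplus> g)"
    by (rule cmp_plus[symmetric]) (simp_all add: assms)
  also have "(f \<ominus> g) \<oplus> g = f" using assms by simp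
  finally show ?thesis using assms by (subst eq_minus_iff) simp_all
qed

lemma minus_cmp [simp]:
  assumes "ar f" "ar g" "ar h" "dm g = dm f" "cd g = cd f" "cd h = dm f"
  shows "(f \<ominus> g) \<cdot> h = f \<cdot> h \<ominus> g \<cdot> h"
proof -
  have "(f \<ominus> g) \<cdot> h \<oplus> g \<cdot> h = ((f \<ominus> g) \<oplus> g) \<cdot> h"
    by (rule plus_cmp[symmetric]) (simp_all add: assms)
  also have "(f \<ominus> g) \<oplus> g = f" using assms by simp
  finally show ?thesis using assms by (subst eq_minus_iff) simp_all
qed

lemma cmp_zmor [simp]:
  assumes "ar h" "A \<in> obj D" "dm h = B"
  shows "h \<cdot> zmor D A B = zmor D A (cd h)"
proof -
  have B: "B \<in> obj D" "cd h \<in> obj D" using assms ar_dest by auto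
  let ?z = "zmor D A B"
  have "h \<cdot> ?z = h \<cdot> (?z \<ominus> ?z)" using assms B by simp
  also have "\<dots> = h \<cdot> ?z \<ominus> h \<cdot> ?z" using assms B by (intro cmp_minus) simp_all
  finally show ?thesis using assms B minus_self[of "h \<cdot> ?z" "h \<cdot> ?z"] by simp
qed

lemma zmor_cmp [simp]:
  assumes "ar h" "C \<in> obj D" "cd h = B"
  shows "zmor D B C \<cdot> h = zmor D (dm h) C"
proof -
  have B: "B \<in> obj D" "dm h \<in> obj D" using assms ar_dest by auto
  let ?z = "zmor D B C"
  have "?z \<cdot> h = (?z \<ominus> ?z) \<cdot> h" using assms B by simp
  also have "\<dots> = ?z \<cdot> h \<ominus> ?z \<cdot> h" using assms B by (intro minus_cmp) simp_all
  finally show ?thesis using assms B minus_self[of "?z \<cdot> h" "?z \<cdot> h"] by simp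
qed

lemma minus_self' [simp]: "ar f \<Longrightarrow> f \<ominus> f = zmor D (dm f) (cd f)"
  using minus_self by blast

text \<open>
  These rules sort sums and move all subtractions in an equation to the other side, so that two
  equal combinations of arrows are rewritten to the same sum. Negation would not serve as well, since
  sorting separates a negated summand from the one that it cancels.
\<close>

lemmas additive_simps = plus_assoc plus_left_commute plus_commute plus_minus_right plus_minus_left
  minus_minus_left minus_minus_right eq_minus_iff minus_eq_iff

lemma inv_eq_minus:
  assumes "ar f" "dm f = A" "cd f = B"
  shows "inv\<^bsub>Hom D A B\<^esub> f = zmor D A B \<ominus> f"
proof -
  interpret H: comm_group "Hom D A B" using group_dest[OF assms(1)] assms by simp
  have "f \<in> mor D A B" "A \<in> obj D" "B \<in> obj D" using ar_dest[OF assms(1)] assms by simp_all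
  then show ?thesis by (simp add: minus_def)
qed

end

section \<open>Chain maps and homotopies\<close>

context preadditive_category
begin

lemma complex_iff:
  "is_complex n D X \<longleftrightarrow>
    (\<forall>i \<le> Suc n. ob X i \<in> obj D) \<and>
    (\<forall>i \<le> n. arr (df X i) (ob X i) (ob X (Suc i))) \<and>
    (\<forall>i < n. df X (Suc i) \<cdot> df X i = zmor D (ob X i) (ob X (Suc (Suc i))))"
  unfolding is_complex_def using mor_iff by auto

lemma complex_dest:
  assumes "is_complex n D X"
  shows "\<And>i. i \<le> Suc n \<Longrightarrow> ob X i \<in> obj D"
    and "\<And>i. i \<le> n \<Longrightarrow> ar (df X i)"
    and "\<And>i. i \<le> n \<Longrightarrow> dm (df X i) = ob X i"
    and "\<And>i. i \<le> n \<Longrightarrow> cd (df X i) = ob X (Suc i)"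
    and "\<And>i. i < n \<Longrightarrow> df X (Suc i) \<cdot> df X i = zmor D (ob X i) (ob X (Suc (Suc i)))"
  using assms unfolding complex_iff by auto

lemma chain_map_iff:
  assumes "is_complex n D X" "is_complex n D Y"
  shows "chain_map n D X Y f \<longleftrightarrow>
    (\<forall>i \<le> Suc n. arr (f i) (ob X i) (ob Y i)) \<and>
    (\<forall>i \<le> n. f (Suc i) \<cdot> df X i = df Y i \<cdot> f i)"
  unfolding chain_map_def using mor_iff complex_dest[OF assms(1)] complex_dest[OF assms(2)] by auto

lemma chain_map_dest:
  assumes "chain_map n D X Y f" "is_complex n D X" "is_complex n D Y"
  shows "\<And>i. i \<le> Suc n \<Longrightarrow> ar (f i)"
    and "\<And>i. i \<le> Suc n \<Longrightarrow> dm (f i) = ob X i"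
    and "\<And>i. i \<le> Suc n \<Longrightarrow> cd (f i) = ob Y i"
    and "\<And>i. i \<le> n \<Longrightarrow> f (Suc i) \<cdot> df X i = df Y i \<cdot> f i"
  using assms chain_map_iff by auto

text \<open>
  This is the condition on the homotopy in \<open>null_homotopic\<close> with the cases of the two end degrees
  separated. The component \<open>h i\<close> starts in degree \<open>i\<close>, whence the successors in the indices.
\<close>

definition contraction ::
    "nat \<Rightarrow> ('o, 'm) cpx \<Rightarrow> ('o, 'm) cpx \<Rightarrow> (nat \<Rightarrow> 'm) \<Rightarrow> (nat \<Rightarrow> 'm) \<Rightarrow> bool"
  where "contraction n X Y k h \<longleftrightarrow>
    (\<forall>i \<le> n. arr (h (Suc i)) (ob X (Suc i)) (ob Y i)) \<and>
    k 0 = h 1 \<cdot> df X 0 \<and>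
    (\<forall>i < n. k (Suc i) = df Y i \<cdot> h (Suc i) \<oplus> h (Suc (Suc i)) \<cdot> df X (Suc i)) \<and>
    k (Suc n) = df Y n \<cdot> h (Suc n)"

lemma contraction_cong:
  "contraction n X Y k h \<Longrightarrow> (\<And>i. i \<le> Suc n \<Longrightarrow> k i = k' i) \<Longrightarrow> contraction n X Y k' h"
  unfolding contraction_def by auto

lemma null_homotopic_iff:
  assumes "is_complex n D X" "is_complex n D Y"
  shows "null_homotopic n D X Y k \<longleftrightarrow> (\<exists>h. contraction n X Y k h)"
proof -
  note [simp] = complex_dest[OF assms(1)] complex_dest[OF assms(2)]
  have "(\<forall>i. 1 \<le> i \<and> i \<le> n + 1 \<longrightarrow> h i \<in> mor D (ob X i) (ob Y (i - 1))) \<and>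
         (\<forall>i \<le> n + 1. k i =
            (if i = 0 then zmor D (ob X i) (ob Y i) else df Y (i - 1) \<cdot> h i)
            \<otimes>\<^bsub>Hom D (ob X i) (ob Y i)\<^esub>
            (if i = n + 1 then zmor D (ob X i) (ob Y i) else h (i + 1) \<cdot> df X i))
        \<longleftrightarrow> contraction n X Y k h" (is "?A \<and> ?B \<longleftrightarrow> _") for h
  proof -
    have A: "?A \<longleftrightarrow> (\<forall>i \<le> n. arr (h (Suc i)) (ob X (Suc i)) (ob Y i))" (is "_ \<longleftrightarrow> ?A'")
    proof -
      have "?A \<longleftrightarrow> (\<forall>i \<le> n. h (Suc i) \<in> mor D (ob X (Suc i)) (ob Y i))"
        by (auto simp: gr0_conv_Suc Suc_le_eq[symmetric])
           (metis Suc_le_D Suc_le_mono diff_Suc_1')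
      then show ?thesis by (auto simp: mor_iff)
    qed
    have "?B \<longleftrightarrow> k 0 = h 1 \<cdot> df X 0 \<and>
      (\<forall>i < n. k (Suc i) = df Y i \<cdot> h (Suc i) \<oplus> h (Suc (Suc i)) \<cdot> df X (Suc i)) \<and>
      k (Suc n) = df Y n \<cdot> h (Suc n)" (is "_ \<longleftrightarrow> ?B'") if h: ?A'
    proof -
      have h' [simp]: "ar (h (Suc i))" "dm (h (Suc i)) = ob X (Suc i)" "cd (h (Suc i)) = ob Y i"
        if "i \<le> n" for i using h that by auto
      have p: "f \<otimes>\<^bsub>Hom D A B\<^esub> g = f \<oplus> g" if "dm f = A" "cd f = B" for f g A B
        using that by (simp add: plus_def)
      define R where "R i =
            (if i = 0 then zmor D (ob X i) (ob Y i) else df Y (i - 1) \<cdot> h i)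
            \<otimes>\<^bsub>Hom D (ob X i) (ob Y i)\<^esub>
            (if i = n + 1 then zmor D (ob X i) (ob Y i) else h (i + 1) \<cdot> df X i)" for i
      have "R 0 = zmor D (ob X 0) (ob Y 0) \<oplus> h 1 \<cdot> df X 0"
        unfolding R_def by (subst p[symmetric]) simp_all
      then have R0: "R 0 = h 1 \<cdot> df X 0" by simp
      have RS: "R (Suc i) = df Y i \<cdot> h (Suc i) \<oplus> h (Suc (Suc i)) \<cdot> df X (Suc i)" if "i < n" for i
        unfolding R_def using that by (subst p[symmetric]) simp_all
      have "R (Suc n) = df Y n \<cdot> h (Suc n) \<oplus> zmor D (ob X (Suc n)) (ob Y (Suc n))"
        unfolding R_def by (subst p[symmetric]) simp_all
      then have Rn: "R (Suc n) = df Y n \<cdot> h (Suc n)" by simp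
      have "?B \<longleftrightarrow> (\<forall>i \<le> n + 1. k i = R i)" unfolding R_def ..
      also have "\<dots> \<longleftrightarrow> (\<forall>i \<in> {0} \<union> Suc ` {..<n} \<union> {Suc n}. k i = R i)"
      proof -
        have "i \<le> n + 1 \<longleftrightarrow> i \<in> {0} \<union> Suc ` {..<n} \<union> {Suc n}" for i by (cases i) auto
        then show ?thesis by blast
      qed
      also have "\<dots> \<longleftrightarrow> ?B'"
        by (auto simp: R0 RS Rn)
      finally show ?thesis .
    qed
    then show ?thesis using A unfolding contraction_def by blast
  qed
  then show ?thesis unfolding null_homotopic_def by metis
qed

lemma homotopic_iff:
  assumes "is_complex n D X" "is_complex n D Y"
    and "\<forall>i \<le> Suc n. arr (f i) (ob X i) (ob Y i)"
  shows "homotopic n D X Y f g \<longleftrightarrow> (\<exists>h. contraction n X Y (\<lambda>i. f i \<ominus> g i) h)"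
proof -
  have e: "f i \<otimes>\<^bsub>Hom D (ob X i) (ob Y i)\<^esub> inv\<^bsub>Hom D (ob X i) (ob Y i)\<^esub> g i = f i \<ominus> g i"
    if "i \<le> Suc n" for i
    using assms(3) that by (simp add: minus_def)
  show ?thesis
    unfolding homotopic_def null_homotopic_iff[OF assms(1,2)]
    by (rule ex_cong1) (use e contraction_cong in \<open>metis (no_types, lifting)\<close>)
qed

lemma contraction_zmor:
  assumes "is_complex n D X" "is_complex n D Y" "\<And>i. i \<le> Suc n \<Longrightarrow> k i = zmor D (ob X i) (ob Y i)"
  shows "contraction n X Y k (\<lambda>i. zmor D (ob X i) (ob Y (i - 1)))"
  using complex_dest[OF assms(1)] complex_dest[OF assms(2)] assms(3)
  unfolding contraction_def by auto

lemma contraction_plus: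
  assumes "is_complex n D X" "is_complex n D Y" "contraction n X Y k h" "contraction n X Y k' h'"
  shows "contraction n X Y (\<lambda>i. k i \<oplus> k' i) (\<lambda>i. h i \<oplus> h' i)"
  using complex_dest[OF assms(1)] complex_dest[OF assms(2)] assms(3,4)
  unfolding contraction_def by (simp add: additive_simps)

lemma contraction_cmp_left:
  assumes "is_complex n D X" "is_complex n D Y" "is_complex n D Z"
    and "contraction n X Y k h" "chain_map n D Y Z g"
  shows "contraction n X Z (\<lambda>i. g i \<cdot> k i) (\<lambda>i. g (i - 1) \<cdot> h i)"
proof -
  note [simp] = complex_dest[OF assms(1)] complex_dest[OF assms(2)] complex_dest[OF assms(3)]
    chain_map_dest(1-3)[OF assms(5,2,3)]
  have c: "df Z i \<cdot> g i \<cdot> x = g (Suc i) \<cdot> df Y i \<cdot> x" if "i \<le> n" "ar x" "cd x = ob Y i" for x i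
  proof -
    have "(df Z i \<cdot> g i) \<cdot> x = (g (Suc i) \<cdot> df Y i) \<cdot> x"
      using chain_map_dest(4)[OF assms(5,2,3)] that by simp
    then show ?thesis using that by simp
  qed
  show ?thesis using assms(4) unfolding contraction_def by (simp add: c)
qed

lemma contraction_cmp_right:
  assumes "is_complex n D W" "is_complex n D X" "is_complex n D Y"
    and "contraction n X Y k h" "chain_map n D W X f"
  shows "contraction n W Y (\<lambda>i. k i \<cdot> f i) (\<lambda>i. h i \<cdot> f i)"
proof -
  note [simp] = complex_dest[OF assms(1)] complex_dest[OF assms(2)] complex_dest[OF assms(3)]
    chain_map_dest(1-3)[OF assms(5,1,2)]
  show ?thesis using assms(4) unfolding contraction_def
    by (simp add: chain_map_dest(4)[OF assms(5,1,2)])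
qed

lemma chain_map_cmp:
  assumes "is_complex n D X" "is_complex n D Y" "is_complex n D Z"
    and "chain_map n D X Y f" "chain_map n D Y Z g"
  shows "chain_map n D X Z (\<lambda>i. g i \<cdot> f i)"
proof -
  note [simp] = complex_dest[OF assms(1)] complex_dest[OF assms(2)] complex_dest[OF assms(3)]
    chain_map_dest(1-3)[OF assms(5,2,3)] chain_map_dest(1-3)[OF assms(4,1,2)]
  have "g (Suc i) \<cdot> f (Suc i) \<cdot> df X i = df Z i \<cdot> g i \<cdot> f i" if i: "i \<le> n" for i
  proof -
    have "g (Suc i) \<cdot> f (Suc i) \<cdot> df X i = (g (Suc i) \<cdot> df Y i) \<cdot> f i"
      using i chain_map_dest(4)[OF assms(4,1,2)] by simp
    also have "\<dots> = (df Z i \<cdot> g i) \<cdot> f i"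
      using i chain_map_dest(4)[OF assms(5,2,3)] by simp
    finally show ?thesis using i by simp
  qed
  then show ?thesis using assms(1,3) by (simp add: chain_map_iff)
qed

lemma homotopy_equivalent_iff:
  assumes "X \<in> complexes_between n D A C" "Y \<in> complexes_between n D A C"
  shows "homotopy_equivalent n D A C X Y \<longleftrightarrow>
    (\<exists>f g. chain_map_between n D A C X Y f \<and> chain_map_between n D A C Y X g \<and>
      (\<exists>h. contraction n X X (\<lambda>i. g i \<cdot> f i \<ominus> idn D (ob X i)) h) \<and>
      (\<exists>h. contraction n Y Y (\<lambda>i. f i \<cdot> g i \<ominus> idn D (ob Y i)) h))"
proof -
  have c: "is_complex n D X" "is_complex n D Y" using assms unfolding complexes_between_def by auto
  note [simp] = complex_dest[OF c(1)] complex_dest[OF c(2)]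
  have "homotopic n D X X (\<lambda>i. g i \<cdot> f i) (\<lambda>i. idn D (ob X i)) \<longleftrightarrow>
      (\<exists>h. contraction n X X (\<lambda>i. g i \<cdot> f i \<ominus> idn D (ob X i)) h)"
    "homotopic n D Y Y (\<lambda>i. f i \<cdot> g i) (\<lambda>i. idn D (ob Y i)) \<longleftrightarrow>
      (\<exists>h. contraction n Y Y (\<lambda>i. f i \<cdot> g i \<ominus> idn D (ob Y i)) h)"
    if "chain_map n D X Y f" "chain_map n D Y X g" for f g
    using c chain_map_dest[OF that(1) c] chain_map_dest[OF that(2) c(2,1)]
    by (subst homotopic_iff; simp)+
  then show ?thesis unfolding homotopy_equivalent_def chain_map_between_def by blast
qed

lemma homotopy_equivalent_sym:
  "homotopy_equivalent n D A C X Y \<Longrightarrow> homotopy_equivalent n D A C Y X"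
  unfolding homotopy_equivalent_def by blast

lemma homotopy_equivalent_refl:
  assumes "X \<in> complexes_between n D A C"
  shows "homotopy_equivalent n D A C X X"
proof -
  have c: "is_complex n D X" and e: "ob X 0 = A" "ob X (Suc n) = C"
    using assms unfolding complexes_between_def by auto
  note [simp] = complex_dest[OF c]
  have "chain_map_between n D A C X X (\<lambda>i. idn D (ob X i))"
    unfolding chain_map_between_def using c e by (simp add: chain_map_iff)
  moreover have "contraction n X X (\<lambda>i. idn D (ob X i) \<cdot> idn D (ob X i) \<ominus> idn D (ob X i))
      (\<lambda>i. zmor D (ob X i) (ob X (i - 1)))"
    by (rule contraction_zmor[OF c c]) simp
  ultimately show ?thesis unfolding homotopy_equivalent_iff[OF assms assms] by blast
qed

text \<open>
  Contractions may be composed with chain maps on either side, and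
  \<open>gg'f'f - 1 = g(g'f' - 1)f + (gf - 1)\<close>.
\<close>

lemma homotopy_equivalent_trans:
  assumes "X \<in> complexes_between n D A C" "Y \<in> complexes_between n D A C"
    "Z \<in> complexes_between n D A C"
    and "homotopy_equivalent n D A C X Y" "homotopy_equivalent n D A C Y Z"
  shows "homotopy_equivalent n D A C X Z"
proof -
  have *: "\<exists>h. contraction n X X (\<lambda>i. (g i \<cdot> g' i) \<cdot> (f' i \<cdot> f i) \<ominus> idn D (ob X i)) h"
    if c: "is_complex n D X" "is_complex n D Y" "is_complex n D Z"
      and m: "chain_map n D X Y f" "chain_map n D Y X g" "chain_map n D Y Z f'" "chain_map n D Z Y g'"
      and h: "\<exists>h. contraction n X X (\<lambda>i. g i \<cdot> f i \<ominus> idn D (ob X i)) h"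
      "\<exists>h. contraction n Y Y (\<lambda>i. g' i \<cdot> f' i \<ominus> idn D (ob Y i)) h"
    for X Y Z :: "('o, 'm) cpx" and f g f' g'
  proof -
    obtain h h' where "contraction n X X (\<lambda>i. g i \<cdot> f i \<ominus> idn D (ob X i)) h"
      "contraction n Y Y (\<lambda>i. g' i \<cdot> f' i \<ominus> idn D (ob Y i)) h'" using h by blast
    then have 1: "contraction n X X
      (\<lambda>i. (g i \<cdot> (g' i \<cdot> f' i \<ominus> idn D (ob Y i)) \<cdot> f i) \<oplus> (g i \<cdot> f i \<ominus> idn D (ob X i)))
      (\<lambda>i. (g (i - 1) \<cdot> h' i \<cdot> f i) \<oplus> h i)"
      using c m contraction_plus contraction_cmp_left contraction_cmp_right by meson
    have 2: "(g i \<cdot> (g' i \<cdot> f' i \<ominus> idn D (ob Y i)) \<cdot> f i) \<oplus> (g i \<cdot> f i \<ominus> idn D (ob X i))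
        = (g i \<cdot> g' i) \<cdot> (f' i \<cdot> f i) \<ominus> idn D (ob X i)" if "i \<le> Suc n" for i
    proof -
      note [simp] = chain_map_dest[OF m(1) c(1,2)] chain_map_dest[OF m(2) c(2,1)]
        chain_map_dest[OF m(3) c(2,3)] chain_map_dest[OF m(4) c(3,2)]
        complex_dest[OF c(1)] complex_dest[OF c(2)]
      show ?thesis using that by (simp add: additive_simps)
    qed
    show ?thesis by (rule exI, rule contraction_cong[OF 1 2])
  qed
  have c: "is_complex n D X" "is_complex n D Y" "is_complex n D Z"
    and e: "A \<in> obj D" "C \<in> obj D"
    using assms complex_dest(1)[of n X 0] complex_dest(1)[of n X "Suc n"]
    unfolding complexes_between_def by auto
  obtain f g where fg: "chain_map_between n D A C X Y f" "chain_map_between n D A C Y X g"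
      "\<exists>h. contraction n X X (\<lambda>i. g i \<cdot> f i \<ominus> idn D (ob X i)) h"
      "\<exists>h. contraction n Y Y (\<lambda>i. f i \<cdot> g i \<ominus> idn D (ob Y i)) h"
    using assms(4) unfolding homotopy_equivalent_iff[OF assms(1,2)] by blast
  obtain f' g' where fg': "chain_map_between n D A C Y Z f'" "chain_map_between n D A C Z Y g'"
      "\<exists>h. contraction n Y Y (\<lambda>i. g' i \<cdot> f' i \<ominus> idn D (ob Y i)) h"
      "\<exists>h. contraction n Z Z (\<lambda>i. f' i \<cdot> g' i \<ominus> idn D (ob Z i)) h"
    using assms(5) unfolding homotopy_equivalent_iff[OF assms(2,3)] by blast
  have m: "chain_map n D X Y f" "chain_map n D Y X g" "chain_map n D Y Z f'" "chain_map n D Z Y g'"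
    using fg(1,2) fg'(1,2) unfolding chain_map_between_def by auto
  have "chain_map_between n D A C X Z (\<lambda>i. f' i \<cdot> f i)" "chain_map_between n D A C Z X (\<lambda>i. g i \<cdot> g' i)"
    using fg(1,2) fg'(1,2) e chain_map_cmp[OF c m(1,3)] chain_map_cmp[OF c(3,2,1) m(4,2)]
    unfolding chain_map_between_def by auto
  then show ?thesis
    unfolding homotopy_equivalent_iff[OF assms(1,3)]
    using *[OF c m fg(3) fg'(3)] *[OF c(3,2,1) m(4,3,2,1) fg'(4) fg(4)] by blast
qed

lemma homotopy_class_eq_iff:
  assumes "X \<in> complexes_between n D A C" "Y \<in> complexes_between n D A C"
  shows "homotopy_class n D A C X = homotopy_class n D A C Y \<longleftrightarrow> homotopy_equivalent n D A C X Y"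
  using assms homotopy_equivalent_sym homotopy_equivalent_refl homotopy_equivalent_trans
  unfolding homotopy_class_def by blast

text \<open>Complexes that agree in the relevant degrees may still differ as functions on the natural numbers.\<close>

lemma homotopy_equivalent_same:
  assumes "X \<in> complexes_between n D A C" "Y \<in> complexes_between n D A C"
    and "\<And>i. i \<le> Suc n \<Longrightarrow> ob X i = ob Y i" "\<And>i. i \<le> n \<Longrightarrow> df X i = df Y i"
  shows "homotopy_equivalent n D A C X Y"
proof -
  have c: "is_complex n D X" "is_complex n D Y" and e: "ob Y 0 = A" "ob Y (Suc n) = C"
    using assms unfolding complexes_between_def by auto
  note [simp] = complex_dest[OF c(2)] assms(3,4)
  have "chain_map_between n D A C X Y (\<lambda>i. idn D (ob Y i))"
    "chain_map_between n D A C Y X (\<lambda>i. idn D (ob Y i))"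
    unfolding chain_map_between_def using c e by (simp_all add: chain_map_iff)
  moreover have "contraction n X X (\<lambda>i. idn D (ob Y i) \<cdot> idn D (ob Y i) \<ominus> idn D (ob X i))
      (\<lambda>i. zmor D (ob X i) (ob X (i - 1)))"
    by (rule contraction_zmor[OF c(1) c(1)]) simp
  moreover have "contraction n Y Y (\<lambda>i. idn D (ob Y i) \<cdot> idn D (ob Y i) \<ominus> idn D (ob Y i))
      (\<lambda>i. zmor D (ob Y i) (ob Y (i - 1)))"
    by (rule contraction_zmor[OF c(2) c(2)]) simp
  ultimately show ?thesis unfolding homotopy_equivalent_iff[OF assms(1,2)] by blast
qed

end

section \<open>Comparison of right exact complexes\<close>

context preadditive_category
begin

text \<open>
  This is exactness of \<open>D(X\<^bsub>n+1\<^esub>, -) \<rightarrow> \<cdots> \<rightarrow> D(X\<^sub>0, -)\<close> at the terms of index \<open>1, \<dots>, n\<close>, that is,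
  all of the exactness of an \<open>n\<close>-exangle that can be stated without the extension and involves
  morphisms out of the complex.
\<close>

definition right_exact :: "nat \<Rightarrow> ('o, 'm) cpx \<Rightarrow> bool"
  where "right_exact n X \<longleftrightarrow>
    (\<forall>i < n. \<forall>g. ar g \<and> dm g = ob X (Suc i) \<and> g \<cdot> df X i = zmor D (ob X i) (cd g) \<longrightarrow>
      (\<exists>k. arr k (ob X (Suc (Suc i))) (cd g) \<and> g = k \<cdot> df X (Suc i)))"

lemma right_exactD:
  assumes "right_exact n X" "i < n" "ar g" "dm g = ob X (Suc i)" "g \<cdot> df X i = zmor D (ob X i) (cd g)"
  obtains k where "ar k" "dm k = ob X (Suc (Suc i))" "cd k = cd g" "g = k \<cdot> df X (Suc i)"
  using assms unfolding right_exact_def by auto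

lemma df_df_cmp:
  assumes "is_complex n D X" "i < n" "ar x" "cd x = ob X i"
  shows "df X (Suc i) \<cdot> df X i \<cdot> x = zmor D (dm x) (ob X (Suc (Suc i)))"
proof -
  note [simp] = complex_dest[OF assms(1)]
  have "df X (Suc i) \<cdot> df X i \<cdot> x = (df X (Suc i) \<cdot> df X i) \<cdot> x"
    by (rule cmp_assoc'[symmetric]) (use assms(2-4) in simp_all)
  then show ?thesis unfolding complex_dest(5)[OF assms(1,2)] using assms(2-4) by simp
qed

text \<open>
  Starting with \<open>h\<^sub>1 = 0\<close>, the remainder \<open>f\<^bsub>i+1\<^esub> - d\<^sub>i h\<^bsub>i+1\<^esub>\<close> vanishes on \<open>d\<^sub>i\<close> and so factors through
  \<open>d\<^bsub>i+1\<^esub>\<close>, which gives the next component. In the last degree nothing is claimed: \<open>f\<^bsub>n+1\<^esub>\<close> and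
  \<open>d\<^sub>n h\<^bsub>n+1\<^esub>\<close> agree after composition with \<open>d\<^sub>n\<close>, which need not be an epimorphism.
\<close>

lemma partial_contraction:
  assumes X: "is_complex n D X" and Y: "is_complex n D Y" and "right_exact n X"
    and f: "chain_map n D X Y f" and f0: "f 0 = zmor D (ob X 0) (ob Y 0)"
  shows "\<exists>h. (\<forall>i \<le> n. arr (h (Suc i)) (ob X (Suc i)) (ob Y i)) \<and>
    h 1 = zmor D (ob X 1) (ob Y 0) \<and>
    (\<forall>i < n. f (Suc i) = df Y i \<cdot> h (Suc i) \<oplus> h (Suc (Suc i)) \<cdot> df X (Suc i))"
proof -
  note [simp] = complex_dest[OF X] complex_dest[OF Y] chain_map_dest(1-3)[OF f X Y]
  have "\<exists>h. (\<forall>i \<le> m. arr (h (Suc i)) (ob X (Suc i)) (ob Y i)) \<and>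
    h 1 = zmor D (ob X 1) (ob Y 0) \<and>
    (\<forall>i < m. f (Suc i) = df Y i \<cdot> h (Suc i) \<oplus> h (Suc (Suc i)) \<cdot> df X (Suc i))" if "m \<le> n" for m
    using that
  proof (induction m)
    case 0
    show ?case by (rule exI[of _ "\<lambda>i. zmor D (ob X 1) (ob Y 0)"]) simp
  next
    case (Suc m)
    then obtain h where h: "\<And>i. i \<le> m \<Longrightarrow> arr (h (Suc i)) (ob X (Suc i)) (ob Y i)"
      and h1: "h 1 = zmor D (ob X 1) (ob Y 0)"
      and hs: "\<And>i. i < m \<Longrightarrow> f (Suc i) = df Y i \<cdot> h (Suc i) \<oplus> h (Suc (Suc i)) \<cdot> df X (Suc i)"
      by auto
    have m: "m < n" using Suc.prems by simp
    have hm: "ar (h (Suc m))" "dm (h (Suc m)) = ob X (Suc m)" "cd (h (Suc m)) = ob Y m"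
      using h[of m] by simp_all
    define g where "g = f (Suc m) \<ominus> df Y m \<cdot> h (Suc m)"
    have g: "ar g" "dm g = ob X (Suc m)" "cd g = ob Y (Suc m)"
      unfolding g_def using hm m by simp_all
    have "f (Suc m) \<cdot> df X m = df Y m \<cdot> h (Suc m) \<cdot> df X m"
    proof (cases m)
      case 0
      then show ?thesis using chain_map_dest(4)[OF f X Y, of 0] f0 h1 m by simp
    next
      case m': (Suc m')
      have hm': "ar (h (Suc m'))" "dm (h (Suc m')) = ob X (Suc m')" "cd (h (Suc m')) = ob Y m'"
        using h[of m'] m' by simp_all
      have "f (Suc m) \<cdot> df X m = df Y m \<cdot> f m" using chain_map_dest(4)[OF f X Y, of m] m by simp
      also have "f m = df Y m' \<cdot> h (Suc m') \<oplus> h (Suc m) \<cdot> df X m"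
        using hs[of m'] m' by simp
      also have "df Y m \<cdot> \<dots> = df Y m \<cdot> h (Suc m) \<cdot> df X m"
        using m m' hm hm' df_df_cmp[OF Y, of m' "h (Suc m')"] by simp
      finally show ?thesis .
    qed
    then have "g \<cdot> df X m = zmor D (ob X m) (cd g)"
      unfolding g(3) unfolding g_def using hm m by simp
    then obtain k where k: "ar k" "dm k = ob X (Suc (Suc m))" "cd k = cd g" "g = k \<cdot> df X (Suc m)"
      using right_exactD[OF assms(3) m g(1,2)] by blast
    have "f (Suc m) = df Y m \<cdot> h (Suc m) \<oplus> k \<cdot> df X (Suc m)"
      unfolding k(4)[symmetric] unfolding g_def using hm m by (simp add: additive_simps)
    then have "(\<forall>i < Suc m. f (Suc i) = df Y i \<cdot> (h(Suc (Suc m) := k)) (Suc i) \<oplus>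
        (h(Suc (Suc m) := k)) (Suc (Suc i)) \<cdot> df X (Suc i))"
      using hs by (auto simp: less_Suc_eq)
    moreover have "\<forall>i \<le> Suc m. arr ((h(Suc (Suc m) := k)) (Suc i)) (ob X (Suc i)) (ob Y i)"
      using h k g by (auto simp: le_Suc_eq)
    moreover have "(h(Suc (Suc m) := k)) 1 = zmor D (ob X 1) (ob Y 0)" using h1 by simp
    ultimately show ?case by blast
  qed
  then show ?thesis by blast
qed

text \<open>The partial contraction of \<open>f\<close> fails only in the last degree, and \<open>g\<close> vanishes there.\<close>

lemma cmp_null_homotopic:
  assumes X: "is_complex n D X" and Y: "is_complex n D Y" and Z: "is_complex n D Z"
    and "right_exact n X"
    and f: "chain_map n D X Y f" and f0: "f 0 = zmor D (ob X 0) (ob Y 0)"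
    and g: "chain_map n D Y Z g" and gn: "g (Suc n) = zmor D (ob Y (Suc n)) (ob Z (Suc n))"
  shows "\<exists>h. contraction n X Z (\<lambda>i. g i \<cdot> f i) h"
proof -
  note [simp] = complex_dest[OF X] complex_dest[OF Y] complex_dest[OF Z]
    chain_map_dest(1-3)[OF f X Y] chain_map_dest(1-3)[OF g Y Z]
  obtain h where h: "\<And>i. i \<le> n \<Longrightarrow> arr (h (Suc i)) (ob X (Suc i)) (ob Y i)"
    and h1: "h 1 = zmor D (ob X 1) (ob Y 0)"
    and hs: "\<And>i. i < n \<Longrightarrow> f (Suc i) = df Y i \<cdot> h (Suc i) \<oplus> h (Suc (Suc i)) \<cdot> df X (Suc i)"
    using partial_contraction[OF assms(1-2,4-6)] by blast
  have h' [simp]: "ar (h (Suc i))" "dm (h (Suc i)) = ob X (Suc i)" "cd (h (Suc i)) = ob Y i"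
    if "i \<le> n" for i using h that by auto
  have c: "df Z i \<cdot> g i \<cdot> x = g (Suc i) \<cdot> df Y i \<cdot> x" if "i \<le> n" "ar x" "cd x = ob Y i" for x i
  proof -
    have "(df Z i \<cdot> g i) \<cdot> x = (g (Suc i) \<cdot> df Y i) \<cdot> x"
      using chain_map_dest(4)[OF g Y Z] that by simp
    then show ?thesis using that by simp
  qed
  have "contraction n X Z (\<lambda>i. g i \<cdot> f i) (\<lambda>i. g (i - 1) \<cdot> h i)"
    unfolding contraction_def using h1 by (simp add: c hs f0 gn)
  then show ?thesis by blast
qed

lemma chain_map_plus:
  assumes "is_complex n D X" "is_complex n D Y" "chain_map n D X Y f" "chain_map n D X Y g"
  shows "chain_map n D X Y (\<lambda>i. f i \<oplus> g i)"
  using complex_dest[OF assms(1)] complex_dest[OF assms(2)]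
    chain_map_dest[OF assms(3,1,2)] chain_map_dest[OF assms(4,1,2)]
  unfolding chain_map_iff[OF assms(1,2)] by simp

lemma chain_map_minus:
  assumes "is_complex n D X" "is_complex n D Y" "chain_map n D X Y f" "chain_map n D X Y g"
  shows "chain_map n D X Y (\<lambda>i. f i \<ominus> g i)"
  using complex_dest[OF assms(1)] complex_dest[OF assms(2)]
    chain_map_dest[OF assms(3,1,2)] chain_map_dest[OF assms(4,1,2)]
  unfolding chain_map_iff[OF assms(1,2)] by simp

lemma chain_map_idn:
  assumes "is_complex n D X"
  shows "chain_map n D X X (\<lambda>i. idn D (ob X i))"
  using complex_dest[OF assms(1)] unfolding chain_map_iff[OF assms assms] by simp

text \<open>
  The chain map \<open>gf - 1\<close> vanishes in both end degrees, but it need not be null-homotopic. Its square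
  is, by \<open>cmp_null_homotopic\<close>, and so is \<open>(1 - gf)(gf - 1) = g'f - 1\<close> for \<open>g' = 2g - gfg\<close>. The
  same \<open>g'\<close> works on the other side, as \<open>(1 - fg)(fg - 1) = fg' - 1\<close>.
\<close>

lemma homotopy_equivalentI_right_exact:
  assumes "X \<in> complexes_between n D A C" "Y \<in> complexes_between n D A C"
    and "right_exact n X" "right_exact n Y"
    and "chain_map_between n D A C X Y f" "chain_map_between n D A C Y X g"
  shows "homotopy_equivalent n D A C X Y"
proof -
  have X: "is_complex n D X" and Y: "is_complex n D Y"
    and e: "ob X 0 = A" "ob X (Suc n) = C" "ob Y 0 = A" "ob Y (Suc n) = C"
    using assms(1,2) unfolding complexes_between_def by auto
  have f: "chain_map n D X Y f" "f 0 = idn D A" "f (Suc n) = idn D C"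
    and g: "chain_map n D Y X g" "g 0 = idn D A" "g (Suc n) = idn D C"
    using assms(5,6) unfolding chain_map_between_def by auto
  note [simp] = complex_dest[OF X] complex_dest[OF Y]
    chain_map_dest(1-3)[OF f(1) X Y] chain_map_dest(1-3)[OF g(1) Y X]
  have o [simp]: "A \<in> obj D" "C \<in> obj D"
    using complex_dest(1)[OF X, of 0] complex_dest(1)[OF X, of "Suc n"] e by auto
  have gf: "chain_map n D X X (\<lambda>i. g i \<cdot> f i)" and fg: "chain_map n D Y Y (\<lambda>i. f i \<cdot> g i)"
    using chain_map_cmp[OF X Y X f(1) g(1)] chain_map_cmp[OF Y X Y g(1) f(1)] .
  define g' where "g' i = (g i \<oplus> g i) \<ominus> (g i \<cdot> f i) \<cdot> g i" for i
  have "chain_map n D Y X g'"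
    unfolding g'_def using X Y g gf
    by (intro chain_map_minus[of n Y X "\<lambda>i. g i \<oplus> g i"] chain_map_plus) (auto intro: chain_map_cmp)
  moreover have "g' 0 = idn D A" "g' (Suc n) = idn D C"
    unfolding g'_def using f g by (simp_all add: additive_simps)
  ultimately have g': "chain_map_between n D A C Y X g'"
    unfolding chain_map_between_def by simp
  have "\<exists>h. contraction n X X (\<lambda>i. (idn D (ob X i) \<ominus> g i \<cdot> f i) \<cdot> (g i \<cdot> f i \<ominus> idn D (ob X i))) h"
    using f g e X by (intro cmp_null_homotopic[OF X X X assms(3)] chain_map_minus gf chain_map_idn) simp_all
  moreover have "\<exists>h. contraction n Y Y (\<lambda>i. (idn D (ob Y i) \<ominus> f i \<cdot> g i) \<cdot> (f i \<cdot> g i \<ominus> idn D (ob Y i))) h"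
    using f g e Y by (intro cmp_null_homotopic[OF Y Y Y assms(4)] chain_map_minus fg chain_map_idn) simp_all
  moreover have "(idn D (ob X i) \<ominus> g i \<cdot> f i) \<cdot> (g i \<cdot> f i \<ominus> idn D (ob X i)) = g' i \<cdot> f i \<ominus> idn D (ob X i)"
    "(idn D (ob Y i) \<ominus> f i \<cdot> g i) \<cdot> (f i \<cdot> g i \<ominus> idn D (ob Y i)) = f i \<cdot> g' i \<ominus> idn D (ob Y i)"
    if "i \<le> Suc n" for i
    unfolding g'_def using that by (simp_all add: additive_simps)
  ultimately have "\<exists>h. contraction n X X (\<lambda>i. g' i \<cdot> f i \<ominus> idn D (ob X i)) h"
    "\<exists>h. contraction n Y Y (\<lambda>i. f i \<cdot> g' i \<ominus> idn D (ob Y i)) h"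
    by (meson contraction_cong)+
  then show ?thesis
    unfolding homotopy_equivalent_iff[OF assms(1,2)] using assms(5) g' by blast
qed

end

section \<open>Biproducts and matrices\<close>

context additive_category
begin

lemma zob_obj' [simp]: "zob D \<in> obj D"
  by (rule zob_obj)

lemma dsum_obj' [simp]: "A \<in> obj D \<Longrightarrow> B \<in> obj D \<Longrightarrow> dsum D A B \<in> obj D"
  by (rule dsum_obj)

lemma ar_dsum [simp]:
  assumes "A \<in> obj D" "B \<in> obj D"
  shows "ar (inj1 D A B)" "dm (inj1 D A B) = A" "cd (inj1 D A B) = dsum D A B"
    and "ar (inj2 D A B)" "dm (inj2 D A B) = B" "cd (inj2 D A B) = dsum D A B"
    and "ar (prj1 D A B)" "dm (prj1 D A B) = dsum D A B" "cd (prj1 D A B) = A"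
    and "ar (prj2 D A B)" "dm (prj2 D A B) = dsum D A B" "cd (prj2 D A B) = B"
  using inj1_mor[OF assms] inj2_mor[OF assms] prj1_mor[OF assms] prj2_mor[OF assms] assms
  by (simp_all add: mor_iff)

lemma prj_inj [simp]:
  assumes "A \<in> obj D" "B \<in> obj D"
  shows "prj1 D A B \<cdot> inj1 D A B = idn D A" "prj2 D A B \<cdot> inj2 D A B = idn D B"
    "prj1 D A B \<cdot> inj2 D A B = zmor D B A" "prj2 D A B \<cdot> inj1 D A B = zmor D A B"
  using prj1_inj1 prj2_inj2 prj1_inj2 prj2_inj1 assms by auto

lemma prj_inj_cmp [simp]:
  assumes "A \<in> obj D" "B \<in> obj D" "ar x"
  shows "cd x = A \<Longrightarrow> prj1 D A B \<cdot> inj1 D A B \<cdot> x = x"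
    "cd x = B \<Longrightarrow> prj2 D A B \<cdot> inj2 D A B \<cdot> x = x"
    "cd x = B \<Longrightarrow> prj1 D A B \<cdot> inj2 D A B \<cdot> x = zmor D (dm x) A"
    "cd x = A \<Longrightarrow> prj2 D A B \<cdot> inj1 D A B \<cdot> x = zmor D (dm x) B"
  using assms cmp_assoc'[of x "inj1 D A B" "prj1 D A B", symmetric]
    cmp_assoc'[of x "inj2 D A B" "prj2 D A B", symmetric]
    cmp_assoc'[of x "inj2 D A B" "prj1 D A B", symmetric]
    cmp_assoc'[of x "inj1 D A B" "prj2 D A B", symmetric]
  by (simp_all del: cmp_assoc')

lemma inj_prj_plus:
  assumes "A \<in> obj D" "B \<in> obj D"
  shows "inj1 D A B \<cdot> prj1 D A B \<oplus> inj2 D A B \<cdot> prj2 D A B = idn D (dsum D A B)"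
  using assms dsum_idn[OF assms] by (simp add: plus_def)

lemma inj_prj_cmp:
  assumes "A \<in> obj D" "B \<in> obj D" "ar x" "cd x = dsum D A B"
  shows "x = inj1 D A B \<cdot> prj1 D A B \<cdot> x \<oplus> inj2 D A B \<cdot> prj2 D A B \<cdot> x"
proof -
  have "x = (inj1 D A B \<cdot> prj1 D A B \<oplus> inj2 D A B \<cdot> prj2 D A B) \<cdot> x"
    using inj_prj_plus[OF assms(1,2)] assms by simp
  then show ?thesis using assms by simp
qed

lemma cmp_inj_prj:
  assumes "A \<in> obj D" "B \<in> obj D" "ar x" "dm x = dsum D A B"
  shows "x = (x \<cdot> inj1 D A B) \<cdot> prj1 D A B \<oplus> (x \<cdot> inj2 D A B) \<cdot> prj2 D A B"
proof -
  have "x = x \<cdot> (inj1 D A B \<cdot> prj1 D A B \<oplus> inj2 D A B \<cdot> prj2 D A B)"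
    using inj_prj_plus[OF assms(1,2)] assms by simp
  then show ?thesis using assms by simp
qed

lemma mcol_eq:
  assumes "ar u" "ar v" "dm u = A" "dm v = A" "cd u = B" "cd v = B'"
  shows "mcol D A B B' u v = inj1 D B B' \<cdot> u \<oplus> inj2 D B B' \<cdot> v"
  unfolding mcol_def using assms ar_dest(2)[OF assms(1)] ar_dest(2)[OF assms(2)] by (simp add: plus_def)

lemma mrow_eq:
  assumes "ar u" "ar v" "dm u = A" "dm v = A'" "cd u = B" "cd v = B"
  shows "mrow D A A' B u v = u \<cdot> prj1 D A A' \<oplus> v \<cdot> prj2 D A A'"
  unfolding mrow_def using assms ar_dest(1)[OF assms(1)] ar_dest(1)[OF assms(2)] by (simp add: plus_def)

lemma mmat_eq:
  assumes "ar p" "ar q" "ar u" "ar v" "dm p = A" "dm q = A'" "dm u = A" "dm v = A'"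
    "cd p = B" "cd q = B" "cd u = B'" "cd v = B'"
  shows "mmat D A A' B B' p q u v =
    inj1 D B B' \<cdot> (p \<cdot> prj1 D A A' \<oplus> q \<cdot> prj2 D A A') \<oplus> inj2 D B B' \<cdot> (u \<cdot> prj1 D A A' \<oplus> v \<cdot> prj2 D A A')"
  unfolding mmat_def using assms ar_dest[OF assms(1)] ar_dest[OF assms(4)]
  by (subst mcol_eq) (simp_all add: mrow_eq)

end

section \<open>Groups of extensions\<close>

context biadditive_functor
begin

lemma act_mem:
  assumes "arr a A B" "arr c C' C" "\<delta> \<in> carrier (ext G C A)"
  shows "act G c a \<delta> \<in> carrier (ext G C' B)"
  using assms act_hom[of A B C C' a c] hom_in_carrier unfolding arr_def by metis

lemma push_mem:
  assumes "ar a" "dm a = A" "cd a = B" "C \<in> obj D" "\<delta> \<in> carrier (ext G C A)"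
  shows "push D G C a \<delta> \<in> carrier (ext G C B)"
  unfolding push_def using assms by (intro act_mem[of a A B _ _ C]) simp_all

lemma pull_mem:
  assumes "ar c" "dm c = C'" "cd c = C" "A \<in> obj D" "\<delta> \<in> carrier (ext G C A)"
  shows "pull D G A c \<delta> \<in> carrier (ext G C' A)"
  unfolding pull_def using assms by (intro act_mem[of _ A _ _ _ C]) simp_all

lemma act_cmp':
  assumes "ar a" "ar a'" "dm a' = cd a" "ar c" "ar c'" "cd c' = dm c" "\<delta> \<in> carrier (ext G (cd c) (dm a))"
  shows "act G (c \<cdot> c') (a' \<cdot> a) \<delta> = act G c' a' (act G c a \<delta>)"
  using assms ar_dest[OF assms(1)] ar_dest[OF assms(2)] ar_dest[OF assms(4)] ar_dest[OF assms(5)]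
  by (intro act_cmp) auto

lemma push_cmp:
  assumes "ar a" "ar a'" "dm a' = cd a" "C \<in> obj D" "\<delta> \<in> carrier (ext G C (dm a))"
  shows "push D G C (a' \<cdot> a) \<delta> = push D G C a' (push D G C a \<delta>)"
  unfolding push_def using assms act_cmp'[of a a' "idn D C" "idn D C" \<delta>] by simp

lemma pull_cmp:
  assumes "ar c" "ar c'" "cd c' = dm c" "A \<in> obj D" "\<delta> \<in> carrier (ext G (cd c) A)"
  shows "pull D G A (c \<cdot> c') \<delta> = pull D G A c' (pull D G A c \<delta>)"
  unfolding pull_def using assms act_cmp'[of "idn D A" "idn D A" c c' \<delta>] by simp

lemma push_pull:
  assumes "ar a" "dm a = A" "cd a = B" "ar c" "dm c = C'" "cd c = C" "\<delta> \<in> carrier (ext G C A)"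
  shows "push D G C' a (pull D G A c \<delta>) = pull D G B c (push D G C a \<delta>)"
proof -
  have o: "A \<in> obj D" "B \<in> obj D" "C \<in> obj D" "C' \<in> obj D" using assms ar_dest by auto
  then show ?thesis
    unfolding push_def pull_def
    using assms act_cmp'[of "idn D A" a c "idn D C'" \<delta>] act_cmp'[of a "idn D B" "idn D C" c \<delta>]
    by simp
qed

lemma pull_mult:
  assumes "ar c" "dm c = C'" "cd c = C" "A \<in> obj D" "\<delta> \<in> carrier (ext G C A)" "\<epsilon> \<in> carrier (ext G C A)"
  shows "pull D G A c (\<delta> \<otimes>\<^bsub>ext G C A\<^esub> \<epsilon>) = pull D G A c \<delta> \<otimes>\<^bsub>ext G C' A\<^esub> pull D G A c \<epsilon>"
  unfolding pull_def using assms act_hom[of A A C C' "idn D A" c, THEN hom_mult] ar_dest[OF assms(1)]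
  by (simp add: idn_mor)

lemma push_mult:
  assumes "ar a" "dm a = A" "cd a = B" "C \<in> obj D" "\<delta> \<in> carrier (ext G C A)" "\<epsilon> \<in> carrier (ext G C A)"
  shows "push D G C a (\<delta> \<otimes>\<^bsub>ext G C A\<^esub> \<epsilon>) = push D G C a \<delta> \<otimes>\<^bsub>ext G C B\<^esub> push D G C a \<epsilon>"
  unfolding push_def using assms act_hom[of A B C C a "idn D C", THEN hom_mult] ar_dest[OF assms(1)]
  by (simp add: idn_mor)

lemma ext_group: "C \<in> obj D \<Longrightarrow> A \<in> obj D \<Longrightarrow> group (ext G C A)"
  using ext_comm_group comm_group_def by blast

lemma pull_one:
  assumes "ar c" "dm c = C'" "cd c = C" "A \<in> obj D"
  shows "pull D G A c \<one>\<^bsub>ext G C A\<^esub> = \<one>\<^bsub>ext G C' A\<^esub>"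
  unfolding pull_def using assms act_hom[of A A C C' "idn D A" c, THEN hom_one] ar_dest[OF assms(1)]
  by (simp add: idn_mor ext_group)

lemma push_one:
  assumes "ar a" "dm a = A" "cd a = B" "C \<in> obj D"
  shows "push D G C a \<one>\<^bsub>ext G C A\<^esub> = \<one>\<^bsub>ext G C B\<^esub>"
  unfolding push_def using assms act_hom[of A B C C a "idn D C", THEN hom_one] ar_dest[OF assms(1)]
  by (simp add: idn_mor ext_group)

lemma pull_plus:
  assumes "ar c" "ar c'" "dm c = C'" "cd c = C" "dm c' = C'" "cd c' = C" "A \<in> obj D" "\<delta> \<in> carrier (ext G C A)"
  shows "pull D G A (c \<oplus> c') \<delta> = pull D G A c \<delta> \<otimes>\<^bsub>ext G C' A\<^esub> pull D G A c' \<delta>"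
  using assms pull_add[of A C C' c c' \<delta>] ar_dest[OF assms(1)] ar_dest[OF assms(2)]
  by (simp add: plus_def)

lemma push_plus:
  assumes "ar a" "ar a'" "dm a = A" "cd a = B" "dm a' = A" "cd a' = B" "C \<in> obj D" "\<delta> \<in> carrier (ext G C A)"
  shows "push D G C (a \<oplus> a') \<delta> = push D G C a \<delta> \<otimes>\<^bsub>ext G C B\<^esub> push D G C a' \<delta>"
  using assms push_add[of A B C a a' \<delta>] ar_dest[OF assms(1)] ar_dest[OF assms(2)]
  by (simp add: plus_def)

lemma pull_idn: "A \<in> obj D \<Longrightarrow> C \<in> obj D \<Longrightarrow> \<delta> \<in> carrier (ext G C A) \<Longrightarrow> pull D G A (idn D C) \<delta> = \<delta>"
  unfolding pull_def by (rule act_idn)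

lemma push_idn: "A \<in> obj D \<Longrightarrow> C \<in> obj D \<Longrightarrow> \<delta> \<in> carrier (ext G C A) \<Longrightarrow> push D G C (idn D A) \<delta> = \<delta>"
  unfolding push_def by (rule act_idn)

lemma pull_zmor:
  assumes "A \<in> obj D" "C \<in> obj D" "C' \<in> obj D" "\<delta> \<in> carrier (ext G C A)"
  shows "pull D G A (zmor D C' C) \<delta> = \<one>\<^bsub>ext G C' A\<^esub>"
proof -
  interpret H: group "ext G C' A" using ext_group assms by blast
  have m: "pull D G A (zmor D C' C) \<delta> \<in> carrier (ext G C' A)"
    using assms by (intro pull_mem) simp_all
  have "pull D G A (zmor D C' C \<oplus> zmor D C' C) \<delta> =
    pull D G A (zmor D C' C) \<delta> \<otimes>\<^bsub>ext G C' A\<^esub> pull D G A (zmor D C' C) \<delta>"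
    using assms by (intro pull_plus) simp_all
  then show ?thesis using assms m by simp
qed

lemma push_zmor:
  assumes "A \<in> obj D" "B \<in> obj D" "C \<in> obj D" "\<delta> \<in> carrier (ext G C A)"
  shows "push D G C (zmor D A B) \<delta> = \<one>\<^bsub>ext G C B\<^esub>"
proof -
  interpret H: group "ext G C B" using ext_group assms by blast
  have m: "push D G C (zmor D A B) \<delta> \<in> carrier (ext G C B)"
    using assms by (intro push_mem) simp_all
  have "push D G C (zmor D A B \<oplus> zmor D A B) \<delta> =
    push D G C (zmor D A B) \<delta> \<otimes>\<^bsub>ext G C B\<^esub> push D G C (zmor D A B) \<delta>"
    using assms by (intro push_plus) simp_all
  then show ?thesis using assms m by simp
qed

lemma push_plus_one:
  assumes "ar a" "ar a'" "dm a = A" "cd a = B" "dm a' = A" "cd a' = B" "C \<in> obj D" "\<delta> \<in> carrier (ext G C A)"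
    and "push D G C a' \<delta> = \<one>\<^bsub>ext G C B\<^esub>"
  shows "push D G C (a \<oplus> a') \<delta> = push D G C a \<delta>"
proof -
  have "B \<in> obj D" using assms(1,4) ar_dest(2) by blast
  then interpret H: group "ext G C B" using ext_group assms(7) by blast
  show ?thesis
    using push_plus[OF assms(1-8)] push_mem[OF assms(1,3,4,7,8)] assms(9) by simp
qed

lemma pull_minus_one:
  assumes "ar c" "ar c'" "dm c = C'" "cd c = C" "dm c' = C'" "cd c' = C" "A \<in> obj D" "\<delta> \<in> carrier (ext G C A)"
    and "pull D G A c \<delta> = pull D G A c' \<delta>"
  shows "pull D G A (c \<ominus> c') \<delta> = \<one>\<^bsub>ext G C' A\<^esub>"
proof -
  have "C' \<in> obj D" using assms(1,3) ar_dest(1) by blast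
  then interpret H: group "ext G C' A" using ext_group assms(7) by blast
  have m: "pull D G A c \<delta> \<in> carrier (ext G C' A)" "pull D G A (c \<ominus> c') \<delta> \<in> carrier (ext G C' A)"
    using assms(1-8) pull_mem[of c C' C A \<delta>] pull_mem[of "c \<ominus> c'" C' C A \<delta>] by simp_all
  have "pull D G A c \<delta> = pull D G A ((c \<ominus> c') \<oplus> c') \<delta>" using assms(1-6) by simp
  also have "\<dots> = pull D G A (c \<ominus> c') \<delta> \<otimes>\<^bsub>ext G C' A\<^esub> pull D G A c \<delta>"
    unfolding assms(9) using assms(1-8) by (intro pull_plus) simp_all
  finally show ?thesis using m by (metis H.r_cancel_one')
qed

end

section \<open>Distinguished n-exangles\<close>

context exact_realisation
begin

abbreviation dist :: "('o, 'm) cpx \<Rightarrow> 'e \<Rightarrow> bool"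
  where "dist \<equiv> distinguished n D G r"

lemma dist_dest:
  assumes "dist X \<delta>"
  shows "is_complex n D X" "\<delta> \<in> carrier (ext G (ob X (Suc n)) (ob X 0))"
    "realises n D r (ob X (Suc n)) (ob X 0) \<delta> X" "n_exangle n D G X \<delta>"
    "ob X 0 \<in> obj D" "ob X (Suc n) \<in> obj D"
    "X \<in> complexes_between n D (ob X 0) (ob X (Suc n))"
proof -
  show d: "\<delta> \<in> carrier (ext G (ob X (Suc n)) (ob X 0))" "realises n D r (ob X (Suc n)) (ob X 0) \<delta> X"
    using assms unfolding distinguished_def by auto
  show b: "X \<in> complexes_between n D (ob X 0) (ob X (Suc n))" using d(2) unfolding realises_def by blast
  show c: "is_complex n D X" using b unfolding complexes_between_def by auto
  show o: "ob X 0 \<in> obj D" "ob X (Suc n) \<in> obj D" using complex_dest(1)[OF c] by auto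
  show "n_exangle n D G X \<delta>" using R1[OF o d] .
qed

lemma dist_exists:
  assumes "A \<in> obj D" "C \<in> obj D" "\<delta> \<in> carrier (ext G C A)"
  obtains X where "dist X \<delta>" "ob X 0 = A" "ob X (Suc n) = C"
proof -
  obtain X where X: "realises n D r C A \<delta> X" using realised[OF assms] by blast
  then have "ob X 0 = A" "ob X (Suc n) = C" unfolding realises_def complexes_between_def by auto
  then show ?thesis using that X assms unfolding distinguished_def by auto
qed

lemma dist_lift:
  assumes X: "dist X \<delta>" and Y: "dist Y \<rho>" and "ar a" "dm a = ob X 0" "cd a = ob Y 0"
    and "ar c" "dm c = ob X (Suc n)" "cd c = ob Y (Suc n)"
    and "push D G (ob X (Suc n)) a \<delta> = pull D G (ob Y 0) c \<rho>"
  obtains f where "chain_map n D X Y f" "f 0 = a" "f (Suc n) = c"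
proof -
  have "ext_morphism D G (ob X (Suc n)) (ob X 0) \<delta> (ob Y (Suc n)) (ob Y 0) \<rho> a c"
    unfolding ext_morphism_def using assms(3-9) ar_dest(3) by metis
  from R0[OF dist_dest(5)[OF X] dist_dest(5)[OF Y] dist_dest(6)[OF X] dist_dest(6)[OF Y]
      dist_dest(2)[OF X] dist_dest(2)[OF Y] dist_dest(3)[OF X] dist_dest(3)[OF Y] this]
  show ?thesis using that by auto
qed

lemma dist_homotopy_equivalent:
  assumes X: "dist X \<delta>" and Y: "Y \<in> complexes_between n D (ob X 0) (ob X (Suc n))"
    and "homotopy_equivalent n D (ob X 0) (ob X (Suc n)) X Y"
  shows "dist Y \<delta>"
proof -
  have "homotopy_class n D (ob X 0) (ob X (Suc n)) X = homotopy_class n D (ob X 0) (ob X (Suc n)) Y"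
    using homotopy_class_eq_iff[OF dist_dest(7)[OF X] Y] assms(3) by blast
  moreover have "ob Y 0 = ob X 0" "ob Y (Suc n) = ob X (Suc n)"
    using Y unfolding complexes_between_def by auto
  ultimately show ?thesis
    using Y dist_dest(2,3)[OF X] unfolding distinguished_def realises_def by simp
qed

lemma dist_exact:
  assumes "dist X \<delta>"
  shows push_df: "push D G (ob X (Suc n)) (df X 0) \<delta> = \<one>\<^bsub>ext G (ob X (Suc n)) (ob X 1)\<^esub>"
    and pull_df: "pull D G (ob X 0) (df X n) \<delta> = \<one>\<^bsub>ext G (ob X n) (ob X 0)\<^esub>"
    and right_exact_dist: "right_exact n X"
proof -
  note e = dist_dest(4)[OF assms]
  note [simp] = complex_dest[OF dist_dest(1)[OF assms]]
  show "push D G (ob X (Suc n)) (df X 0) \<delta> = \<one>\<^bsub>ext G (ob X (Suc n)) (ob X 1)\<^esub>"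
    "pull D G (ob X 0) (df X n) \<delta> = \<one>\<^bsub>ext G (ob X n) (ob X 0)\<^esub>"
    using e unfolding n_exangle_def by auto
  show "right_exact n X"
    unfolding right_exact_def
  proof (intro allI impI)
    fix i g assume i: "i < n" and g: "ar g \<and> dm g = ob X (Suc i) \<and> g \<cdot> df X i = zmor D (ob X i) (cd g)"
    have W: "cd g \<in> obj D" using g ar_dest by blast
    have "g \<in> kernel (Hom D (ob X (i + 1)) (cd g)) (Hom D (ob X i) (cd g)) (\<lambda>g. g \<cdot> df X i)"
      unfolding kernel_def using g ar_dest(3)[of g] by simp
    also have "\<dots> = (\<lambda>g. g \<cdot> df X (i + 1)) ` mor D (ob X (i + 2)) (cd g)"
      by (rule e[unfolded n_exangle_def, THEN conjunct2, THEN conjunct2, THEN conjunct2, THEN conjunct2, THEN bspec, OF W, THEN conjunct2, THEN conjunct2, THEN conjunct1, rule_format, OF i, symmetric])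
    finally obtain k where k: "k \<in> mor D (ob X (i + 2)) (cd g)" "g = k \<cdot> df X (Suc i)" by auto
    have "arr k (ob X (Suc (Suc i))) (cd g)" by (rule arrI) (use k(1) W i in simp_all)
    then show "\<exists>k. arr k (ob X (Suc (Suc i))) (cd g) \<and> g = k \<cdot> df X (Suc i)"
      using k(2) by blast
  qed
qed

lemma pull_factor:
  assumes X: "dist X \<delta>" and "ar g" "cd g = ob X (Suc n)"
    and "pull D G (ob X 0) g \<delta> = \<one>\<^bsub>ext G (dm g) (ob X 0)\<^esub>"
  obtains k where "ar k" "dm k = dm g" "cd k = ob X n" "g = df X n \<cdot> k"
proof -
  note e = dist_dest(4)[OF assms(1)]
  note [simp] = complex_dest[OF dist_dest(1)[OF assms(1)]]
  have W: "dm g \<in> obj D" using assms ar_dest by blast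
  have "g \<in> kernel (Hom D (dm g) (ob X (n + 1))) (ext G (dm g) (ob X 0)) (\<lambda>f. pull D G (ob X 0) f \<delta>)"
    unfolding kernel_def using assms ar_dest(3)[of g] by simp
  also have "\<dots> = (\<lambda>k. df X n \<cdot> k) ` mor D (dm g) (ob X n)"
    by (rule e[unfolded n_exangle_def, THEN conjunct2, THEN conjunct2, THEN conjunct2, THEN conjunct2, THEN bspec, OF W, THEN conjunct2, THEN conjunct1, symmetric])
  finally obtain k where k: "k \<in> mor D (dm g) (ob X n)" "g = df X n \<cdot> k" by blast
  then have "arr k (dm g) (ob X n)" using W by (intro arrI) simp_all
  then show ?thesis by (intro that[of k] k(2)) simp_all
qed

lemma push_factor:
  assumes X: "dist X \<delta>" and "ar g" "dm g = ob X 0"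
    and "push D G (ob X (Suc n)) g \<delta> = \<one>\<^bsub>ext G (ob X (Suc n)) (cd g)\<^esub>"
  obtains k where "ar k" "dm k = ob X 1" "cd k = cd g" "g = k \<cdot> df X 0"
proof -
  note e = dist_dest(4)[OF assms(1)]
  note [simp] = complex_dest[OF dist_dest(1)[OF assms(1)]]
  have W: "cd g \<in> obj D" using assms ar_dest by blast
  have "g \<in> kernel (Hom D (ob X 0) (cd g)) (ext G (ob X (n + 1)) (cd g)) (\<lambda>g. push D G (ob X (n + 1)) g \<delta>)"
    unfolding kernel_def using assms ar_dest(3)[of g] by simp
  also have "\<dots> = (\<lambda>k. k \<cdot> df X 0) ` mor D (ob X 1) (cd g)"
    by (rule e[unfolded n_exangle_def, THEN conjunct2, THEN conjunct2, THEN conjunct2, THEN conjunct2, THEN bspec, OF W, THEN conjunct2, THEN conjunct2, THEN conjunct2, symmetric])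
  finally obtain k where k: "k \<in> mor D (ob X 1) (cd g)" "g = k \<cdot> df X 0" by blast
  then have "arr k (ob X 1) (cd g)" using W by (intro arrI) simp_all
  then show ?thesis by (intro that[of k] k(2)) simp_all
qed

text \<open>
  This is how complexes are recognised as conflations below: exactness of \<open>Y\<close> is required on one
  side only, and the two chain maps may be arbitrary lifts of the identities of the ends.
\<close>

lemma dist_comparison:
  assumes X: "dist X \<delta>" and Y: "Y \<in> complexes_between n D (ob X 0) (ob X (Suc n))" "right_exact n Y"
    and "chain_map n D X Y f" "f 0 = idn D (ob X 0)" "f (Suc n) = idn D (ob X (Suc n))"
    and "chain_map n D Y X g" "g 0 = idn D (ob X 0)" "g (Suc n) = idn D (ob X (Suc n))"
  shows "dist Y \<delta>"
proof (rule dist_homotopy_equivalent[OF X Y(1)])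
  show "homotopy_equivalent n D (ob X 0) (ob X (Suc n)) X Y"
    using homotopy_equivalentI_right_exact[OF dist_dest(7)[OF X] Y(1) right_exact_dist[OF X] Y(2)] assms(4-9)
    unfolding chain_map_between_def by simp
qed

end

section \<open>Exactness at the groups of extensions\<close>

context n_exangulated_category
begin

lemma EA2_cone:
  assumes X: "dist X (pull D G (ob Y 0) c \<rho>)" and Y: "dist Y \<rho>" and "ob X 0 = ob Y 0"
    and "ar c" "dm c = ob X (Suc n)" "cd c = ob Y (Suc n)"
  obtains f where "chain_map n D X Y f" "f 0 = idn D (ob X 0)" "f (Suc n) = c"
    "dist (coneM n D X Y f) (push D G (ob Y (Suc n)) (df X 0) \<rho>)"
proof -
  have "c \<in> mor D (ob X (n + 1)) (ob Y (n + 1))" using assms(4-6) ar_dest(3)[of c] by simp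
  from EA2[OF assms(3) this X Y] show ?thesis using that by auto
qed

lemma EA2_op_cone:
  assumes X: "dist X \<delta>" and Y: "dist Y (push D G (ob X (Suc n)) a \<delta>)" and "ob X (Suc n) = ob Y (Suc n)"
    and "ar a" "dm a = ob X 0" "cd a = ob Y 0"
  obtains f where "chain_map n D X Y f" "f 0 = a" "f (Suc n) = idn D (ob X (Suc n))"
    "dist (coneN n D X Y f) (pull D G (ob X 0) (df Y n) \<delta>)"
proof -
  have "a \<in> mor D (ob X 0) (ob Y 0)" using assms(4-6) ar_dest(3)[of a] by simp
  from EA2_op[of X Y a \<delta>, OF _ this X] assms(3) Y show ?thesis using that by auto
qed

text \<open>
  Consider the extension \<open>\<eta>\<close> by \<open>ob X 0\<close> of the direct sum of \<open>ob X (Suc n)\<close> and \<open>T\<close> with the two components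
  \<open>\<delta>\<close> and \<open>\<epsilon>\<close>. The first inclusion pulls \<open>\<eta>\<close> back to \<open>\<delta>\<close>, and the cone of a suitable lift of it
  has the extension \<open>(df X 0)\<^sub>*\<eta> = 0\<close>. Its last differential therefore splits. It consists of the first
  inclusion and of a morphism that pulls \<open>\<eta>\<close> back to zero, so \<open>\<eta>\<close> is a pullback of \<open>\<delta>\<close>, and so is \<open>\<epsilon>\<close>.
\<close>

lemma ext_exact:
  assumes n: "n \<ge> 1" and X: "dist X \<delta>" and T: "T \<in> obj D" and \<epsilon>: "\<epsilon> \<in> carrier (ext G T (ob X 0))"
    and z: "push D G T (df X 0) \<epsilon> = \<one>\<^bsub>ext G T (ob X 1)\<^esub>"
  obtains c where "ar c" "dm c = T" "cd c = ob X (Suc n)" "\<epsilon> = pull D G (ob X 0) c \<delta>"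
proof -
  note [simp] = complex_dest[OF dist_dest(1)[OF X]] T
  let ?A = "ob X 0" let ?C = "ob X (Suc n)"
  let ?S = "dsum D ?C T"
  have d: "\<delta> \<in> carrier (ext G ?C ?A)" using dist_dest(2)[OF X] .
  interpret ES: group "ext G ?S ?A" by (rule ext_group) simp_all
  interpret EC: group "ext G ?C ?A" by (rule ext_group) simp_all
  interpret ET: group "ext G T ?A" by (rule ext_group) simp_all
  interpret ES1: group "ext G ?S (ob X (Suc 0))" by (rule ext_group) simp_all
  define \<eta> where "\<eta> = pull D G ?A (prj1 D ?C T) \<delta> \<otimes>\<^bsub>ext G ?S ?A\<^esub> pull D G ?A (prj2 D ?C T) \<epsilon>"
  have p1: "pull D G ?A (prj1 D ?C T) \<delta> \<in> carrier (ext G ?S ?A)"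
    using d by (intro pull_mem) simp_all
  have p2: "pull D G ?A (prj2 D ?C T) \<epsilon> \<in> carrier (ext G ?S ?A)"
    using \<epsilon> by (intro pull_mem) simp_all
  have \<eta>: "\<eta> \<in> carrier (ext G ?S ?A)" unfolding \<eta>_def using p1 p2 by simp
  obtain U where U: "dist U \<eta>" and U0: "ob U 0 = ?A" and Un: "ob U (Suc n) = ?S"
    using dist_exists[OF _ _ \<eta>] by auto
  have i1: "pull D G ?A (inj1 D ?C T) \<eta> = \<delta>"
  proof -
    have "pull D G ?A (inj1 D ?C T) \<eta> = pull D G ?A (inj1 D ?C T) (pull D G ?A (prj1 D ?C T) \<delta>)
        \<otimes>\<^bsub>ext G ?C ?A\<^esub> pull D G ?A (inj1 D ?C T) (pull D G ?A (prj2 D ?C T) \<epsilon>)"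
      unfolding \<eta>_def using p1 p2 by (intro pull_mult) simp_all
    also have "\<dots> = \<delta>"
      using d \<epsilon> pull_cmp[of "prj1 D ?C T" "inj1 D ?C T" ?A \<delta>, symmetric]
        pull_cmp[of "prj2 D ?C T" "inj1 D ?C T" ?A \<epsilon>, symmetric]
      by (simp add: pull_idn pull_zmor)
    finally show ?thesis .
  qed
  have i2: "pull D G ?A (inj2 D ?C T) \<eta> = \<epsilon>"
  proof -
    have "pull D G ?A (inj2 D ?C T) \<eta> = pull D G ?A (inj2 D ?C T) (pull D G ?A (prj1 D ?C T) \<delta>)
        \<otimes>\<^bsub>ext G T ?A\<^esub> pull D G ?A (inj2 D ?C T) (pull D G ?A (prj2 D ?C T) \<epsilon>)"
      unfolding \<eta>_def using p1 p2 by (intro pull_mult) simp_all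
    also have "\<dots> = \<epsilon>"
      using d \<epsilon> pull_cmp[of "prj1 D ?C T" "inj2 D ?C T" ?A \<delta>, symmetric]
        pull_cmp[of "prj2 D ?C T" "inj2 D ?C T" ?A \<epsilon>, symmetric]
      by (simp add: pull_idn pull_zmor)
    finally show ?thesis .
  qed
  have "dist X (pull D G (ob U 0) (inj1 D ?C T) \<eta>)" using X i1 U0 by simp
  then obtain f where f: "chain_map n D X U f" "f 0 = idn D ?A" "f (Suc n) = inj1 D ?C T"
    and M: "dist (coneM n D X U f) (push D G (ob U (Suc n)) (df X 0) \<eta>)"
    by (rule EA2_cone[OF _ U]) (simp_all add: U0 Un)
  note [simp] = complex_dest[OF dist_dest(1)[OF U]]
  have "push D G ?S (df X 0) \<eta> = push D G ?S (df X 0) (pull D G ?A (prj1 D ?C T) \<delta>)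
      \<otimes>\<^bsub>ext G ?S (ob X 1)\<^esub> push D G ?S (df X 0) (pull D G ?A (prj2 D ?C T) \<epsilon>)"
    unfolding \<eta>_def using p1 p2 by (intro push_mult) simp_all
  also have "\<dots> = \<one>\<^bsub>ext G ?S (ob X 1)\<^esub>"
    using d \<epsilon> z push_df[OF X]
      push_pull[of "df X 0" ?A "ob X 1" "prj1 D ?C T" ?S ?C \<delta>]
      push_pull[of "df X 0" ?A "ob X 1" "prj2 D ?C T" ?S T \<epsilon>]
    by (simp add: pull_one)
  finally have M1: "push D G ?S (df X 0) \<eta> = \<one>\<^bsub>ext G ?S (ob X 1)\<^esub>" .
  have M0: "ob (coneM n D X U f) 0 = ob X 1" "ob (coneM n D X U f) (Suc n) = ?S"
    "ob (coneM n D X U f) n = dsum D ?C (ob U n)"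
    using n Un unfolding coneM_def by auto
  have Md: "df (coneM n D X U f) n = inj1 D ?C T \<cdot> prj1 D ?C (ob U n) \<oplus> df U n \<cdot> prj2 D ?C (ob U n)"
    unfolding coneM_def using n f(3) Un by (simp add: mrow_eq)
  have pull_id_one: "pull D G (ob X 1) (idn D ?S) \<one>\<^bsub>ext G ?S (ob X 1)\<^esub> = \<one>\<^bsub>ext G ?S (ob X 1)\<^esub>"
    by (rule pull_one) simp_all
  \<comment> \<open>As the cone has extension zero, the identity of its end term factors through its last differential.\<close>
  obtain m where m0: "ar m" "dm m = dm (idn D ?S)" "cd m = ob (coneM n D X U f) n"
    and m': "idn D ?S = df (coneM n D X U f) n \<cdot> m"
    by (rule pull_factor[OF M[unfolded Un], of "idn D ?S"]) (use pull_id_one in \<open>simp_all add: M0 M1\<close>)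
  have m: "ar m" "dm m = ?S" "cd m = dsum D ?C (ob U n)" using m0 M0 by simp_all
  define x where "x = prj1 D ?C (ob U n) \<cdot> m"
  define y where "y = prj2 D ?C (ob U n) \<cdot> m"
  have xy [simp]: "ar x" "dm x = ?S" "cd x = ?C" "ar y" "dm y = ?S" "cd y = ob U n"
    unfolding x_def y_def using m by simp_all
  have id: "idn D ?S = inj1 D ?C T \<cdot> x \<oplus> df U n \<cdot> y"
    using m m' Un unfolding Md x_def y_def by simp
  have "\<eta> = pull D G ?A (inj1 D ?C T \<cdot> x \<oplus> df U n \<cdot> y) \<eta>"
    using \<eta> unfolding id[symmetric] by (simp add: pull_idn)
  also have "\<dots> = pull D G ?A (inj1 D ?C T \<cdot> x) \<eta> \<otimes>\<^bsub>ext G ?S ?A\<^esub> pull D G ?A (df U n \<cdot> y) \<eta>"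
    using \<eta> Un by (intro pull_plus) simp_all
  also have "pull D G ?A (df U n \<cdot> y) \<eta> = \<one>\<^bsub>ext G ?S ?A\<^esub>"
    using \<eta> Un U0 pull_df[OF U] by (simp add: pull_cmp pull_one)
  also have "pull D G ?A (inj1 D ?C T \<cdot> x) \<eta> = pull D G ?A x \<delta>"
    using \<eta> i1 by (simp add: pull_cmp)
  finally have "\<eta> = pull D G ?A x \<delta>" using d pull_mem[of x ?S ?C ?A \<delta>] by simp
  then have "\<epsilon> = pull D G ?A (x \<cdot> inj2 D ?C T) \<delta>" using i2 d by (simp add: pull_cmp)
  then show ?thesis using that[of "x \<cdot> inj2 D ?C T"] by simp
qed

end

section \<open>Exchange of the second term of a conflation\<close>

text \<open>
  Suppose that \<open>h\<close> and the first differential of \<open>K\<close> factor through each other, say \<open>h = q \<cdot> d0\<close> and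
  \<open>d0 = p \<cdot> h\<close>. Then \<open>1 - p \<cdot> q\<close> vanishes on \<open>d0\<close> and factors as \<open>t \<cdot> d1\<close>. The complex
  
    \<open>K\<^sub>0 \<rightarrow> Y \<rightarrow> K\<^sub>2 \<oplus> Y \<rightarrow> K\<^sub>3 \<oplus> K\<^sub>1 \<rightarrow> K\<^sub>4 \<rightarrow> \<cdots>\<close>
  
  with first differential \<open>h\<close> arises from \<open>K\<close> as follows: add \<open>Y\<close> in degrees 1 and 2 and \<open>K\<^sub>1\<close> in
  degrees 2 and 3, each time joined by an identity, change the basis so that the first differential
  becomes \<open>(0, h)\<close>, and split off the summand \<open>K\<^sub>1\<close> in degrees 1 and 2. For \<open>n = 2\<close> degree 3 is the end, so the end term changes.
\<close>

locale degree_one_exchange = additive_category D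
  for D :: "('o, 'm) category_data" (structure) +
  fixes n :: nat and K :: "('o, 'm) cpx" and Y :: 'o and h p q t :: 'm
  assumes n: "n \<ge> 2" and K: "is_complex n D K" and K_exact: "right_exact n K"
    and h: "arr h (ob K 0) Y" and p: "arr p Y (ob K 1)" and q: "arr q (ob K 1) Y"
    and t: "arr t (ob K 2) (ob K 1)"
    and q_df: "q \<cdot> df K 0 = h" and p_h: "p \<cdot> h = df K 0"
    and t_df: "t \<cdot> df K 1 = idn D (ob K 1) \<ominus> p \<cdot> q"
begin

abbreviation K1 where "K1 \<equiv> ob K (Suc 0)"
abbreviation K2 where "K2 \<equiv> ob K (Suc (Suc 0))"
abbreviation K3 where "K3 \<equiv> ob K (Suc (Suc (Suc 0)))"
abbreviation d0 where "d0 \<equiv> df K 0"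
abbreviation d1 where "d1 \<equiv> df K (Suc 0)"
abbreviation d2 where "d2 \<equiv> df K (Suc (Suc 0))"

definition e1 where
  "e1 = inj1 D K2 Y \<cdot> d1 \<cdot> p \<oplus> inj2 D K2 Y \<cdot> (q \<cdot> p \<ominus> idn D Y)"

definition e2 where
  "e2 = inj1 D K3 K1 \<cdot> d2 \<cdot> prj1 D K2 Y \<oplus> inj2 D K3 K1 \<cdot> (t \<cdot> prj1 D K2 Y \<oplus> p \<cdot> prj2 D K2 Y)"

definition W :: "('o, 'm) cpx" where
  "W = \<lparr>ob = (\<lambda>i. if i = 1 then Y else if i = 2 then dsum D K2 Y else if i = 3 then dsum D K3 K1 else ob K i),
        df = (\<lambda>i. if i = 0 then h else if i = 1 then e1 else if i = 2 then e2
                  else if i = 3 then df K 3 \<cdot> prj1 D K3 K1 else df K i)\<rparr>"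

lemma W_simps [simp]:
  "ob W 0 = ob K 0" "ob W (Suc 0) = Y" "ob W (Suc (Suc 0)) = dsum D K2 Y"
  "ob W (Suc (Suc (Suc 0))) = dsum D K3 K1"
  "ob W (Suc (Suc (Suc (Suc i)))) = ob K (Suc (Suc (Suc (Suc i))))"
  "df W 0 = h" "df W (Suc 0) = e1" "df W (Suc (Suc 0)) = e2"
  "df W (Suc (Suc (Suc 0))) = df K (Suc (Suc (Suc 0))) \<cdot> prj1 D K3 K1"
  "df W (Suc (Suc (Suc (Suc i)))) = df K (Suc (Suc (Suc (Suc i))))"
  by (simp_all add: W_def eval_nat_numeral)

lemma n_simps [simp]: "0 < n" "Suc 0 < n" "Suc 0 \<le> n" "Suc (Suc 0) \<le> n"
  using n by auto

lemma K_simps [simp]: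
  "i \<le> Suc n \<Longrightarrow> ob K i \<in> obj D" "i \<le> n \<Longrightarrow> ar (df K i)" "i \<le> n \<Longrightarrow> dm (df K i) = ob K i"
  "i \<le> n \<Longrightarrow> cd (df K i) = ob K (Suc i)"
  "i < n \<Longrightarrow> df K (Suc i) \<cdot> df K i = zmor D (ob K i) (ob K (Suc (Suc i)))"
  "i < n \<Longrightarrow> ar x \<Longrightarrow> cd x = ob K i \<Longrightarrow>
    df K (Suc i) \<cdot> df K i \<cdot> x = zmor D (dm x) (ob K (Suc (Suc i)))"
  using complex_dest[OF K] df_df_cmp[OF K] by auto

lemma arrow_simps [simp]:
  "ar h" "dm h = ob K 0" "cd h = Y" "ar p" "dm p = Y" "cd p = K1" "ar q" "dm q = K1" "cd q = Y"
  "ar t" "dm t = K2" "cd t = K1" "q \<cdot> d0 = h" "p \<cdot> h = d0" "t \<cdot> d1 = idn D K1 \<ominus> p \<cdot> q"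
  using h p q t q_df p_h t_df by (simp_all add: eval_nat_numeral)

lemma Y_obj [simp]: "Y \<in> obj D"
  using ar_dest(2)[of h] by simp

lemma t_d1_cmp [simp]:
  assumes "ar x" "cd x = K1"
  shows "t \<cdot> d1 \<cdot> x = x \<ominus> p \<cdot> q \<cdot> x"
proof -
  have "t \<cdot> d1 \<cdot> x = (t \<cdot> d1) \<cdot> x" by (rule cmp_assoc'[symmetric]) (simp_all add: assms)
  then show ?thesis using assms by simp
qed

lemma p_h_cmp [simp]:
  assumes "ar x" "cd x = ob K 0"
  shows "p \<cdot> h \<cdot> x = d0 \<cdot> x" "q \<cdot> d0 \<cdot> x = h \<cdot> x"
  using cmp_assoc'[of x h p] cmp_assoc'[of x d0 q] assms by simp_all

lemma e_simps [simp]: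
  "ar e1" "dm e1 = Y" "cd e1 = dsum D K2 Y"
  "ar e2" "dm e2 = dsum D K2 Y" "cd e2 = dsum D K3 K1"
  unfolding e1_def e2_def by simp_all

lemma cases_degree:
  obtains "i = 0" | "i = Suc 0" | "i = Suc (Suc 0)" | "i = Suc (Suc (Suc 0))"
    | j where "i = Suc (Suc (Suc (Suc j)))"
  by (metis not0_implies_Suc)

lemma W_complex: "is_complex n D W"
proof -
  have "ob W i \<in> obj D" if "i \<le> Suc n" for i
    by (rule cases_degree[of i]) (use that in simp_all)
  moreover have "arr (df W i) (ob W i) (ob W (Suc i))" if "i \<le> n" for i
    by (rule cases_degree[of i]) (use that in simp_all)
  moreover have "df W (Suc i) \<cdot> df W i = zmor D (ob W i) (ob W (Suc (Suc i)))" if "i < n" for i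
  proof (rule cases_degree[of i])
    assume "i = 0"
    then show ?thesis by (simp add: e1_def)
  next
    assume "i = Suc 0"
    then show ?thesis by (simp add: e1_def e2_def additive_simps)
  next
    assume "i = Suc (Suc 0)"
    then show ?thesis using that by (simp add: e2_def)
  qed (use that in simp_all)
  ultimately show ?thesis unfolding complex_iff by blast
qed

text \<open>
  In each degree a factorisation through \<open>K\<close> is found first and then corrected by the components on
  the new summands, using \<open>t \<cdot> d1 = 1 - p \<cdot> q\<close>.
\<close>

lemma W_exact: "right_exact n W"
  unfolding right_exact_def
proof (intro allI impI)
  fix i g assume i: "i < n" and g: "ar g \<and> dm g = ob W (Suc i) \<and> g \<cdot> df W i = zmor D (ob W i) (cd g)"
  define T where "T = cd g"
  have g' [simp]: "ar g" "dm g = ob W (Suc i)" "cd g = T" and gd: "g \<cdot> df W i = zmor D (ob W i) T"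
    using g by (auto simp: T_def)
  have T [simp]: "T \<in> obj D" using ar_dest(2)[of g] by simp
  have "\<exists>k. arr k (ob W (Suc (Suc i))) T \<and> g = k \<cdot> df W (Suc i)"
  proof (rule cases_degree[of i])
    assume [simp]: "i = 0"
    have gq: "ar (g \<cdot> q)" "dm (g \<cdot> q) = K1" "cd (g \<cdot> q) = T"
      "(g \<cdot> q) \<cdot> d0 = zmor D (ob K 0) (cd (g \<cdot> q))"
      using gd by simp_all
    obtain y where y: "ar y" "dm y = K2" "cd y = T" "g \<cdot> q = y \<cdot> d1"
      using right_exactD[OF K_exact n_simps(1) gq(1,2,4)] unfolding gq(3) .
    have "y \<cdot> d1 \<cdot> p = g \<cdot> q \<cdot> p"
      using y cmp_assoc'[of p d1 y] cmp_assoc'[of p q g] by simp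
    then have "g = (y \<cdot> prj1 D K2 Y \<ominus> g \<cdot> prj2 D K2 Y) \<cdot> e1"
      using y by (simp add: e1_def additive_simps)
    then show ?thesis using y by (intro exI[of _ "y \<cdot> prj1 D K2 Y \<ominus> g \<cdot> prj2 D K2 Y"]) simp
  next
    assume [simp]: "i = Suc 0"
    define x where "x = g \<cdot> inj1 D K2 Y"
    define y where "y = g \<cdot> inj2 D K2 Y"
    have xy [simp]: "ar x" "dm x = K2" "cd x = T" "ar y" "dm y = Y" "cd y = T"
      unfolding x_def y_def by simp_all
    have "x \<cdot> d1 \<cdot> p \<oplus> y \<cdot> (q \<cdot> p \<ominus> idn D Y) = zmor D Y T"
      using gd unfolding x_def y_def by (simp add: e1_def)
    then have y_eq: "(y \<cdot> q \<oplus> x \<cdot> d1) \<cdot> p = y" by (simp add: additive_simps)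
    define b where "b = y \<cdot> q \<oplus> x \<cdot> d1"
    have b [simp]: "ar b" "dm b = K1" "cd b = T" "b \<cdot> p = y" unfolding b_def using y_eq by simp_all
    have "b \<cdot> p \<cdot> q = y \<cdot> q" using cmp_assoc'[of q p b] by simp
    then have "(x \<ominus> b \<cdot> t) \<cdot> d1 = x \<cdot> d1 \<ominus> (b \<ominus> y \<cdot> q)" by simp
    also have "\<dots> = zmor D K1 T" unfolding b_def by (simp add: additive_simps)
    finally have "(x \<ominus> b \<cdot> t) \<cdot> d1 = zmor D K1 T" .
    then have xb: "ar (x \<ominus> b \<cdot> t)" "dm (x \<ominus> b \<cdot> t) = K2" "cd (x \<ominus> b \<cdot> t) = T"
      "(x \<ominus> b \<cdot> t) \<cdot> d1 = zmor D K1 (cd (x \<ominus> b \<cdot> t))"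
      by simp_all
    obtain a where a: "ar a" "dm a = K3" "cd a = T" "x \<ominus> b \<cdot> t = a \<cdot> d2"
      using right_exactD[OF K_exact n_simps(2) xb(1,2,4)] unfolding xb(3) .
    then have x_eq: "x = b \<cdot> t \<oplus> a \<cdot> d2" by (simp add: additive_simps)
    have "g = x \<cdot> prj1 D K2 Y \<oplus> y \<cdot> prj2 D K2 Y"
      unfolding x_def y_def by (rule cmp_inj_prj) simp_all
    also have "\<dots> = (a \<cdot> prj1 D K3 K1 \<oplus> b \<cdot> prj2 D K3 K1) \<cdot> e2"
      unfolding x_eq b(4)[symmetric] using a by (simp add: e2_def additive_simps del: b(4))
    finally show ?thesis using a by (intro exI[of _ "a \<cdot> prj1 D K3 K1 \<oplus> b \<cdot> prj2 D K3 K1"]) simp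
  next
    assume i2 [simp]: "i = Suc (Suc 0)"
    have n3 [simp]: "Suc (Suc 0) < n" "Suc (Suc (Suc 0)) \<le> n" using i by simp_all
    define x where "x = g \<cdot> inj1 D K3 K1"
    define y where "y = g \<cdot> inj2 D K3 K1"
    have xy [simp]: "ar x" "dm x = K3" "cd x = T" "ar y" "dm y = K1" "cd y = T"
      unfolding x_def y_def by simp_all
    have g_eq: "g = x \<cdot> prj1 D K3 K1 \<oplus> y \<cdot> prj2 D K3 K1"
      unfolding x_def y_def by (rule cmp_inj_prj) simp_all
    have ge: "g \<cdot> e2 = zmor D (dsum D K2 Y) T" using gd by simp
    have "(g \<cdot> e2) \<cdot> inj1 D K2 Y = x \<cdot> d2 \<oplus> y \<cdot> t"
      unfolding x_def y_def by (simp add: e2_def)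
    then have xt: "x \<cdot> d2 \<oplus> y \<cdot> t = zmor D K2 T" unfolding ge by simp
    have "(g \<cdot> e2) \<cdot> inj2 D K2 Y = y \<cdot> p"
      unfolding x_def y_def by (simp add: e2_def)
    then have yp: "y \<cdot> p = zmor D Y T" unfolding ge by simp
    have "(x \<cdot> d2 \<oplus> y \<cdot> t) \<cdot> d1 = y \<ominus> (y \<cdot> p) \<cdot> q" by simp
    then have y0: "y = zmor D K1 T" unfolding xt yp by simp
    then have "x \<cdot> d2 = zmor D K2 T" using xt by simp
    then have xd: "x \<cdot> d2 = zmor D K2 (cd x)" by simp
    obtain z where z: "ar z" "dm z = ob K (Suc (Suc (Suc (Suc 0))))" "cd z = T"
        "x = z \<cdot> df K (Suc (Suc (Suc 0)))"
      using right_exactD[OF K_exact n3(1) xy(1,2) xd] unfolding xy(3) .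
    have "g = z \<cdot> df W (Suc i)" unfolding g_eq y0 z(4) using z(1-3) by simp
    then show ?thesis using z by (intro exI[of _ z]) simp
  next
    assume i3 [simp]: "i = Suc (Suc (Suc 0))"
    have n4 [simp]: "Suc (Suc (Suc 0)) < n" "Suc (Suc (Suc 0)) \<le> n" "Suc (Suc (Suc (Suc 0))) \<le> n"
      using i by simp_all
    have "(g \<cdot> df W i) \<cdot> inj1 D K3 K1 = g \<cdot> df K (Suc (Suc (Suc 0)))" by simp
    then have g3: "g \<cdot> df K (Suc (Suc (Suc 0))) = zmor D K3 (cd g)" unfolding gd by simp
    have "dm g = ob K (Suc (Suc (Suc (Suc 0))))" by simp
    then obtain k where "ar k" "dm k = ob K (Suc (Suc (Suc (Suc (Suc 0)))))" "cd k = T"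
        "g = k \<cdot> df K (Suc (Suc (Suc (Suc 0))))"
      using right_exactD[OF K_exact n4(1) g'(1) _ g3, unfolded g'(3)] by blast
    then show ?thesis by (intro exI[of _ k]) simp
  next
    fix j assume [simp]: "i = Suc (Suc (Suc (Suc j)))"
    have gd': "g \<cdot> df K i = zmor D (ob K i) (cd g)" using gd by simp
    have "dm g = ob K (Suc i)" by simp
    then obtain k where "ar k" "dm k = ob K (Suc (Suc i))" "cd k = T" "g = k \<cdot> df K (Suc i)"
      using right_exactD[OF K_exact i g'(1) _ gd', unfolded g'(3)] by blast
    then show ?thesis by (intro exI[of _ k]) simp
  qed
  then show "\<exists>k. arr k (ob W (Suc (Suc i))) (cd g) \<and> g = k \<cdot> df W (Suc i)" unfolding g'(3) .
qed

text \<open>Chosen for \<open>a2 \<cdot> d1 = e1 \<cdot> q\<close>: here \<open>d1 \<cdot> p \<cdot> q = (1 - d1 \<cdot> t) \<cdot> d1\<close> and \<open>q \<cdot> p \<cdot> q - q = - q \<cdot> t \<cdot> d1\<close>.\<close>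

definition a2 where "a2 = inj1 D K2 Y \<cdot> (idn D K2 \<ominus> d1 \<cdot> t) \<ominus> inj2 D K2 Y \<cdot> q \<cdot> t"

lemma a2_simps [simp]:
  "ar a2" "dm a2 = K2" "cd a2 = dsum D K2 Y"
  "a2 \<cdot> d1 = e1 \<cdot> q" "e2 \<cdot> a2 = inj1 D K3 K1 \<cdot> d2"
  unfolding a2_def by (simp_all add: e1_def e2_def additive_simps)

definition into_W :: "nat \<Rightarrow> 'm" where
  "into_W i = (if i = 1 then q else if i = 2 then a2 else if i = 3 then inj1 D K3 K1 else idn D (ob K i))"

definition from_W :: "nat \<Rightarrow> 'm" where
  "from_W i = (if i = 1 then p else if i = 2 then prj1 D K2 Y else if i = 3 then prj1 D K3 K1 else idn D (ob K i))"

lemma into_W_simps [simp]: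
  "into_W 0 = idn D (ob K 0)" "into_W (Suc 0) = q" "into_W (Suc (Suc 0)) = a2"
  "into_W (Suc (Suc (Suc 0))) = inj1 D K3 K1"
  "into_W (Suc (Suc (Suc (Suc i)))) = idn D (ob K (Suc (Suc (Suc (Suc i)))))"
  by (simp_all add: into_W_def eval_nat_numeral)

lemma from_W_simps [simp]:
  "from_W 0 = idn D (ob K 0)" "from_W (Suc 0) = p" "from_W (Suc (Suc 0)) = prj1 D K2 Y"
  "from_W (Suc (Suc (Suc 0))) = prj1 D K3 K1"
  "from_W (Suc (Suc (Suc (Suc i)))) = idn D (ob K (Suc (Suc (Suc (Suc i)))))"
  by (simp_all add: from_W_def eval_nat_numeral)

lemma into_W_chain_map: "chain_map n D K W into_W"
proof -
  have "arr (into_W i) (ob K i) (ob W i)" if "i \<le> Suc n" for i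
    by (rule cases_degree[of i]) (use that in simp_all)
  moreover have "into_W (Suc i) \<cdot> df K i = df W i \<cdot> into_W i" if "i \<le> n" for i
    by (rule cases_degree[of i]) (use that in simp_all)
  ultimately show ?thesis unfolding chain_map_iff[OF K W_complex] by blast
qed

lemma from_W_chain_map: "chain_map n D W K from_W"
proof -
  have "arr (from_W i) (ob W i) (ob K i)" if "i \<le> Suc n" for i
    by (rule cases_degree[of i]) (use that in simp_all)
  moreover have "from_W (Suc i) \<cdot> df W i = df K i \<cdot> from_W i" if "i \<le> n" for i
    by (rule cases_degree[of i]) (use that in \<open>simp_all add: e1_def e2_def\<close>)
  ultimately show ?thesis unfolding chain_map_iff[OF W_complex K] by blast
qed

end

context exact_realisation
begin

text \<open>
  The exchanged complex is compared with a conflation. For \<open>n \<ge> 3\<close> its ends are those of \<open>K\<close>, and \<open>K\<close>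
  itself serves. For \<open>n = 2\<close> its end term is \<open>K\<^sub>3 \<oplus> K\<^sub>1\<close>, and the comparison is with a realisation
  \<open>L\<close> of the pullback of \<open>\<theta>\<close> to this sum. The chain maps between \<open>K\<close> and \<open>L\<close> that lift the inclusion
  and the projection of the end terms are then composed with those between \<open>K\<close> and the exchanged
  complex, and corrected on the summand \<open>K\<^sub>1\<close>.
\<close>

lemma inflation_exchange:
  assumes n: "n \<ge> 2" and K: "dist K \<theta>"
    and h: "arr h (ob K 0) Y" and p: "arr p Y (ob K 1)" and q: "arr q (ob K 1) Y"
    and q_df: "q \<cdot> df K 0 = h" and p_h: "p \<cdot> h = df K 0"
  obtains W \<rho> where "dist W \<rho>" "df W 0 = h" "ob W 0 = ob K 0" "ob W 1 = Y"
    "ob W 2 = dsum D (ob K 2) Y" "ob W 3 = dsum D (ob K 3) (ob K 1)"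
    "\<And>i. i \<ge> 4 \<Longrightarrow> ob W i = ob K i"
proof -
  note Kc = dist_dest(1)[OF K]
  note [simp] = complex_dest[OF Kc]
  have n1: "0 < n" using n by simp
  have pq: "ar (idn D (ob K 1) \<ominus> p \<cdot> q)" "dm (idn D (ob K 1) \<ominus> p \<cdot> q) = ob K (Suc 0)"
    "cd (idn D (ob K 1) \<ominus> p \<cdot> q) = ob K (Suc 0)"
    using n p q by simp_all
  have "(idn D (ob K 1) \<ominus> p \<cdot> q) \<cdot> df K 0 = zmor D (ob K 0) (cd (idn D (ob K 1) \<ominus> p \<cdot> q))"
    unfolding pq(3) using n p q q_df p_h by simp
  then obtain t where "ar t" "dm t = ob K (Suc (Suc 0))" "cd t = ob K (Suc 0)"
      "idn D (ob K 1) \<ominus> p \<cdot> q = t \<cdot> df K (Suc 0)"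
    using right_exactD[OF right_exact_dist[OF K] n1 pq(1,2), unfolded pq(3)] pq(3) by metis
  then have t: "arr t (ob K 2) (ob K 1)" "t \<cdot> df K 1 = idn D (ob K 1) \<ominus> p \<cdot> q"
    by (simp_all add: eval_nat_numeral)
  interpret E: degree_one_exchange D n K Y h p q t
    by unfold_locales (use n Kc right_exact_dist[OF K] h p q t q_df p_h in simp_all)
  have "\<exists>\<rho>. dist E.W \<rho>"
  proof (cases "n = 2")
    case False
    then have "3 \<le> n" using n by linarith
    then obtain j where j: "n = Suc (Suc (Suc j))" by (auto simp: le_iff_add)
    have e: "ob E.W (Suc n) = ob K (Suc n)" "E.into_W (Suc n) = idn D (ob K (Suc n))"
      "E.from_W (Suc n) = idn D (ob K (Suc n))"
      unfolding j by simp_all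
    have "E.W \<in> complexes_between n D (ob K 0) (ob K (Suc n))"
      unfolding complexes_between_def using E.W_complex e by simp
    from dist_comparison[OF K this E.W_exact E.into_W_chain_map _ _ E.from_W_chain_map] e
    show ?thesis by auto
  next
    case True
    then have n2 [simp]: "n = Suc (Suc 0)" by simp
    have \<theta>: "\<theta> \<in> carrier (ext G E.K3 (ob K 0))" using dist_dest(2)[OF K] by simp
    let ?S = "dsum D E.K3 E.K1"
    define \<theta>' where "\<theta>' = pull D G (ob K 0) (prj1 D E.K3 E.K1) \<theta>"
    have \<theta>': "\<theta>' \<in> carrier (ext G ?S (ob K 0))"
      unfolding \<theta>'_def using \<theta> by (intro pull_mem) simp_all
    obtain L where L: "dist L \<theta>'" and L0 [simp]: "ob L 0 = ob K 0" and L3: "ob L (Suc n) = ?S"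
      by (rule dist_exists[OF _ _ \<theta>']) simp_all
    then have L3' [simp]: "ob L (Suc (Suc (Suc 0))) = ?S" by simp
    note Lc = dist_dest(1)[OF L]
    note Ld = complex_dest[OF Lc] df_df_cmp[OF Lc]
    let ?L1 = "ob L (Suc 0)" let ?L2 = "ob L (Suc (Suc 0))"
    let ?l0 = "df L 0" let ?l1 = "df L (Suc 0)" let ?l2 = "df L (Suc (Suc 0))"
    have l [simp]: "?L1 \<in> obj D" "?L2 \<in> obj D" "ar ?l0" "dm ?l0 = ob K 0" "cd ?l0 = ?L1"
      "ar ?l1" "dm ?l1 = ?L1" "cd ?l1 = ?L2" "ar ?l2" "dm ?l2 = ?L2" "cd ?l2 = ?S"
      "?l1 \<cdot> ?l0 = zmor D (ob K 0) ?L2" "?l2 \<cdot> ?l1 = zmor D ?L1 ?S"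
      using Ld(1)[of "Suc 0"] Ld(1)[of "Suc (Suc 0)"] Ld(2-5)[of 0] Ld(2-5)[of "Suc 0"]
        Ld(2-4)[of "Suc (Suc 0)"] by simp_all
    have "pull D G (ob K 0) (inj1 D E.K3 E.K1) \<theta>' = \<theta>"
      unfolding \<theta>'_def using \<theta> pull_cmp[of "prj1 D E.K3 E.K1" "inj1 D E.K3 E.K1" "ob K 0" \<theta>, symmetric]
      by (simp add: pull_idn)
    then have pp: "push D G (ob K (Suc n)) (idn D (ob K 0)) \<theta>
        = pull D G (ob L 0) (inj1 D E.K3 E.K1) \<theta>'"
      using \<theta> by (simp add: push_idn)
    have ar_ends: "ar (idn D (ob K 0))" "dm (idn D (ob K 0)) = ob K 0" "cd (idn D (ob K 0)) = ob L 0"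
        "ar (inj1 D E.K3 E.K1)" "dm (inj1 D E.K3 E.K1) = ob K (Suc n)" "cd (inj1 D E.K3 E.K1) = ob L (Suc n)"
        "dm (idn D (ob K 0)) = ob L 0" "cd (idn D (ob K 0)) = ob K 0"
        "ar (prj1 D E.K3 E.K1)" "dm (prj1 D E.K3 E.K1) = ob L (Suc n)" "cd (prj1 D E.K3 E.K1) = ob K (Suc n)"
      by simp_all
    obtain \<gamma> where \<gamma>: "chain_map n D K L \<gamma>" "\<gamma> 0 = idn D (ob K 0)" "\<gamma> (Suc n) = inj1 D E.K3 E.K1"
      by (rule dist_lift[OF K L ar_ends(1-6) pp])
    have pp': "push D G (ob L (Suc n)) (idn D (ob K 0)) \<theta>' = pull D G (ob K 0) (prj1 D E.K3 E.K1) \<theta>"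
      using \<theta>' by (simp add: push_idn) (simp add: \<theta>'_def)
    obtain \<kappa> where \<kappa>: "chain_map n D L K \<kappa>" "\<kappa> 0 = idn D (ob K 0)" "\<kappa> (Suc n) = prj1 D E.K3 E.K1"
      by (rule dist_lift[OF L K ar_ends(1,7-11) pp'])
    define g1 g2 where "g1 = \<gamma> (Suc 0)" and "g2 = \<gamma> (Suc (Suc 0))"
    define k1 k2 where "k1 = \<kappa> (Suc 0)" and "k2 = \<kappa> (Suc (Suc 0))"
    note gd = chain_map_dest[OF \<gamma>(1) Kc Lc]
    note kd = chain_map_dest[OF \<kappa>(1) Lc Kc]
    have g [simp]: "ar g1" "dm g1 = E.K1" "cd g1 = ?L1" "ar g2" "dm g2 = E.K2" "cd g2 = ?L2"
      "g1 \<cdot> E.d0 = ?l0" "g2 \<cdot> E.d1 = ?l1 \<cdot> g1" "?l2 \<cdot> g2 = inj1 D E.K3 E.K1 \<cdot> E.d2"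
      unfolding g1_def g2_def
      using gd(1-3)[of "Suc 0"] gd(1-3)[of "Suc (Suc 0)"] gd(4)[of 0] gd(4)[of 1] gd(4)[of 2] \<gamma>(2,3)
      by (simp_all add: numeral_2_eq_2)
    have k [simp]: "ar k1" "dm k1 = ?L1" "cd k1 = E.K1" "ar k2" "dm k2 = ?L2" "cd k2 = E.K2"
      "k1 \<cdot> ?l0 = E.d0" "k2 \<cdot> ?l1 = E.d1 \<cdot> k1" "E.d2 \<cdot> k2 = prj1 D E.K3 E.K1 \<cdot> ?l2"
      unfolding k1_def k2_def
      using kd(1-3)[of "Suc 0"] kd(1-3)[of "Suc (Suc 0)"] kd(4)[of 0] kd(4)[of 1] kd(4)[of 2] \<kappa>(2,3)
      by (simp_all add: numeral_2_eq_2)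
    have pi: "pull D G (ob L 0) (inj2 D E.K3 E.K1) \<theta>' = \<one>\<^bsub>ext G (dm (inj2 D E.K3 E.K1)) (ob L 0)\<^esub>"
      unfolding \<theta>'_def using \<theta> pull_cmp[of "prj1 D E.K3 E.K1" "inj2 D E.K3 E.K1" "ob K 0" \<theta>, symmetric]
      by (simp add: pull_zmor)
    have "ar (inj2 D E.K3 E.K1)" "cd (inj2 D E.K3 E.K1) = ob L (Suc n)" by simp_all
    \<comment> \<open>On the summand \<open>K\<^sub>1\<close> of the end term the extension of \<open>L\<close> vanishes, so the inclusion lifts to \<open>L\<^sub>2\<close>.\<close>
    then obtain j where j0: "ar j" "dm j = dm (inj2 D E.K3 E.K1)" "cd j = ob L n"
      "inj2 D E.K3 E.K1 = df L n \<cdot> j"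
      using pull_factor[OF L _ _ pi] by blast
    have j [simp]: "ar j" "dm j = E.K1" "cd j = ?L2" using j0(1-3) by simp_all
    have [simp]: "?l2 \<cdot> j = inj2 D E.K3 E.K1" using j0(4)[symmetric] by simp
    have [simp]: "?l2 \<cdot> ?l1 \<cdot> x = zmor D (dm x) ?S" if "ar x" "cd x = ?L1" for x
      using that cmp_assoc'[of x ?l1 ?l2] by simp
    have [simp]: "g2 \<cdot> E.d1 \<cdot> x = ?l1 \<cdot> g1 \<cdot> x" "?l2 \<cdot> j \<cdot> x = inj2 D E.K3 E.K1 \<cdot> x"
      if "ar x" "cd x = E.K1" for x
      using that cmp_assoc'[of x E.d1 g2] cmp_assoc'[of x j ?l2] by simp_all
    have [simp]: "?l2 \<cdot> g2 \<cdot> x = inj1 D E.K3 E.K1 \<cdot> E.d2 \<cdot> x" if "ar x" "cd x = E.K2" for x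
      using that cmp_assoc'[of x g2 ?l2] by simp
    have [simp]: "E.d2 \<cdot> k2 \<cdot> x = prj1 D E.K3 E.K1 \<cdot> ?l2 \<cdot> x" if "ar x" "cd x = ?L2" for x
      using that cmp_assoc'[of x k2 E.d2] by simp
    \<comment> \<open>The composite of \<open>from_W\<close> and \<open>\<gamma>\<close> is the identity in degree 3 only on \<open>K\<^sub>3\<close>; the term with \<open>j\<close>
      supplies \<open>K\<^sub>1\<close>.\<close>
    define \<omega> where "\<omega> i = (if i = 0 then idn D (ob K 0) else if i = 1 then g1 \<cdot> p
      else if i = 2 then g2 \<cdot> prj1 D E.K2 Y \<oplus> j \<cdot> (t \<cdot> prj1 D E.K2 Y \<oplus> p \<cdot> prj2 D E.K2 Y)
      else idn D ?S)" for i :: nat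
    have \<omega> [simp]: "\<omega> 0 = idn D (ob K 0)" "\<omega> (Suc 0) = g1 \<cdot> p" "\<omega> (Suc (Suc 0)) =
        g2 \<cdot> prj1 D E.K2 Y \<oplus> j \<cdot> (t \<cdot> prj1 D E.K2 Y \<oplus> p \<cdot> prj2 D E.K2 Y)"
      "\<omega> (Suc (Suc (Suc 0))) = idn D ?S"
      by (simp_all add: \<omega>_def eval_nat_numeral)
    \<comment> \<open>The column with entries \<open>d1\<close> and \<open>q\<close> is sent by \<open>e2\<close> to the inclusion of \<open>K\<^sub>1\<close>, which supplies the
      second component of the identity in degree 3.\<close>
    define \<upsilon> where "\<upsilon> i = (if i = 0 then idn D (ob K 0) else if i = 1 then q \<cdot> k1
      else if i = 2 then E.a2 \<cdot> k2 \<oplus>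
        (inj1 D E.K2 Y \<cdot> E.d1 \<oplus> inj2 D E.K2 Y \<cdot> q) \<cdot> prj2 D E.K3 E.K1 \<cdot> ?l2
      else idn D ?S)" for i :: nat
    have \<upsilon> [simp]: "\<upsilon> 0 = idn D (ob K 0)" "\<upsilon> (Suc 0) = q \<cdot> k1" "\<upsilon> (Suc (Suc 0)) = E.a2 \<cdot> k2 \<oplus>
        (inj1 D E.K2 Y \<cdot> E.d1 \<oplus> inj2 D E.K2 Y \<cdot> q) \<cdot> prj2 D E.K3 E.K1 \<cdot> ?l2"
      "\<upsilon> (Suc (Suc (Suc 0))) = idn D ?S"
      by (simp_all add: \<upsilon>_def eval_nat_numeral)
    have Wb: "E.W \<in> complexes_between n D (ob L 0) (ob L (Suc n))"
      unfolding complexes_between_def using E.W_complex by simp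
    have cases3: "i = 0 \<or> i = Suc 0 \<or> i = Suc (Suc 0) \<or> i = Suc (Suc (Suc 0))" if "i \<le> Suc n" for i
      using that by auto
    have w1: "arr (\<omega> i) (ob E.W i) (ob L i)" if "i \<le> Suc n" for i
      using cases3[OF that] by (elim disjE) simp_all
    have u1: "arr (\<upsilon> i) (ob L i) (ob E.W i)" if "i \<le> Suc n" for i
      using cases3[OF that] by (elim disjE) simp_all
    have w2: "\<omega> (Suc i) \<cdot> df E.W i = df L i \<cdot> \<omega> i" if "i \<le> n" for i
    proof -
      consider "i = 0" | "i = Suc 0" | "i = Suc (Suc 0)" using \<open>i \<le> n\<close> by force
      then show ?thesis
      proof cases
        case 1
        then show ?thesis by simp
      next
        case 2
        then show ?thesis by (simp add: E.e1_def additive_simps)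
      next
        case 3
        then show ?thesis by (simp add: E.e2_def additive_simps)
      qed
    qed
    have a2c: "E.e2 \<cdot> E.a2 \<cdot> x = inj1 D E.K3 E.K1 \<cdot> E.d2 \<cdot> x" if "ar x" "cd x = E.K2" for x
      using that cmp_assoc'[of x E.a2 E.e2] by simp
    have a2d: "E.a2 \<cdot> E.d1 \<cdot> x = E.e1 \<cdot> q \<cdot> x" if "ar x" "cd x = E.K1" for x
      using that cmp_assoc'[of x E.d1 E.a2] by simp
    have e2s: "E.e2 \<cdot> (inj1 D E.K2 Y \<cdot> E.d1 \<oplus> inj2 D E.K2 Y \<cdot> q) = inj2 D E.K3 E.K1"
      by (simp add: E.e2_def additive_simps)
    have e2sc: "E.e2 \<cdot> (inj1 D E.K2 Y \<cdot> E.d1 \<oplus> inj2 D E.K2 Y \<cdot> q) \<cdot> x = inj2 D E.K3 E.K1 \<cdot> x"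
      if "ar x" "cd x = E.K1" for x
    proof -
      have "E.e2 \<cdot> (inj1 D E.K2 Y \<cdot> E.d1 \<oplus> inj2 D E.K2 Y \<cdot> q) \<cdot> x =
        (E.e2 \<cdot> (inj1 D E.K2 Y \<cdot> E.d1 \<oplus> inj2 D E.K2 Y \<cdot> q)) \<cdot> x"
        by (rule cmp_assoc'[symmetric]) (simp_all add: that)
      then show ?thesis unfolding e2s .
    qed
    have u2: "\<upsilon> (Suc i) \<cdot> df L i = df E.W i \<cdot> \<upsilon> i" if "i \<le> n" for i
    proof -
      consider "i = 0" | "i = Suc 0" | "i = Suc (Suc 0)" using \<open>i \<le> n\<close> by force
      then show ?thesis
      proof cases
        case 1
        then show ?thesis by simp
      next
        case 2
        then show ?thesis by (simp add: a2d)
      next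
        case 3
        have "E.e2 \<cdot> (E.a2 \<cdot> k2 \<oplus>
            (inj1 D E.K2 Y \<cdot> E.d1 \<oplus> inj2 D E.K2 Y \<cdot> q) \<cdot> prj2 D E.K3 E.K1 \<cdot> ?l2)
          = E.e2 \<cdot> E.a2 \<cdot> k2 \<oplus> E.e2 \<cdot>
            (inj1 D E.K2 Y \<cdot> E.d1 \<oplus> inj2 D E.K2 Y \<cdot> q) \<cdot> prj2 D E.K3 E.K1 \<cdot> ?l2"
          by (rule cmp_plus) simp_all
        also have "\<dots> = inj1 D E.K3 E.K1 \<cdot> prj1 D E.K3 E.K1 \<cdot> ?l2 \<oplus> inj2 D E.K3 E.K1 \<cdot> prj2 D E.K3 E.K1 \<cdot> ?l2"
          by (subst a2c, simp, simp, subst e2sc) simp_all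
        also have "\<dots> = ?l2" by (rule inj_prj_cmp[symmetric]) simp_all
        finally show ?thesis using 3 by (simp del: cmp_plus plus_cmp)
      qed
    qed
    have wm: "chain_map n D E.W L \<omega>" using w1 w2 unfolding chain_map_iff[OF E.W_complex Lc] by blast
    have um: "chain_map n D L E.W \<upsilon>" using u1 u2 unfolding chain_map_iff[OF Lc E.W_complex] by blast
    have "dist E.W \<theta>'"
      by (rule dist_comparison[OF L Wb E.W_exact um _ _ wm]) simp_all
    then show ?thesis by blast
  qed
  then obtain \<rho> where "dist E.W \<rho>" by blast
  then show ?thesis by (rule that) (simp_all add: E.W_def eval_nat_numeral)
qed

end

section \<open>Composition of inflations within a subcategory\<close>

text \<open>
  Conflations \<open>X\<close> and \<open>Y\<close> whose inflations \<open>f\<close> and \<open>g\<close> are composable, and a conflation \<open>W\<close> of the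
  composite. Only \<open>W\<close> is out of control: nothing relates its other terms to those of \<open>X\<close> and \<open>Y\<close>.
\<close>

locale composable_conflations = n_exangulated_category n D G r
  for n :: nat and D :: "('o, 'm) category_data" (structure)
    and G :: "('o, 'm, 'e) bifunctor_data" and r :: "('o, 'm, 'e) realisation" +
  fixes X Y W :: "('o, 'm) cpx" and \<delta> \<rho> \<tau> :: 'e
  assumes n: "n \<ge> 1" and X: "dist X \<delta>" and Y: "dist Y \<rho>" and W: "dist W \<tau>"
    and YX: "ob Y 0 = ob X 1" and W_df: "df W 0 = df Y 0 \<cdot> df X 0"
begin

abbreviation "f \<equiv> df X 0"
abbreviation "d1 \<equiv> df X (Suc 0)"
abbreviation "g \<equiv> df Y 0"
abbreviation "XC \<equiv> ob X (Suc n)"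
abbreviation "YC \<equiv> ob Y (Suc n)"
abbreviation "WC \<equiv> ob W (Suc n)"
abbreviation "X0 \<equiv> ob X 0"
abbreviation "X1 \<equiv> ob X (Suc 0)"
abbreviation "X2 \<equiv> ob X (Suc (Suc 0))"
abbreviation "Y1 \<equiv> ob Y (Suc 0)"

lemma n_simps [simp]: "0 < n" "Suc 0 \<le> n" using n by auto

lemma YX' [simp]: "ob Y 0 = X1" using YX by simp

lemmas X_simps [simp] = complex_dest[OF dist_dest(1)[OF X]]
lemmas Y_simps [simp] = complex_dest[OF dist_dest(1)[OF Y]]

lemma Y_simps' [simp]: "dm g = X1" using Y_simps(3)[of 0] by simp

lemma W0 [simp]: "ob W 0 = X0" "ob W (Suc 0) = Y1"
proof -
  have "dm (df W 0) = X0" "cd (df W 0) = Y1" unfolding W_df by simp_all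
  then show "ob W 0 = X0" "ob W (Suc 0) = Y1"
    using complex_dest(3,4)[OF dist_dest(1)[OF W], of 0] by simp_all
qed

lemma W_simps [simp]:
  "i \<le> Suc n \<Longrightarrow> ob W i \<in> obj D" "0 < i \<Longrightarrow> i \<le> n \<Longrightarrow> ar (df W i)"
  "0 < i \<Longrightarrow> i \<le> n \<Longrightarrow> dm (df W i) = ob W i" "0 < i \<Longrightarrow> i \<le> n \<Longrightarrow> cd (df W i) = ob W (Suc i)"
  "df W 0 = g \<cdot> f"
  using complex_dest[OF dist_dest(1)[OF W]] W_df by auto

lemma ext_mem: "\<delta> \<in> carrier (ext G XC X0)" "\<rho> \<in> carrier (ext G YC X1)" "\<tau> \<in> carrier (ext G WC X0)"
  using dist_dest(2)[OF X] dist_dest(2)[OF Y] dist_dest(2)[OF W] by simp_all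

lemma push_f: "push D G XC f \<delta> = \<one>\<^bsub>ext G XC X1\<^esub>"
  and push_g: "push D G YC g \<rho> = \<one>\<^bsub>ext G YC Y1\<^esub>"
  and push_gf: "push D G WC (g \<cdot> f) \<tau> = \<one>\<^bsub>ext G WC Y1\<^esub>"
  using push_df[OF X] push_df[OF Y] push_df[OF W] by simp_all

lemma push_f_\<tau>_mem: "push D G WC f \<tau> \<in> carrier (ext G WC X1)"
  using ext_mem by (intro push_mem) simp_all

text \<open>Exactness for \<open>W\<close> applies to \<open>\<delta>\<close>: already \<open>f\<^sub>*\<delta> = 0\<close>, hence \<open>(g \<cdot> f)\<^sub>*\<delta> = 0\<close>.\<close>

lemma first_end_map:
  obtains e where "ar e" "dm e = XC" "cd e = WC" "pull D G X0 e \<tau> = \<delta>"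
proof -
  have "push D G XC (df W 0) \<delta> = \<one>\<^bsub>ext G XC (ob W 1)\<^esub>"
    using ext_mem push_f by (simp add: push_cmp push_one)
  from ext_exact[OF n W _ _ this] ext_mem(1) show ?thesis using that by simp metis
qed

text \<open>Exactness for \<open>Y\<close> applies to \<open>f\<^sub>*\<tau>\<close>: here \<open>g\<^sub>*(f\<^sub>*\<tau>) = 0\<close>, as \<open>\<tau>\<close> is the extension of a conflation which begins with \<open>g \<cdot> f\<close>.\<close>

lemma second_end_map:
  obtains c where "ar c" "dm c = WC" "cd c = YC" "pull D G X1 c \<rho> = push D G WC f \<tau>"
proof -
  have "push D G WC (df Y 0) (push D G WC f \<tau>) = \<one>\<^bsub>ext G WC (ob Y 1)\<^esub>"
    using ext_mem push_gf push_cmp[of f g WC \<tau>] by simp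
  from ext_exact[OF n Y _ _ this] push_f_\<tau>_mem show ?thesis using that by simp metis
qed

text \<open>
  The mapping cone axiom provides some lift \<open>F\<close>; its component in degree 1 need not be \<open>g\<close>, but it
  agrees with \<open>g\<close> on \<open>f\<close>, so the two differ by a morphism that factors through \<open>d1\<close>.
\<close>

lemma first_cone:
  assumes e: "ar e" "dm e = XC" "cd e = WC" "pull D G X0 e \<tau> = \<delta>"
  obtains F k where "dist (coneM n D X W F) (push D G WC f \<tau>)"
    "ar (F (Suc 0))" "dm (F (Suc 0)) = X1" "cd (F (Suc 0)) = Y1" "ar k" "dm k = X2" "cd k = Y1" "g \<ominus> F (Suc 0) = k \<cdot> d1"
proof -
  have X': "dist X (pull D G (ob W 0) e \<tau>)" using X e by simp
  obtain F where F: "chain_map n D X W F" "F 0 = idn D X0"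
    and M: "dist (coneM n D X W F) (push D G WC f \<tau>)"
    using EA2_cone[OF X' W W0(1)[symmetric] e(1-3)] by metis
  note Fd = chain_map_dest[OF F(1) dist_dest(1)[OF X] dist_dest(1)[OF W]]
  have F1: "ar (F (Suc 0))" "dm (F (Suc 0)) = X1" "cd (F (Suc 0)) = Y1" using Fd(1-3)[of "Suc 0"] n by simp_all
  have F1f: "F (Suc 0) \<cdot> f = g \<cdot> f" using Fd(4)[of 0] F(2) by simp
  have s: "ar (g \<ominus> F (Suc 0))" "dm (g \<ominus> F (Suc 0)) = X1" "cd (g \<ominus> F (Suc 0)) = Y1" using F1 by simp_all
  have "(g \<ominus> F (Suc 0)) \<cdot> f = zmor D X0 (cd (g \<ominus> F (Suc 0)))"
    unfolding s(3) using F1 F1f by simp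
  then obtain k where "ar k" "dm k = X2" "cd k = Y1" "g \<ominus> F (Suc 0) = k \<cdot> d1"
    using right_exactD[OF right_exact_dist[OF X] n_simps(1) s(1,2), unfolded s(3)] s(3) by metis
  then show ?thesis using that M F1 by blast
qed

lemma coneM_start:
  "ob (coneM n D X W F) 0 = X1" "ob (coneM n D X W F) 1 = dsum D X2 Y1"
  "ob (coneM n D X W F) (Suc n) = WC"
  "ar (F (Suc 0)) \<Longrightarrow> dm (F (Suc 0)) = X1 \<Longrightarrow> cd (F (Suc 0)) = Y1 \<Longrightarrow>
    df (coneM n D X W F) 0 = inj1 D X2 Y1 \<cdot> (zmor D X1 X2 \<ominus> d1) \<oplus> inj2 D X2 Y1 \<cdot> F (Suc 0)"
  using n by (simp_all add: coneM_def mcol_eq inv_eq_minus numeral_2_eq_2)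

text \<open>
  The cone of \<open>X \<rightarrow> W\<close> has extension \<open>f\<^sub>*\<tau>\<close> and begins with the column of \<open>-d1\<close> and \<open>F\<^sub>1\<close>. Both
  entries annihilate the pullback of \<open>\<rho>\<close> along the last differential of \<open>Z\<close>: the first by the
  choice of \<open>Z\<close>, and the second because \<open>g\<close> does and differs from \<open>F\<^sub>1\<close> by a multiple of \<open>d1\<close>.
\<close>

lemma map_to_composite_end:
  assumes Z: "dist Z (push D G YC d1 \<rho>)" "ob Z 0 = X2" "ob Z (Suc n) = YC"
  obtains w where "ar w" "dm w = ob Z n" "cd w = WC"
    "pull D G X1 (df Z n) \<rho> = pull D G X1 w (push D G WC f \<tau>)"
proof -
  note [simp] = complex_dest[OF dist_dest(1)[OF Z(1)]] Z(2,3)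
  let ?z = "df Z n" let ?T = "ob Z n"
  let ?\<epsilon> = "pull D G X1 ?z \<rho>"
  obtain e where e: "ar e" "dm e = XC" "cd e = WC" "pull D G X0 e \<tau> = \<delta>" by (rule first_end_map)
  obtain F k where M: "dist (coneM n D X W F) (push D G WC f \<tau>)"
    and F [simp]: "ar (F (Suc 0))" "dm (F (Suc 0)) = X1" "cd (F (Suc 0)) = Y1"
    and k: "ar k" "dm k = X2" "cd k = Y1" "g \<ominus> F (Suc 0) = k \<cdot> d1"
    by (rule first_cone[OF e])
  have \<epsilon>: "?\<epsilon> \<in> carrier (ext G ?T X1)" using ext_mem by (intro pull_mem) simp_all
  have d: "push D G ?T d1 ?\<epsilon> = \<one>\<^bsub>ext G ?T X2\<^esub>"
  proof -
    have "push D G ?T d1 ?\<epsilon> = pull D G X2 ?z (push D G YC d1 \<rho>)"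
      using ext_mem by (intro push_pull) simp_all
    then show ?thesis using pull_df[OF Z(1)] by simp
  qed
  have g1: "push D G ?T g ?\<epsilon> = \<one>\<^bsub>ext G ?T Y1\<^esub>"
  proof -
    have "push D G ?T g ?\<epsilon> = pull D G Y1 ?z (push D G YC g \<rho>)"
      using ext_mem by (intro push_pull) simp_all
    then show ?thesis using push_g by (simp add: pull_one)
  qed
  have kd: "push D G ?T (k \<cdot> d1) ?\<epsilon> = \<one>\<^bsub>ext G ?T Y1\<^esub>"
    using k d \<epsilon> by (simp add: push_cmp push_one)
  have "g = F (Suc 0) \<oplus> k \<cdot> d1" using k by (simp add: additive_simps)
  then have "push D G ?T g ?\<epsilon> = push D G ?T (F (Suc 0)) ?\<epsilon>"
    using push_plus_one[OF _ _ _ _ _ _ _ _ kd, of "F (Suc 0)" X1] k(1-3) \<epsilon> F by simp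
  then have F1: "push D G ?T (F (Suc 0)) ?\<epsilon> = \<one>\<^bsub>ext G ?T Y1\<^esub>" using g1 by simp
  have "(zmor D X1 X2 \<ominus> d1) \<oplus> d1 = zmor D X1 X2" by simp
  then have "push D G ?T (zmor D X1 X2 \<ominus> d1) ?\<epsilon> = push D G ?T (zmor D X1 X2) ?\<epsilon>"
    using push_plus_one[of "zmor D X1 X2 \<ominus> d1" d1 X1 X2 ?T ?\<epsilon>] d \<epsilon> by simp
  then have nd: "push D G ?T (zmor D X1 X2 \<ominus> d1) ?\<epsilon> = \<one>\<^bsub>ext G ?T X2\<^esub>"
    using \<epsilon> by (simp add: push_zmor)
  have "push D G ?T (df (coneM n D X W F) 0) ?\<epsilon> = push D G ?T (inj1 D X2 Y1 \<cdot> (zmor D X1 X2 \<ominus> d1)) ?\<epsilon>"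
    unfolding coneM_start(4)[of F, OF F]
    using \<epsilon> F F1
    by (intro push_plus_one[of _ _ X1 "dsum D X2 Y1"]) (simp_all del: cmp_minus cmp_zmor One_nat_def add: push_cmp push_one)
  also have "\<dots> = \<one>\<^bsub>ext G ?T (dsum D X2 Y1)\<^esub>"
    using \<epsilon> nd by (simp del: cmp_minus cmp_zmor add: push_cmp push_one)
  finally have "push D G ?T (df (coneM n D X W F) 0) ?\<epsilon> = \<one>\<^bsub>ext G ?T (ob (coneM n D X W F) 1)\<^esub>"
    unfolding coneM_start .
  from ext_exact[OF n M _ _ this] \<epsilon> show ?thesis using that unfolding coneM_start by simp metis
qed

text \<open>
  With \<open>c\<close> factored as \<open>d\<^sub>n\<^sup>Z \<cdot> w'\<close>, the composite \<open>w \<cdot> w'\<close> fixes \<open>f\<^sub>*\<tau>\<close>. So the pullback of \<open>\<tau>\<close> along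
  \<open>1 - w \<cdot> w'\<close> is annihilated by \<open>f\<^sub>*\<close>, hence a pullback \<open>u\<^sup>*\<delta> = (e \<cdot> u)\<^sup>*\<tau>\<close>. Thus \<open>e \<cdot> u + w \<cdot> w'\<close> fixes
  \<open>\<tau>\<close>, and it factors through the direct sum.
\<close>

lemma extension_retract:
  assumes Z: "dist Z (push D G YC d1 \<rho>)" "ob Z 0 = X2" "ob Z (Suc n) = YC"
  obtains v v' where "arr v (dsum D (ob Z n) XC) WC" "arr v' WC (dsum D (ob Z n) XC)"
    "pull D G X0 (v \<cdot> v') \<tau> = \<tau>"
proof -
  note [simp] = complex_dest[OF dist_dest(1)[OF Z(1)]] Z(2,3)
  let ?z = "df Z n" let ?T = "ob Z n"
  let ?V = "dsum D ?T XC"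
  obtain e where e: "ar e" "dm e = XC" "cd e = WC" "pull D G X0 e \<tau> = \<delta>" by (rule first_end_map)
  obtain c where c: "ar c" "dm c = WC" "cd c = YC" "pull D G X1 c \<rho> = push D G WC f \<tau>"
    by (rule second_end_map)
  obtain w where w: "ar w" "dm w = ?T" "cd w = WC"
    "pull D G X1 ?z \<rho> = pull D G X1 w (push D G WC f \<tau>)"
    by (rule map_to_composite_end[OF Z])
  have df: "push D G WC d1 (push D G WC f \<tau>) = \<one>\<^bsub>ext G WC X2\<^esub>"
    using ext_mem push_cmp[of f d1 WC \<tau>, symmetric] by (simp add: push_zmor)
  have "pull D G X2 c (push D G YC d1 \<rho>) = push D G WC d1 (pull D G X1 c \<rho>)"
    using ext_mem c by (intro push_pull[symmetric]) simp_all
  then have "pull D G (ob Z 0) c (push D G YC d1 \<rho>) = \<one>\<^bsub>ext G (dm c) (ob Z 0)\<^esub>"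
    unfolding c using df c by simp
  then obtain w' where w': "ar w'" "dm w' = WC" "cd w' = ?T" "c = ?z \<cdot> w'"
    using pull_factor[OF Z(1), of c] c by (metis Z(3))
  have [simp]: "ar (w \<cdot> w')" "dm (w \<cdot> w') = WC" "cd (w \<cdot> w') = WC"
    using w(1-3) w'(1-3) by simp_all
  have "pull D G X1 (w \<cdot> w') (push D G WC f \<tau>) = pull D G X1 w' (pull D G X1 ?z \<rho>)"
    unfolding w(4) using w(1-3) w'(1-3) push_f_\<tau>_mem by (intro pull_cmp) simp_all
  also have "\<dots> = pull D G X1 (?z \<cdot> w') \<rho>"
    using w'(1-3) ext_mem by (intro pull_cmp[symmetric]) simp_all
  also have "\<dots> = push D G WC f \<tau>" unfolding w'(4)[symmetric] by (rule c(4))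
  finally have ww: "pull D G X1 (w \<cdot> w') (push D G WC f \<tau>) = push D G WC f \<tau>" .
  have one: "pull D G X1 (idn D WC \<ominus> w \<cdot> w') (push D G WC f \<tau>) = \<one>\<^bsub>ext G WC X1\<^esub>"
    using push_f_\<tau>_mem ww by (intro pull_minus_one[of _ _ WC WC]) (simp_all add: pull_idn)
  let ?\<kappa> = "pull D G X0 (idn D WC \<ominus> w \<cdot> w') \<tau>"
  have \<kappa>: "?\<kappa> \<in> carrier (ext G WC X0)" using ext_mem by (intro pull_mem) simp_all
  have "push D G WC f ?\<kappa> = pull D G X1 (idn D WC \<ominus> w \<cdot> w') (push D G WC f \<tau>)"
    using ext_mem by (intro push_pull) simp_all
  then have "push D G WC f ?\<kappa> = \<one>\<^bsub>ext G WC (ob X 1)\<^esub>" using one by simp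
  from ext_exact[OF n X _ \<kappa> this] obtain u where u: "ar u" "dm u = WC" "cd u = XC"
    "?\<kappa> = pull D G X0 u \<delta>" by (metis X_simps(1) W_simps(1) order_refl)
  have eu: "pull D G X0 (e \<cdot> u) \<tau> = ?\<kappa>"
    using e u ext_mem by (simp add: pull_cmp)
  interpret H: group "ext G WC X0" by (rule ext_group) simp_all
  have wm: "pull D G X0 (w \<cdot> w') \<tau> \<in> carrier (ext G WC X0)" using ext_mem by (intro pull_mem) simp_all
  have s: "\<tau> = pull D G X0 (e \<cdot> u \<oplus> w \<cdot> w') \<tau>"
  proof -
    have "pull D G X0 (e \<cdot> u \<oplus> w \<cdot> w') \<tau> = ?\<kappa> \<otimes>\<^bsub>ext G WC X0\<^esub> pull D G X0 (w \<cdot> w') \<tau>"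
      unfolding eu[symmetric] using e(1-3) u(1-3) ext_mem by (intro pull_plus) simp_all
    also have "\<dots> = pull D G X0 ((idn D WC \<ominus> w \<cdot> w') \<oplus> w \<cdot> w') \<tau>"
      using ext_mem by (intro pull_plus[symmetric]) simp_all
    also have "\<dots> = \<tau>" using ext_mem by (simp add: pull_idn)
    finally show ?thesis ..
  qed
  define v where "v = w \<cdot> prj1 D ?T XC \<oplus> e \<cdot> prj2 D ?T XC"
  define v' where "v' = inj1 D ?T XC \<cdot> w' \<oplus> inj2 D ?T XC \<cdot> u"
  have "arr v ?V WC" "arr v' WC ?V" "v \<cdot> v' = e \<cdot> u \<oplus> w \<cdot> w'"
    unfolding v_def v'_def using w(1-3) w'(1-3) e(1-3) u(1-3) by (simp_all add: additive_simps)
  then show ?thesis using that s by simp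
qed

end

context n_exangulated_category
begin

text \<open>
  A morphism compatible with the extensions exists by exactness and extends to a chain map; this
  chain map agrees with \<open>\<phi>\<close> only after composition with \<open>df P 0\<close>, and the difference in degree 1 can be
  moved to degree 2 without changing the pullback of \<open>\<beta>\<close>.
\<close>

lemma end_comparison:
  assumes n: "n = 1" and P: "dist P \<alpha>" and R: "dist R \<beta>" and RP: "ob R 0 = ob P 0"
    and \<phi>: "arr \<phi> (ob P 1) (ob R 1)" "\<phi> \<cdot> df P 0 = df R 0"
  obtains \<chi> where "ar \<chi>" "dm \<chi> = ob P 2" "cd \<chi> = ob R 2"
    "\<chi> \<cdot> df P 1 = df R 1 \<cdot> \<phi>" "pull D G (ob P 0) \<chi> \<beta> = \<alpha>"
proof -
  note [simp] = complex_dest[OF dist_dest(1)[OF P]] complex_dest[OF dist_dest(1)[OF R]] RP n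
  have \<phi>' [simp]: "ar \<phi>" "dm \<phi> = ob P (Suc 0)" "cd \<phi> = ob R (Suc 0)" using \<phi>(1) by simp_all
  have [simp]: "dm (df R 0) = ob P 0"
    using complex_dest(3)[OF dist_dest(1)[OF R], of 0] by simp
  let ?P2 = "ob P (Suc (Suc 0))" let ?R2 = "ob R (Suc (Suc 0))"
  have \<alpha>: "\<alpha> \<in> carrier (ext G ?P2 (ob P 0))" using dist_dest(2)[OF P] by simp
  have \<beta>: "\<beta> \<in> carrier (ext G ?R2 (ob P 0))" using dist_dest(2)[OF R] by simp
  have "push D G ?P2 (df R 0) \<alpha> = push D G ?P2 \<phi> (push D G ?P2 (df P 0) \<alpha>)"
    unfolding \<phi>(2)[symmetric] using \<alpha> by (intro push_cmp) simp_all
  also have "\<dots> = \<one>\<^bsub>ext G ?P2 (ob R 1)\<^esub>" using push_df[OF P] by (simp add: push_one)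
  finally have "push D G ?P2 (df R 0) \<alpha> = \<one>\<^bsub>ext G ?P2 (ob R 1)\<^esub>" .
  from ext_exact[OF _ R _ _ this] \<alpha>
  obtain c where c: "ar c" "dm c = ?P2" "cd c = ?R2" "\<alpha> = pull D G (ob P 0) c \<beta>"
    by simp metis
  have "push D G (ob P (Suc n)) (idn D (ob P 0)) \<alpha> = pull D G (ob R 0) c \<beta>"
    using \<alpha> c(4) by (simp add: push_idn)
  then obtain f where f: "chain_map n D P R f" "f 0 = idn D (ob P 0)" "f (Suc n) = c"
    using dist_lift[OF P R, of "idn D (ob P 0)" c] c(1-3)
    by (metis RP n One_nat_def ar_idn complex_dest(1)[OF dist_dest(1)[OF P]] zero_le)
  note fd = chain_map_dest[OF f(1) dist_dest(1)[OF P] dist_dest(1)[OF R]]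
  define f1 where "f1 = f (Suc 0)"
  have f1 [simp]: "ar f1" "dm f1 = ob P (Suc 0)" "cd f1 = ob R (Suc 0)"
      "f1 \<cdot> df P 0 = df R 0" "c \<cdot> df P (Suc 0) = df R (Suc 0) \<cdot> f1"
    using fd(1-3)[of "Suc 0"] fd(4)[of 0] fd(4)[of "Suc 0"] f(2,3) by (simp_all add: f1_def)
  have s: "ar (\<phi> \<ominus> f1)" "dm (\<phi> \<ominus> f1) = ob P (Suc 0)" "cd (\<phi> \<ominus> f1) = ob R (Suc 0)" by simp_all
  have "(\<phi> \<ominus> f1) \<cdot> df P 0 = zmor D (ob P 0) (cd (\<phi> \<ominus> f1))"
    unfolding s(3) using \<phi>(2) by simp
  from right_exactD[OF right_exact_dist[OF P] _ s(1,2) this, unfolded s(3)]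
  obtain k where k: "ar k" "dm k = ?P2" "cd k = ob R (Suc 0)" "\<phi> \<ominus> f1 = k \<cdot> df P (Suc 0)"
    using n by (metis less_Suc0 One_nat_def)
  have \<phi>_eq: "\<phi> = f1 \<oplus> k \<cdot> df P (Suc 0)" using k by (simp add: additive_simps)
  define \<chi> where "\<chi> = c \<oplus> df R (Suc 0) \<cdot> k"
  have x: "ar \<chi>" "dm \<chi> = ?P2" "cd \<chi> = ?R2" unfolding \<chi>_def using c k by simp_all
  moreover have "\<chi> \<cdot> df P (Suc 0) = df R (Suc 0) \<cdot> \<phi>"
    unfolding \<phi>_eq \<chi>_def using c(1-3) k(1-3) by simp
  moreover have "pull D G (ob P 0) \<chi> \<beta> = \<alpha>"
  proof -
    interpret H: group "ext G ?P2 (ob P 0)" by (rule ext_group) simp_all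
    have "pull D G (ob P 0) (df R (Suc 0)) \<beta> = \<one>\<^bsub>ext G (ob R (Suc 0)) (ob P 0)\<^esub>"
      using pull_df[OF R] by simp
    then have "pull D G (ob P 0) (df R (Suc 0) \<cdot> k) \<beta> = \<one>\<^bsub>ext G ?P2 (ob P 0)\<^esub>"
      using k(1-3) \<beta> by (simp add: pull_cmp pull_one)
    then show ?thesis
      unfolding \<chi>_def
      using \<alpha> \<beta> c k(1-3) pull_plus[of c "df R (Suc 0) \<cdot> k" ?P2 ?R2 "ob P 0" \<beta>] by simp
  qed
  ultimately show ?thesis using that[of \<chi>] by (simp add: numeral_2_eq_2)
qed

text \<open>
  \<open>e = 1 - \<chi>\<close> vanishes on \<open>df P 1\<close> and, since it annihilates \<open>\<alpha>\<close>, also factors through it. So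
  \<open>e \<cdot> e = 0\<close>, and \<open>1 + e\<close> is inverse to \<open>\<chi>\<close>.
\<close>

lemma end_automorphism:
  assumes n: "n = 1" and P: "dist P \<alpha>"
    and \<chi>: "ar \<chi>" "dm \<chi> = ob P 2" "cd \<chi> = ob P 2" "\<chi> \<cdot> df P 1 = df P 1" "pull D G (ob P 0) \<chi> \<alpha> = \<alpha>"
  obtains \<xi> where "ar \<xi>" "dm \<xi> = ob P 2" "cd \<xi> = ob P 2" "\<xi> \<cdot> \<chi> = idn D (ob P 2)" "\<chi> \<cdot> \<xi> = idn D (ob P 2)"
proof -
  note [simp] = complex_dest[OF dist_dest(1)[OF P]]
  let ?P2 = "ob P (Suc (Suc 0))"
  have x [simp]: "ar \<chi>" "dm \<chi> = ?P2" "cd \<chi> = ?P2" "\<chi> \<cdot> df P (Suc 0) = df P (Suc 0)"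
    using \<chi> by (simp_all add: numeral_2_eq_2)
  have P2 [simp]: "?P2 \<in> obj D" using ar_dest(1)[of \<chi>] by simp
  have d [simp]: "ar (df P (Suc 0))" "dm (df P (Suc 0)) = ob P (Suc 0)" "cd (df P (Suc 0)) = ?P2"
    using n by simp_all
  have \<alpha>: "\<alpha> \<in> carrier (ext G ?P2 (ob P 0))" using dist_dest(2)[OF P] n by simp
  define e where "e = idn D ?P2 \<ominus> \<chi>"
  have e [simp]: "ar e" "dm e = ?P2" "cd e = ?P2" unfolding e_def by simp_all
  have "pull D G (ob P 0) e \<alpha> = \<one>\<^bsub>ext G ?P2 (ob P 0)\<^esub>"
    unfolding e_def using \<alpha> \<chi>(5) by (intro pull_minus_one[of _ _ ?P2 ?P2]) (simp_all add: pull_idn)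
  then have "pull D G (ob P 0) e \<alpha> = \<one>\<^bsub>ext G (dm e) (ob P 0)\<^esub>" by simp
  from pull_factor[OF P e(1) _ this] n
  obtain u where u: "ar u" "dm u = ?P2" "cd u = ob P (Suc 0)" "e = df P (Suc 0) \<cdot> u"
    by (metis One_nat_def e(2,3))
  have "\<chi> \<cdot> e = (\<chi> \<cdot> df P (Suc 0)) \<cdot> u"
    unfolding u(4) using u(1-3) by (intro cmp_assoc'[symmetric]) simp_all
  then have ce: "\<chi> \<cdot> e = e" unfolding x(4) u(4)[symmetric] .
  then have "\<chi> \<cdot> \<chi> = \<chi> \<oplus> \<chi> \<ominus> idn D ?P2"
  proof -
    have "\<chi> \<ominus> \<chi> \<cdot> \<chi> = idn D ?P2 \<ominus> \<chi>" using ce by (simp add: e_def)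
    then show ?thesis by (simp add: additive_simps)
  qed
  then have "(idn D ?P2 \<oplus> e) \<cdot> \<chi> = idn D ?P2" "\<chi> \<cdot> (idn D ?P2 \<oplus> e) = idn D ?P2"
    by (simp_all add: e_def additive_simps)
  then show ?thesis using that[of "idn D ?P2 \<oplus> e"] by (simp add: numeral_2_eq_2)
qed

text \<open>
  The morphisms between the end terms induced by \<open>\<phi>\<close> and \<open>\<psi>\<close> need not be inverse to each other, but
  both composites are automorphisms.
\<close>

lemma ends_isomorphic:
  assumes n: "n = 1" and P: "dist P \<alpha>" and R: "dist R \<beta>" and RP: "ob R 0 = ob P 0"
    and \<phi>: "arr \<phi> (ob P 1) (ob R 1)" "\<phi> \<cdot> df P 0 = df R 0"
    and \<psi>: "arr \<psi> (ob R 1) (ob P 1)" "\<psi> \<cdot> \<phi> = idn D (ob P 1)" "\<phi> \<cdot> \<psi> = idn D (ob R 1)"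
  shows "isomorphic D (ob P 2) (ob R 2)"
proof -
  note [simp] = complex_dest[OF dist_dest(1)[OF P]] complex_dest[OF dist_dest(1)[OF R]] 
  let ?P2 = "ob P (Suc (Suc 0))" let ?R2 = "ob R (Suc (Suc 0))"
  have m [simp]: "ar \<phi>" "dm \<phi> = ob P (Suc 0)" "cd \<phi> = ob R (Suc 0)"
    "ar \<psi>" "dm \<psi> = ob R (Suc 0)" "cd \<psi> = ob P (Suc 0)"
    "\<psi> \<cdot> \<phi> = idn D (ob P (Suc 0))" "\<phi> \<cdot> \<psi> = idn D (ob R (Suc 0))"
    using \<phi>(1) \<psi> by simp_all
  have d [simp]: "ar (df P (Suc 0))" "dm (df P (Suc 0)) = ob P (Suc 0)" "cd (df P (Suc 0)) = ?P2"
    "ar (df R (Suc 0))" "dm (df R (Suc 0)) = ob R (Suc 0)" "cd (df R (Suc 0)) = ?R2"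
    using n by simp_all
  have ds: "ar (df P 0)" "dm (df P 0) = ob P 0" "cd (df P 0) = ob P (Suc 0)" by simp_all
  have "\<psi> \<cdot> df R 0 = (\<psi> \<cdot> \<phi>) \<cdot> df P 0"
    unfolding \<phi>(2)[symmetric] using ds by (intro cmp_assoc'[symmetric]) simp_all
  then have \<psi>d: "\<psi> \<cdot> df R 0 = df P 0" using ds by simp
  obtain \<chi> where c: "ar \<chi>" "dm \<chi> = ob P 2" "cd \<chi> = ob R 2"
    "\<chi> \<cdot> df P 1 = df R 1 \<cdot> \<phi>" "pull D G (ob P 0) \<chi> \<beta> = \<alpha>"
    by (rule end_comparison[OF n P R RP \<phi>])
  obtain \<chi>' where c': "ar \<chi>'" "dm \<chi>' = ob R 2" "cd \<chi>' = ob P 2"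
    "\<chi>' \<cdot> df R 1 = df P 1 \<cdot> \<psi>" "pull D G (ob R 0) \<chi>' \<alpha> = \<beta>"
    by (rule end_comparison[OF n R P RP[symmetric] \<psi>(1) \<psi>d])
  have [simp]: "ar \<chi>" "dm \<chi> = ?P2" "cd \<chi> = ?R2" "\<chi> \<cdot> df P (Suc 0) = df R (Suc 0) \<cdot> \<phi>"
    "ar \<chi>'" "dm \<chi>' = ?R2" "cd \<chi>' = ?P2" "\<chi>' \<cdot> df R (Suc 0) = df P (Suc 0) \<cdot> \<psi>"
    using c(1-4) c'(1-4) by (simp_all add: numeral_2_eq_2)
  have \<alpha>: "\<alpha> \<in> carrier (ext G ?P2 (ob P 0))" using dist_dest(2)[OF P] n by simp
  have \<beta>: "\<beta> \<in> carrier (ext G ?R2 (ob P 0))" using dist_dest(2)[OF R] n RP by simp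
  have 1: "(\<chi>' \<cdot> \<chi>) \<cdot> df P (Suc 0) = df P (Suc 0)"
  proof -
    have "(\<chi>' \<cdot> \<chi>) \<cdot> df P (Suc 0) = (\<chi>' \<cdot> df R (Suc 0)) \<cdot> \<phi>"
      by (simp del: \<open>\<chi>' \<cdot> df R (Suc 0) = df P (Suc 0) \<cdot> \<psi>\<close>)
    then show ?thesis by simp
  qed
  have 2: "(\<chi> \<cdot> \<chi>') \<cdot> df R (Suc 0) = df R (Suc 0)"
  proof -
    have "(\<chi> \<cdot> \<chi>') \<cdot> df R (Suc 0) = (\<chi> \<cdot> df P (Suc 0)) \<cdot> \<psi>"
      by (simp del: \<open>\<chi> \<cdot> df P (Suc 0) = df R (Suc 0) \<cdot> \<phi>\<close>)
    then show ?thesis by simp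
  qed
  have p1: "pull D G (ob P 0) (\<chi>' \<cdot> \<chi>) \<alpha> = \<alpha>"
    using \<alpha> c(5) c'(5) RP by (simp add: pull_cmp)
  have p2: "pull D G (ob R 0) (\<chi> \<cdot> \<chi>') \<beta> = \<beta>"
    using \<beta> c(5) c'(5) RP by (simp add: pull_cmp)
  obtain \<xi> where \<xi>: "ar \<xi>" "dm \<xi> = ob P 2" "cd \<xi> = ob P 2" "\<xi> \<cdot> (\<chi>' \<cdot> \<chi>) = idn D (ob P 2)"
    by (rule end_automorphism[OF n P, of "\<chi>' \<cdot> \<chi>"]) (use 1 p1 in \<open>simp_all add: numeral_2_eq_2\<close>)
  obtain \<zeta> where \<zeta>: "ar \<zeta>" "dm \<zeta> = ob R 2" "cd \<zeta> = ob R 2" "(\<chi> \<cdot> \<chi>') \<cdot> \<zeta> = idn D (ob R 2)"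
    by (rule end_automorphism[OF n R, of "\<chi> \<cdot> \<chi>'"]) (use 2 p2 in \<open>simp_all add: numeral_2_eq_2\<close>)
  have [simp]: "ar \<xi>" "dm \<xi> = ?P2" "cd \<xi> = ?P2" "ar \<zeta>" "dm \<zeta> = ?R2" "cd \<zeta> = ?R2"
    using \<xi> \<zeta> by (simp_all add: numeral_2_eq_2)
  have inv1: "(\<xi> \<cdot> \<chi>') \<cdot> \<chi> = idn D ?P2" using \<xi>(4) by (simp add: numeral_2_eq_2)
  have inv2: "\<chi> \<cdot> (\<chi>' \<cdot> \<zeta>) = idn D ?R2" using \<zeta>(4) by (simp add: numeral_2_eq_2)
  have "\<xi> \<cdot> \<chi>' = (\<xi> \<cdot> \<chi>') \<cdot> (\<chi> \<cdot> (\<chi>' \<cdot> \<zeta>))" unfolding inv2 by simp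
  also have "\<dots> = ((\<xi> \<cdot> \<chi>') \<cdot> \<chi>) \<cdot> (\<chi>' \<cdot> \<zeta>)" by (rule cmp_assoc'[symmetric]) simp_all
  also have "\<dots> = \<chi>' \<cdot> \<zeta>" unfolding inv1 by simp
  finally have "\<xi> \<cdot> \<chi>' = \<chi>' \<cdot> \<zeta>" .
  then have inv3: "\<chi> \<cdot> (\<xi> \<cdot> \<chi>') = idn D ?R2" using inv2 by simp
  have "\<chi> \<in> mor D ?P2 ?R2" "\<xi> \<cdot> \<chi>' \<in> mor D ?R2 ?P2"
    using ar_dest(3)[of \<chi>] ar_dest(3)[of "\<xi> \<cdot> \<chi>'"] by simp_all
  then show ?thesis
    unfolding isomorphic_def numeral_2_eq_2 using inv1 inv3
    by (intro bexI[of _ \<chi>] bexI[of _ "\<xi> \<cdot> \<chi>'"] conjI)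
qed

end

context composable_conflations
begin

text \<open>
  The cone of \<open>X \<rightarrow> W\<close> begins with the column of \<open>-d1\<close> and \<open>F\<^sub>1 = g - k \<cdot> d1\<close> and ends with the end term of
  \<open>W\<close>; the dual cone of \<open>Y \<rightarrow> Z\<close> begins with the column of \<open>g\<close> and \<open>d1\<close> and ends with \<open>Z\<^sub>1\<close>. An
  isomorphism of the middle terms turns one column into the other.
\<close>

lemma end_in_subcategory:
  assumes n1: "n = 1" and sub: "additive_subcategory D \<A>"
    and Z: "dist Z (push D G YC d1 \<rho>)" "ob Z 0 = X2" "ob Z (Suc n) = YC" "ob Z n \<in> \<A>"
  shows "WC \<in> \<A>"
proof -
  note [simp] = complex_dest[OF dist_dest(1)[OF Z(1)]] Z(2,3)
  have Zd [simp]: "dm (df Z 0) = X2" using complex_dest(3)[OF dist_dest(1)[OF Z(1)], of 0] by simp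
  obtain e where e: "ar e" "dm e = XC" "cd e = WC" "pull D G X0 e \<tau> = \<delta>" by (rule first_end_map)
  obtain F k where M: "dist (coneM n D X W F) (push D G WC f \<tau>)"
    and F [simp]: "ar (F (Suc 0))" "dm (F (Suc 0)) = X1" "cd (F (Suc 0)) = Y1"
    and k [simp]: "ar k" "dm k = X2" "cd k = Y1" and gF: "g \<ominus> F (Suc 0) = k \<cdot> d1"
    by (rule first_cone[OF e])
  have g_eq: "F (Suc 0) \<oplus> k \<cdot> d1 = g" using gF by (simp add: additive_simps)
  have YCeq: "ob Y (Suc n) = ob Z (Suc n)" by simp
  have d1: "ar d1" "dm d1 = ob Y 0" "cd d1 = ob Z 0" by simp_all
  obtain H where H: "chain_map n D Y Z H" "H 0 = d1"
    and N: "dist (coneN n D Y Z H) (pull D G (ob Y 0) (df Z n) \<rho>)"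
    using EA2_op_cone[OF Y Z(1) YCeq d1] by metis
  have N0: "ob (coneN n D Y Z H) 0 = X1" "ob (coneN n D Y Z H) 1 = dsum D Y1 X2"
    "ob (coneN n D Y Z H) 2 = ob Z n"
    "df (coneN n D Y Z H) 0 = inj1 D Y1 X2 \<cdot> g \<oplus> inj2 D Y1 X2 \<cdot> d1"
    using n1 H(2) by (simp_all add: coneN_def mcol_eq)
  define \<phi> where "\<phi> = inj1 D Y1 X2 \<cdot> (prj2 D X2 Y1 \<ominus> k \<cdot> prj1 D X2 Y1) \<ominus> inj2 D Y1 X2 \<cdot> prj1 D X2 Y1"
  define \<psi> where "\<psi> = inj2 D X2 Y1 \<cdot> (prj1 D Y1 X2 \<ominus> k \<cdot> prj2 D Y1 X2) \<ominus> inj1 D X2 Y1 \<cdot> prj2 D Y1 X2"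
  have m [simp]: "ar \<phi>" "dm \<phi> = dsum D X2 Y1" "cd \<phi> = dsum D Y1 X2"
    "ar \<psi>" "dm \<psi> = dsum D Y1 X2" "cd \<psi> = dsum D X2 Y1"
    unfolding \<phi>_def \<psi>_def by simp_all
  have 1: "\<phi> \<cdot> \<psi> = idn D (dsum D Y1 X2)"
    unfolding \<phi>_def \<psi>_def inj_prj_plus[OF Y_simps(1)[of "Suc 0"] X_simps(1)[of "Suc (Suc 0)"], symmetric, simplified]
    by (simp add: additive_simps)
  have 2: "\<psi> \<cdot> \<phi> = idn D (dsum D X2 Y1)"
    unfolding \<phi>_def \<psi>_def inj_prj_plus[OF X_simps(1)[of "Suc (Suc 0)"] Y_simps(1)[of "Suc 0"], symmetric, simplified]
    by (simp add: additive_simps)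
  have 3: "\<phi> \<cdot> df (coneM n D X W F) 0 = df (coneN n D Y Z H) 0"
    unfolding coneM_start(4)[of F, OF F] N0(4) g_eq[symmetric] \<phi>_def
    by (simp add: additive_simps)
  have a: "arr \<phi> (ob (coneM n D X W F) 1) (ob (coneN n D Y Z H) 1)"
    "arr \<psi> (ob (coneN n D Y Z H) 1) (ob (coneM n D X W F) 1)"
    unfolding N0 coneM_start by simp_all
  have "isomorphic D (ob (coneM n D X W F) 2) (ob (coneN n D Y Z H) 2)"
    by (rule ends_isomorphic[OF n1 M N _ a(1) 3 a(2)]) (use 1 2 N0 coneM_start in simp_all)
  moreover have "ob (coneM n D X W F) 2 = WC" using coneM_start(3)[of F] n1 by (simp add: numeral_2_eq_2)
  ultimately have "isomorphic D (ob Z n) WC" unfolding N0 isomorphic_def by metis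
  moreover have "WC \<in> obj D" by simp
  ultimately show ?thesis using sub Z(4) unfolding additive_subcategory_def by blast
qed

text \<open>
  Over \<open>v\<^sup>*\<tau>\<close>, whose end term is in \<open>\<A>\<close>, there is a conflation \<open>K\<close> in \<open>\<A>\<close>. From \<open>(g \<cdot> f)\<^sub>*v\<^sup>*\<tau> = 0\<close> and
  \<open>(d\<^sub>0\<^sup>K)\<^sub>*\<tau> = (d\<^sub>0\<^sup>K)\<^sub>*v'\<^sup>*v\<^sup>*\<tau> = 0\<close> it follows that \<open>g \<cdot> f\<close> and \<open>d\<^sub>0\<^sup>K\<close> factor through each other, so
  that the exchange lemma applies for \<open>n \<ge> 2\<close>.
\<close>

lemma composite_inflation:
  assumes sub: "additive_subcategory D \<A>" and closed: "n_extension_closed n D G r \<A>"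
    and XA: "\<And>i. i \<le> Suc n \<Longrightarrow> ob X i \<in> \<A>" and YA: "\<And>i. i \<le> Suc n \<Longrightarrow> ob Y i \<in> \<A>"
  obtains U \<eta> where "dist U \<eta>" "df U 0 = g \<cdot> f" "\<And>i. i \<le> Suc n \<Longrightarrow> ob U i \<in> \<A>"
proof -
  have realise: "\<exists>Z. dist Z \<epsilon> \<and> ob Z 0 = A \<and> ob Z (Suc n) = C \<and> (\<forall>i \<le> Suc n. ob Z i \<in> \<A>)"
    if "A \<in> \<A>" "C \<in> \<A>" "\<epsilon> \<in> carrier (ext G C A)" for A C \<epsilon>
    using closed that unfolding n_extension_closed_def by simp metis
  have dsumA: "dsum D A B \<in> \<A>" if "A \<in> \<A>" "B \<in> \<A>" for A B
    using sub that unfolding additive_subcategory_def by blast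
  have X2A: "X2 \<in> \<A>" "YC \<in> \<A>" using XA YA by simp_all
  have "push D G YC d1 \<rho> \<in> carrier (ext G YC X2)" using ext_mem by (intro push_mem) simp_all
  from realise[OF X2A this] obtain Z where Z: "dist Z (push D G YC d1 \<rho>)" "ob Z 0 = X2" "ob Z (Suc n) = YC"
    and ZA: "\<And>i. i \<le> Suc n \<Longrightarrow> ob Z i \<in> \<A>"
    by blast
  show ?thesis
  proof (cases "n = 1")
    case True
    have WC: "WC \<in> \<A>" using end_in_subcategory[OF True sub Z] ZA by simp
    have "ob W i \<in> \<A>" if i: "i \<le> Suc n" for i
    proof -
      consider "i = 0" | "i = Suc 0" | "i = Suc n" using i True by fastforce
      then show ?thesis using XA[of 0] YA[of "Suc 0"] WC by cases auto
    qed
    then show ?thesis using that[OF W] by simp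
  next
    case False
    then have n2: "n \<ge> 2" using n by linarith
    let ?V = "dsum D (ob Z n) XC"
    obtain v v' where v: "arr v ?V WC" "arr v' WC ?V" "pull D G X0 (v \<cdot> v') \<tau> = \<tau>"
      by (rule extension_retract[OF Z])
    have V: "?V \<in> \<A>" using dsumA ZA XA by simp
    have vs [simp]: "ar v" "dm v = ?V" "cd v = WC" "ar v'" "dm v' = WC" "cd v' = ?V"
      using v by simp_all
    have Vo [simp]: "?V \<in> obj D" using ar_dest(1)[of v] by simp
    let ?\<theta> = "pull D G X0 v \<tau>"
    have \<theta>: "?\<theta> \<in> carrier (ext G ?V X0)" using ext_mem by (intro pull_mem) simp_all
    have \<tau>: "pull D G X0 v' ?\<theta> = \<tau>" using v(3) ext_mem by (simp add: pull_cmp)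
    obtain K where K: "dist K ?\<theta>" and K0: "ob K 0 = X0" "ob K (Suc n) = ?V"
      and KA: "\<And>i. i \<le> Suc n \<Longrightarrow> ob K i \<in> \<A>"
      using realise[OF _ V \<theta>] XA by auto
    note [simp] = complex_dest[OF dist_dest(1)[OF K]]
    have dK [simp]: "dm (df K 0) = X0" using complex_dest(3)[OF dist_dest(1)[OF K], of 0] K0 by simp
    have "push D G ?V (g \<cdot> f) ?\<theta> = pull D G Y1 v (push D G WC (g \<cdot> f) \<tau>)"
      using ext_mem by (intro push_pull) simp_all
    then have "push D G (ob K (Suc n)) (g \<cdot> f) ?\<theta> = \<one>\<^bsub>ext G (ob K (Suc n)) (cd (g \<cdot> f))\<^esub>"
      using push_gf K0 by (simp add: pull_one)
    then obtain q where q: "ar q" "dm q = ob K 1" "cd q = cd (g \<cdot> f)" "g \<cdot> f = q \<cdot> df K 0"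
      using push_factor[OF K, of "g \<cdot> f"] K0 by (metis X_simps(2,3,4) Y_simps(2) Y_simps' ar_cmp(1,2) zero_le)
    have q3: "cd q = Y1" using q(3) by simp
    have "push D G WC (df K 0) \<tau> = pull D G (ob K (Suc 0)) v' (push D G ?V (df K 0) ?\<theta>)"
      by (subst \<tau>[symmetric], rule push_pull) (use \<theta> in simp_all)
    then have "push D G WC (df K 0) \<tau> = \<one>\<^bsub>ext G WC (cd (df K 0))\<^esub>"
      using push_df[OF K] K0 by (simp add: pull_one)
    then obtain p where p: "ar p" "dm p = ob W 1" "cd p = cd (df K 0)" "df K 0 = p \<cdot> df W 0"
      using push_factor[OF W, of "df K 0"] by (metis W0(1) dK complex_dest(2)[OF dist_dest(1)[OF K]] zero_le)
    have p': "cd p = ob K 1" "dm p = Y1" using p(2,3) by simp_all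
    have h: "arr (g \<cdot> f) (ob K 0) Y1" unfolding K0 by simp
    obtain U \<eta> where U: "dist U \<eta>" "df U 0 = g \<cdot> f" "ob U 0 = ob K 0" "ob U 1 = Y1"
      "ob U 2 = dsum D (ob K 2) Y1" "ob U 3 = dsum D (ob K 3) (ob K 1)"
      "\<And>i. i \<ge> 4 \<Longrightarrow> ob U i = ob K i"
      using inflation_exchange[OF n2 K h, of p q] p(1) p' q(1,2) q3 q(4)[symmetric]
        p(4)[symmetric, unfolded W_df] by auto
    have "ob U i \<in> \<A>" if "i \<le> Suc n" for i
    proof -
      consider "i = 0" | "i = 1" | "i = 2" | "i = 3" | "i \<ge> 4" by linarith
      then show ?thesis
        using U(3-7) KA[OF that] KA[of 0] KA[of 1] KA[of 2] KA[of 3] YA[of "Suc 0"] dsumA n2 by cases auto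
    qed
    then show ?thesis using that[OF U(1,2)] by blast
  qed
qed

end

context n_exangulated_category
begin

lemma inflation_cmp_in_subcategory:
  assumes n: "n \<ge> 1" and sub: "additive_subcategory D \<A>" and closed: "n_extension_closed n D G r \<A>"
    and X: "dist X \<delta>" and Y: "dist Y \<rho>" and YX: "ob Y 0 = ob X 1"
    and XA: "\<And>i. i \<le> Suc n \<Longrightarrow> ob X i \<in> \<A>" and YA: "\<And>i. i \<le> Suc n \<Longrightarrow> ob Y i \<in> \<A>"
  obtains U \<eta> where "dist U \<eta>" "df U 0 = df Y 0 \<cdot> df X 0" "\<And>i. i \<le> Suc n \<Longrightarrow> ob U i \<in> \<A>"
proof -
  have i: "inflation n D G r (df X 0)" "inflation n D G r (df Y 0)"
    using X Y unfolding inflation_def conflation_def by blast+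
  note Xc = complex_dest[OF dist_dest(1)[OF X]]
  note Yc = complex_dest[OF dist_dest(1)[OF Y]]
  have a: "ob X 0 \<in> obj D" "ob X 1 \<in> obj D" "ob Y 1 \<in> obj D"
    "df X 0 \<in> mor D (ob X 0) (ob X 1)" "df Y 0 \<in> mor D (ob X 1) (ob Y 1)"
    using Xc(1)[of 0] Xc(1)[of 1] Yc(1)[of 1] Xc(2-4)[of 0] Yc(2-4)[of 0] YX by (simp_all add: mor_iff)
  obtain W \<tau> where "dist W \<tau>" "df W 0 = df Y 0 \<cdot> df X 0"
    using EA1[OF a i] unfolding inflation_def conflation_def by blast
  then interpret composable_conflations n D G r X Y W \<delta> \<rho> \<tau>
    by unfold_locales (use n X Y YX in simp_all)
  show ?thesis using composite_inflation[OF sub closed XA YA] that by blast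
qed

end

section \<open>The opposite category\<close>

text \<open>
  The summands of a direct sum are swapped. With this choice the cones \<open>M\<close> and \<open>N\<close> of the opposite
  category are the cones \<open>N\<close> and \<open>M\<close> of \<open>D\<close> read backwards, not merely isomorphic to them.
\<close>

definition op_category :: "('o, 'm) category_data \<Rightarrow> ('o, 'm) category_data"
  where "op_category D = \<lparr>obj = obj D, Hom = (\<lambda>A B. Hom D B A), idn = idn D, cmp = (\<lambda>g f. cmp D f g),
    zob = zob D, dsum = (\<lambda>A B. dsum D B A),
    inj1 = (\<lambda>A B. prj2 D B A), inj2 = (\<lambda>A B. prj1 D B A),
    prj1 = (\<lambda>A B. inj2 D B A), prj2 = (\<lambda>A B. inj1 D B A)\<rparr>"

definition op_functor :: "('o, 'm, 'e) bifunctor_data \<Rightarrow> ('o, 'm, 'e) bifunctor_data"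
  where "op_functor G = \<lparr>ext = (\<lambda>C A. ext G A C), act = (\<lambda>c a. act G a c)\<rparr>"

text \<open>Reversal is an involution only in the relevant degrees, because the subtraction is truncated.\<close>

definition op_cpx :: "nat \<Rightarrow> ('o, 'm) cpx \<Rightarrow> ('o, 'm) cpx"
  where "op_cpx n X = \<lparr>ob = (\<lambda>i. ob X (Suc n - i)), df = (\<lambda>i. df X (n - i))\<rparr>"

text \<open>
  A preimage, since the class has to contain every complex of the opposite category with a given
  reversal, whatever its irrelevant values.
\<close>

definition op_realisation :: "nat \<Rightarrow> ('o, 'm, 'e) realisation \<Rightarrow> ('o, 'm, 'e) realisation"
  where "op_realisation n r C A \<delta> = {X. op_cpx n X \<in> r A C \<delta>}"

lemma op_category_simps [simp]:
  "obj (op_category D) = obj D" "Hom (op_category D) A B = Hom D B A" "idn (op_category D) = idn D"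
  "cmp (op_category D) g f = cmp D f g" "zob (op_category D) = zob D" "dsum (op_category D) A B = dsum D B A"
  "inj1 (op_category D) A B = prj2 D B A" "inj2 (op_category D) A B = prj1 D B A"
  "prj1 (op_category D) A B = inj2 D B A" "prj2 (op_category D) A B = inj1 D B A"
  by (simp_all add: op_category_def)

lemma cmp_op: "cmp (op_category D) g = (\<lambda>f. cmp D f g)"
  by (simp add: op_category_def)

lemma op_functor_simps [simp]:
  "ext (op_functor G) C A = ext G A C" "act (op_functor G) c a = act G a c"
  by (simp_all add: op_functor_def)

lemma push_op [simp]: "push (op_category D) (op_functor G) C a = pull D G C a"
  and pull_op [simp]: "pull (op_category D) (op_functor G) A c = push D G A c"
  by (simp_all add: push_def pull_def)

lemma op_cpx_simps [simp]: "ob (op_cpx n X) i = ob X (Suc n - i)" "df (op_cpx n X) i = df X (n - i)"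
  by (simp_all add: op_cpx_def)

lemma op_category_op_category: "op_category (op_category D) = D"
  by (simp add: op_category_def)

context preadditive_category
begin

lemma op_preadditive_category: "preadditive_category (op_category D)"
  by (rule preadditive_category.intro; unfold op_category_simps;
      metis mor_disjoint idn_mor cmp_mor cmp_idn idn_cmp cmp_assoc Hom_comm_group
        cmp_left_hom cmp_right_hom)

interpretation op: preadditive_category "op_category D"
  by (rule op_preadditive_category)

lemma op_arr: "op.arr f A B \<longleftrightarrow> arr f B A"
  unfolding op.arr_def arr_def by auto

lemma op_ar [simp]: "op.ar = ar" "op.dm = cd" "op.cd = dm"
proof -
  show "op.ar = ar" unfolding op.ar_def ar_def op_arr by blast
  show "op.dm = cd" unfolding op.dm_def cd_def op_arr ..
  show "op.cd = dm" unfolding op.cd_def dm_def op_arr ..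
qed

lemma op_plus [simp]: "op.plus f g = plus f g" "op.minus f g = minus f g"
  by (simp_all add: op.plus_def plus_def op.minus_def minus_def)

lemma op_cpx_complex:
  assumes "is_complex n D X"
  shows "is_complex n (op_category D) (op_cpx n X)"
proof -
  note [simp] = complex_dest[OF assms]
  have "df X (n - i) \<cdot> df X (n - Suc i) = zmor D (ob X (n - Suc i)) (ob X (Suc n - i))" if i: "i < n" for i
  proof -
    obtain m where "n = Suc (m + i)" by (rule that[of "n - Suc i"]) (use i in simp)
    then show ?thesis using complex_dest(5)[OF assms, of m] by simp
  qed
  then show ?thesis
    unfolding op.complex_iff by (simp add: Suc_diff_le)
qed

lemma op_chain_map:
  assumes X: "is_complex n D X" and Y: "is_complex n D Y" and f: "chain_map n D X Y f"
  shows "chain_map n (op_category D) (op_cpx n Y) (op_cpx n X) (\<lambda>i. f (Suc n - i))"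
  unfolding op.chain_map_iff[OF op_cpx_complex[OF Y] op_cpx_complex[OF X]]
  using chain_map_dest[OF f X Y] by (simp add: Suc_diff_le)

lemma op_contraction:
  assumes X: "is_complex n D X" and Y: "is_complex n D Y" and h: "contraction n X Y k h"
  shows "op.contraction n (op_cpx n Y) (op_cpx n X) (\<lambda>i. k (Suc n - i)) (\<lambda>i. h (Suc (Suc n) - i))"
proof -
  note [simp] = complex_dest[OF X] complex_dest[OF Y]
  have h': "\<And>i. i \<le> n \<Longrightarrow> arr (h (Suc i)) (ob X (Suc i)) (ob Y i)"
    and k0: "k 0 = h 1 \<cdot> df X 0" and kn: "k (Suc n) = df Y n \<cdot> h (Suc n)"
    and ks: "\<And>i. i < n \<Longrightarrow> k (Suc i) = df Y i \<cdot> h (Suc i) \<oplus> h (Suc (Suc i)) \<cdot> df X (Suc i)"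
    using h unfolding contraction_def by auto
  have "k (n - i) = h (Suc n - i) \<cdot> df X (n - i) \<oplus> df Y (n - Suc i) \<cdot> h (n - i)" if i: "i < n" for i
  proof -
    obtain m where m: "n = Suc (m + i)" by (rule that[of "n - Suc i"]) (use i in simp)
    then have "k (Suc m) = df Y m \<cdot> h (Suc m) \<oplus> h (Suc (Suc m)) \<cdot> df X (Suc m)" using ks[of m] by simp
    also have "\<dots> = h (Suc (Suc m)) \<cdot> df X (Suc m) \<oplus> df Y m \<cdot> h (Suc m)"
      using h'[of m] h'[of "Suc m"] m by (intro plus_commute) simp_all
    finally show ?thesis using m by (simp add: Suc_diff_le)
  qed
  moreover have "arr (h (Suc n - i)) (ob X (Suc n - i)) (ob Y (n - i))" if "i \<le> n" for i
    using h'[of "n - i"] that by (simp add: Suc_diff_le)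
  ultimately show ?thesis
    unfolding op.contraction_def using k0 kn by (simp add: Suc_diff_le)
qed

lemma op_complexes_between:
  "X \<in> complexes_between n D A C \<Longrightarrow> op_cpx n X \<in> complexes_between n (op_category D) C A"
  unfolding complexes_between_def using op_cpx_complex by simp

lemma op_homotopy_equivalent:
  assumes X: "X \<in> complexes_between n D A C" and Y: "Y \<in> complexes_between n D A C"
    and "homotopy_equivalent n D A C X Y"
  shows "homotopy_equivalent n (op_category D) C A (op_cpx n X) (op_cpx n Y)"
proof -
  have Xc: "is_complex n D X" and Yc: "is_complex n D Y"
    using X Y unfolding complexes_between_def by auto
  obtain f g h h' where f: "chain_map n D X Y f" "f 0 = idn D A" "f (Suc n) = idn D C"
    and g: "chain_map n D Y X g" "g 0 = idn D A" "g (Suc n) = idn D C"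
    and h: "contraction n X X (\<lambda>i. g i \<cdot> f i \<ominus> idn D (ob X i)) h"
    and h': "contraction n Y Y (\<lambda>i. f i \<cdot> g i \<ominus> idn D (ob Y i)) h'"
    using assms(3) unfolding homotopy_equivalent_iff[OF X Y] chain_map_between_def by auto
  have "chain_map_between n (op_category D) C A (op_cpx n X) (op_cpx n Y) (\<lambda>i. g (Suc n - i))"
    "chain_map_between n (op_category D) C A (op_cpx n Y) (op_cpx n X) (\<lambda>i. f (Suc n - i))"
    unfolding chain_map_between_def using op_chain_map[OF Yc Xc g(1)] op_chain_map[OF Xc Yc f(1)] f g
    by simp_all
  then show ?thesis
    unfolding op.homotopy_equivalent_iff[OF op_complexes_between[OF X] op_complexes_between[OF Y]]
    using op_contraction[OF Xc Xc h] op_contraction[OF Yc Yc h']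
    by (intro exI[of _ "\<lambda>i. g (Suc n - i)"] exI[of _ "\<lambda>i. f (Suc n - i)"]) auto
qed

end

lemma is_complex_cong:
  assumes "\<And>i. i \<le> Suc n \<Longrightarrow> ob X i = ob Y i" "\<And>i. i \<le> n \<Longrightarrow> df X i = df Y i"
  shows "is_complex n D X \<longleftrightarrow> is_complex n D Y"
  unfolding is_complex_def using assms by simp

lemma chain_map_cong:
  assumes "\<And>i. i \<le> Suc n \<Longrightarrow> ob X i = ob X' i" "\<And>i. i \<le> n \<Longrightarrow> df X i = df X' i"
    and "\<And>i. i \<le> Suc n \<Longrightarrow> ob Y i = ob Y' i" "\<And>i. i \<le> n \<Longrightarrow> df Y i = df Y' i"
  shows "chain_map n D X Y f \<longleftrightarrow> chain_map n D X' Y' f"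
  unfolding chain_map_def using assms by simp

lemma n_exangle_cong:
  assumes "\<And>i. i \<le> Suc n \<Longrightarrow> ob X i = ob Y i" "\<And>i. i \<le> n \<Longrightarrow> df X i = df Y i" "n \<ge> 1"
  shows "n_exangle n D G X \<delta> \<longleftrightarrow> n_exangle n D G Y \<delta>"
  unfolding n_exangle_def using assms is_complex_cong[OF assms(1,2)] by simp

context preadditive_category
begin

interpretation op: preadditive_category "op_category D"
  by (rule op_preadditive_category)

lemma op_complexes_between_iff:
  "X \<in> complexes_between n (op_category D) A C \<longleftrightarrow> op_cpx n X \<in> complexes_between n D C A"
proof
  assume "X \<in> complexes_between n (op_category D) A C"
  from op.op_complexes_between[OF this]
  show "op_cpx n X \<in> complexes_between n D C A" unfolding op_category_op_category .
next
  assume "op_cpx n X \<in> complexes_between n D C A"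
  from op_complexes_between[OF this]
  show "X \<in> complexes_between n (op_category D) A C"
    unfolding complexes_between_def using is_complex_cong[of n X "op_cpx n (op_cpx n X)"] by simp
qed

lemma op_homotopy_equivalent_iff:
  assumes X: "X \<in> complexes_between n (op_category D) A C" and Y: "Y \<in> complexes_between n (op_category D) A C"
  shows "homotopy_equivalent n (op_category D) A C X Y \<longleftrightarrow>
    homotopy_equivalent n D C A (op_cpx n X) (op_cpx n Y)"
proof
  assume "homotopy_equivalent n (op_category D) A C X Y"
  from op.op_homotopy_equivalent[OF X Y this]
  show "homotopy_equivalent n D C A (op_cpx n X) (op_cpx n Y)" unfolding op_category_op_category .
next
  let ?X = "op_cpx n (op_cpx n X)" and ?Y = "op_cpx n (op_cpx n Y)"
  have oX: "op_cpx n X \<in> complexes_between n D C A" and oY: "op_cpx n Y \<in> complexes_between n D C A"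
    using X Y op_complexes_between_iff by auto
  note XX = op_complexes_between[OF oX] and YY = op_complexes_between[OF oY]
  assume "homotopy_equivalent n D C A (op_cpx n X) (op_cpx n Y)"
  from op_homotopy_equivalent[OF oX oY this]
  have "homotopy_equivalent n (op_category D) A C ?X ?Y" .
  moreover have "homotopy_equivalent n (op_category D) A C X ?X"
    by (rule op.homotopy_equivalent_same[OF X XX]) simp_all
  moreover have "homotopy_equivalent n (op_category D) A C ?Y Y"
    by (rule op.homotopy_equivalent_same[OF YY Y]) simp_all
  ultimately show "homotopy_equivalent n (op_category D) A C X Y"
    using op.homotopy_equivalent_trans X Y XX YY by meson
qed

lemma op_homotopy_class:
  assumes "X \<in> complexes_between n (op_category D) A C"
  shows "homotopy_class n (op_category D) A C X = {Y. op_cpx n Y \<in> homotopy_class n D C A (op_cpx n X)}"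
  unfolding homotopy_class_def using assms op_complexes_between_iff op_homotopy_equivalent_iff by auto

end

context additive_category
begin

lemma op_additive_category: "additive_category (op_category D)"
proof -
  interpret op: preadditive_category "op_category D" by (rule op_preadditive_category)
  show ?thesis
  proof
    fix A B assume o: "A \<in> obj (op_category D)" "B \<in> obj (op_category D)"
    have "inj2 D B A \<cdot> prj2 D B A \<oplus> inj1 D B A \<cdot> prj1 D B A = idn D (dsum D B A)"
      using o inj_prj_plus[of B A] by (subst plus_commute) simp_all
    then show "inj1 (op_category D) A B \<cdot>\<^bsub>op_category D\<^esub> prj1 (op_category D) A B
        \<otimes>\<^bsub>Hom (op_category D) (dsum (op_category D) A B) (dsum (op_category D) A B)\<^esub>
        inj2 (op_category D) A B \<cdot>\<^bsub>op_category D\<^esub> prj2 (op_category D) A B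
        = idn (op_category D) (dsum (op_category D) A B)"
      using o by (simp add: plus_def)
  qed (auto simp: zob_obj mor_zob zob_mor dsum_obj inj1_mor inj2_mor prj1_mor prj2_mor)
qed

lemma triv_complex:
  assumes "A \<in> obj D" "i \<le> n"
  shows "is_complex n D (triv D i A)"
proof -
  define T where "T j = (if j = i \<or> j = i + 1 then A else zob D)" for j
  have T [simp]: "T j \<in> obj D" for j using assms unfolding T_def by simp
  have t: "triv D i A = \<lparr>ob = T, df = (\<lambda>j. if j = i then idn D A else zmor D (T j) (T (j + 1)))\<rparr>"
    unfolding triv_def T_def Let_def ..
  have "T i = A" "T (Suc i) = A" unfolding T_def by simp_all
  then show ?thesis
    unfolding complex_iff t using assms by auto
qed

end

context biadditive_functor
begin

lemma op_biadditive_functor: "biadditive_functor (op_category D) (op_functor G)"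
  by (intro biadditive_functor.intro biadditive_functor_axioms.intro op_additive_category; simp;
      meson ext_comm_group act_hom act_idn act_cmp push_add pull_add)

lemma op_n_exangle:
  assumes n: "n \<ge> 1" and X: "n_exangle n D G X \<delta>"
  shows "n_exangle n (op_category D) (op_functor G) (op_cpx n X) \<delta>"
proof -
  have c: "is_complex n (op_category D) (op_cpx n X)"
    using op_cpx_complex[OF X[unfolded n_exangle_def, THEN conjunct1]] .
  have 1: "(\<lambda>g. g \<cdot> df X (n - i)) ` mor D (ob X (Suc (n - i))) W =
      kernel (Hom D (ob X (n - i)) W) (Hom D (ob X (n - Suc i)) W) (\<lambda>g. g \<cdot> df X (n - Suc i))"
    and 2: "(\<lambda>g. df X (n - Suc i) \<cdot> g) ` mor D W (ob X (n - Suc i)) =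
      kernel (Hom D W (ob X (n - i))) (Hom D W (ob X (Suc n - i))) (\<lambda>g. df X (n - i) \<cdot> g)"
    if i: "i < n" and W: "W \<in> obj D" for i W
  proof -
    obtain m where m: "n = Suc (m + i)" by (rule that[of "n - Suc i"]) (use i in simp)
    then have "n - i = m + 1" "n - Suc i = m" "Suc (n - i) = m + 2" "Suc n - i = m + 2" "m < n" by simp_all
    then show "(\<lambda>g. g \<cdot> df X (n - i)) ` mor D (ob X (Suc (n - i))) W =
      kernel (Hom D (ob X (n - i)) W) (Hom D (ob X (n - Suc i)) W) (\<lambda>g. g \<cdot> df X (n - Suc i))"
      "(\<lambda>g. df X (n - Suc i) \<cdot> g) ` mor D W (ob X (n - Suc i)) =
      kernel (Hom D W (ob X (n - i))) (Hom D W (ob X (Suc n - i))) (\<lambda>g. df X (n - i) \<cdot> g)"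
      using X W unfolding n_exangle_def by auto
  qed
  show ?thesis
    using X c unfolding n_exangle_def by (simp add: 1 2 cmp_op Suc_diff_Suc Suc_diff_le)
qed

end

context exact_realisation
begin

text \<open>
  A preimage of a class under reversal is a class, because homotopy equivalence is an equivalence
  relation that does not see the irrelevant values.
\<close>

lemma op_realises_iff:
  assumes "A \<in> obj D" "C \<in> obj D" "\<delta> \<in> carrier (ext G A C)"
  shows "realises n (op_category D) (op_realisation n r) C A \<delta> X \<longleftrightarrow> realises n D r A C \<delta> (op_cpx n X)"
proof -
  obtain Z where Z: "realises n D r A C \<delta> Z" using realised[OF assms(2,1,3)] by blast
  then have Zb: "Z \<in> complexes_between n D C A" and Zr: "r A C \<delta> = homotopy_class n D C A Z"
    unfolding realises_def by auto
  have "homotopy_class n (op_category D) A C X = op_realisation n r C A \<delta> \<longleftrightarrow>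
      homotopy_class n D C A (op_cpx n X) = r A C \<delta>"
    if X: "X \<in> complexes_between n (op_category D) A C"
  proof
    have oX: "op_cpx n X \<in> complexes_between n D C A" using X op_complexes_between_iff by blast
    assume "homotopy_class n (op_category D) A C X = op_realisation n r C A \<delta>"
    moreover have "X \<in> homotopy_class n (op_category D) A C X"
      unfolding op_homotopy_class[OF X]
      using oX homotopy_equivalent_refl[OF oX] by (simp add: homotopy_class_def)
    ultimately have "op_cpx n X \<in> homotopy_class n D C A Z"
      unfolding op_realisation_def Zr by simp
    then have "homotopy_equivalent n D C A Z (op_cpx n X)" unfolding homotopy_class_def by blast
    then show "homotopy_class n D C A (op_cpx n X) = r A C \<delta>"
      unfolding Zr using homotopy_class_eq_iff[OF Zb oX] by simp
  next
    assume "homotopy_class n D C A (op_cpx n X) = r A C \<delta>"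
    then show "homotopy_class n (op_category D) A C X = op_realisation n r C A \<delta>"
      unfolding op_homotopy_class[OF X] op_realisation_def by simp
  qed
  then show ?thesis unfolding realises_def using op_complexes_between_iff by blast
qed

lemma op_distinguished_iff:
  "distinguished n (op_category D) (op_functor G) (op_realisation n r) X \<delta> \<longleftrightarrow> dist (op_cpx n X) \<delta>"
proof -
  have "realises n (op_category D) (op_realisation n r) (ob X (n + 1)) (ob X 0) \<delta> X \<longleftrightarrow>
      realises n D r (ob X 0) (ob X (Suc n)) \<delta> (op_cpx n X)"
    if "\<delta> \<in> carrier (ext G (ob X 0) (ob X (Suc n)))"
  proof (cases "is_complex n D (op_cpx n X)")
    case True
    from complex_dest(1)[OF this, of 0] complex_dest(1)[OF this, of "Suc n"]
    have "ob X 0 \<in> obj D" "ob X (Suc n) \<in> obj D" by simp_all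
    from op_realises_iff[OF this that] show ?thesis by simp
  next
    case False
    then show ?thesis
      unfolding realises_def using op_complexes_between_iff[of X n]
      unfolding complexes_between_def by auto
  qed
  then show ?thesis unfolding distinguished_def by auto
qed

lemma dist_same:
  assumes "dist X \<delta>" "\<And>i. i \<le> Suc n \<Longrightarrow> ob X i = ob Y i" "\<And>i. i \<le> n \<Longrightarrow> df X i = df Y i"
  shows "dist Y \<delta>"
proof -
  have Y: "Y \<in> complexes_between n D (ob X 0) (ob X (Suc n))"
    unfolding complexes_between_def using is_complex_cong[OF assms(2,3)] dist_dest(1)[OF assms(1)] assms(2) by simp
  from dist_homotopy_equivalent[OF assms(1) this homotopy_equivalent_same[OF dist_dest(7)[OF assms(1)] Y assms(2,3)]]
  show ?thesis .
qed

lemma op_cpx_dist: "dist (op_cpx n (op_cpx n X)) \<delta> \<longleftrightarrow> dist X \<delta>"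
  using dist_same[of X \<delta> "op_cpx n (op_cpx n X)"] dist_same[of "op_cpx n (op_cpx n X)" \<delta> X] by auto

end

context additive_category
begin

lemma op_mcol:
  assumes "ar u" "ar v" "dm u = B" "dm v = B'" "cd u = A" "cd v = A"
  shows "mcol (op_category D) A B B' u v = mrow D B' B A v u"
proof -
  have o: "A \<in> obj D" "B \<in> obj D" "B' \<in> obj D" using assms ar_dest by auto
  have "u \<cdot> prj2 D B' B \<oplus> v \<cdot> prj1 D B' B = v \<cdot> prj1 D B' B \<oplus> u \<cdot> prj2 D B' B"
    using assms o by (intro plus_commute) simp_all
  then show ?thesis unfolding mcol_def mrow_def using assms o by (simp add: plus_def)
qed

lemma op_mrow:
  assumes "ar u" "ar v" "cd u = A" "cd v = A'" "dm u = B" "dm v = B"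
  shows "mrow (op_category D) A A' B u v = mcol D B A' A v u"
proof -
  have o: "B \<in> obj D" "A \<in> obj D" "A' \<in> obj D" using assms ar_dest by auto
  have "inj2 D A' A \<cdot> u \<oplus> inj1 D A' A \<cdot> v = inj1 D A' A \<cdot> v \<oplus> inj2 D A' A \<cdot> u"
    using assms o by (intro plus_commute) simp_all
  then show ?thesis unfolding mcol_def mrow_def using assms o by (simp add: plus_def)
qed

lemma op_mmat:
  assumes "ar p" "ar q" "ar u" "ar v" "cd p = A" "cd q = A'" "cd u = A" "cd v = A'"
    "dm p = B" "dm q = B" "dm u = B'" "dm v = B'"
  shows "mmat (op_category D) A A' B B' p q u v = mmat D B' B A' A v q u p"
proof -
  have o [simp]: "A \<in> obj D" "A' \<in> obj D" "B \<in> obj D" "B' \<in> obj D"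
    using assms ar_dest(1,2)[of p] ar_dest(1,2)[of v] by auto
  have c: "mcol D B A' A q p = inj1 D A' A \<cdot> q \<oplus> inj2 D A' A \<cdot> p"
    "mcol D B' A' A v u = inj1 D A' A \<cdot> v \<oplus> inj2 D A' A \<cdot> u"
    using assms by (simp_all add: mcol_eq)
  have "mmat (op_category D) A A' B B' p q u v = mcol (op_category D) (dsum D A' A) B B'
      (mcol D B A' A q p) (mcol D B' A' A v u)"
    unfolding mmat_def using assms by (simp add: op_mrow)
  also have "\<dots> = mrow D B' B (dsum D A' A) (mcol D B' A' A v u) (mcol D B A' A q p)"
    unfolding c using assms by (intro op_mcol) simp_all
  also have "\<dots> = mmat D B' B A' A v q u p"
    unfolding c using assms by (simp add: mrow_eq mmat_eq additive_simps)
  finally show ?thesis .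
qed

lemma op_complex_dest:
  assumes "is_complex n D (op_cpx n X)"
  shows "i \<le> n \<Longrightarrow> ar (df X i)" "i \<le> n \<Longrightarrow> dm (df X i) = ob X (Suc i)"
    "i \<le> n \<Longrightarrow> cd (df X i) = ob X i" "i \<le> Suc n \<Longrightarrow> ob X i \<in> obj D"
  using complex_dest(1)[OF assms, of "Suc n - i"] complex_dest(2-4)[OF assms, of "n - i"]
  by (simp_all add: Suc_diff_le)

lemma inv_arr:
  assumes "ar f"
  shows "ar (inv\<^bsub>Hom D (dm f) (cd f)\<^esub> f)" "dm (inv\<^bsub>Hom D (dm f) (cd f)\<^esub> f) = dm f"
    "cd (inv\<^bsub>Hom D (dm f) (cd f)\<^esub> f) = cd f"
  using assms ar_dest[OF assms] by (simp_all add: inv_eq_minus)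

lemma degree_cases:
  fixes i n :: nat
  assumes "i \<le> n"
  obtains "i = 0" | "i = n" | j m where "i = Suc j" "n = Suc (m + i)"
proof (cases "i = 0 \<or> i = n")
  case False
  then show thesis using assms by (intro that(3)[of "i - 1" "n - Suc i"]) linarith+
qed (use that(1,2) in blast)

text \<open>
  Transposing a matrix exchanges the two summands of its source and of its target, which the swapped
  direct sums of the opposite category undo; the signs of the two cones then agree.
\<close>

lemma op_coneM:
  assumes n: "n \<ge> 1" and X: "is_complex n D (op_cpx n X)" and Y: "is_complex n D (op_cpx n Y)"
    and f: "chain_map n D (op_cpx n Y) (op_cpx n X) f"
  defines "F \<equiv> \<lambda>i. f (Suc n - i)"
  shows "i \<le> Suc n \<Longrightarrow> ob (coneN n D (op_cpx n Y) (op_cpx n X) f) i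
      = ob (op_cpx n (coneM n (op_category D) X Y F)) i"
    and "i \<le> n \<Longrightarrow> df (coneN n D (op_cpx n Y) (op_cpx n X) f) i
      = df (op_cpx n (coneM n (op_category D) X Y F)) i"
proof -
  note [simp] = op_complex_dest[OF X] op_complex_dest[OF Y] chain_map_dest(1-3)[OF f Y X]
  have ix [simp]: "ar (inv\<^bsub>Hom D (ob X (Suc i)) (ob X i)\<^esub> df X i)"
    "dm (inv\<^bsub>Hom D (ob X (Suc i)) (ob X i)\<^esub> df X i) = ob X (Suc i)"
    "cd (inv\<^bsub>Hom D (ob X (Suc i)) (ob X i)\<^esub> df X i) = ob X i" if "i \<le> n" for i
    using inv_arr[of "df X i"] that by simp_all
  show "ob (coneN n D (op_cpx n Y) (op_cpx n X) f) i = ob (op_cpx n (coneM n (op_category D) X Y F)) i"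
    if "i \<le> Suc n"
    using n that by (auto simp: coneN_def coneM_def Suc_diff_le le_Suc_eq)
  show "df (coneN n D (op_cpx n Y) (op_cpx n X) f) i = df (op_cpx n (coneM n (op_category D) X Y F)) i"
    if i: "i \<le> n"
  proof (use i in \<open>cases rule: degree_cases\<close>)
    case 1
    then show ?thesis using n by (simp add: coneN_def coneM_def F_def op_mrow)
    next
      case 2
      obtain m where m: "n = Suc m" using n by (cases n) simp_all
      show ?thesis unfolding 2 using 2 n ix[of 1] m
        by (simp add: coneN_def coneM_def F_def op_mcol numeral_2_eq_2)
    next
      case (3 j m)
      then show ?thesis
      using n ix[of "Suc (Suc m)"]
        by (simp add: coneN_def coneM_def F_def op_mmat Suc_diff_le)
  qed
qed

lemma op_coneN:
  assumes n: "n \<ge> 1" and X: "is_complex n D (op_cpx n X)" and Y: "is_complex n D (op_cpx n Y)"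
    and f: "chain_map n D (op_cpx n Y) (op_cpx n X) f"
  defines "F \<equiv> \<lambda>i. f (Suc n - i)"
  shows "i \<le> Suc n \<Longrightarrow> ob (coneM n D (op_cpx n Y) (op_cpx n X) f) i
      = ob (op_cpx n (coneN n (op_category D) X Y F)) i"
    and "i \<le> n \<Longrightarrow> df (coneM n D (op_cpx n Y) (op_cpx n X) f) i
      = df (op_cpx n (coneN n (op_category D) X Y F)) i"
proof -
  note [simp] = op_complex_dest[OF X] op_complex_dest[OF Y] chain_map_dest(1-3)[OF f Y X]
  have iy [simp]: "ar (inv\<^bsub>Hom D (ob Y (Suc i)) (ob Y i)\<^esub> df Y i)"
    "dm (inv\<^bsub>Hom D (ob Y (Suc i)) (ob Y i)\<^esub> df Y i) = ob Y (Suc i)"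
    "cd (inv\<^bsub>Hom D (ob Y (Suc i)) (ob Y i)\<^esub> df Y i) = ob Y i" if "i \<le> n" for i
    using inv_arr[of "df Y i"] that by simp_all
  show "ob (coneM n D (op_cpx n Y) (op_cpx n X) f) i = ob (op_cpx n (coneN n (op_category D) X Y F)) i"
    if "i \<le> Suc n"
    using n that by (auto simp: coneN_def coneM_def Suc_diff_le le_Suc_eq)
  show "df (coneM n D (op_cpx n Y) (op_cpx n X) f) i = df (op_cpx n (coneN n (op_category D) X Y F)) i"
    if i: "i \<le> n"
  proof (use i in \<open>cases rule: degree_cases\<close>)
      case 1
      obtain m where m: "n = Suc m" using n by (cases n) simp_all
      show ?thesis using 1 n iy[of m] m
        by (simp add: coneN_def coneM_def F_def op_mrow)
    next
      case 2
      then show ?thesis using n by (simp add: coneN_def coneM_def F_def op_mcol)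
    next
      case (3 j m)
      then show ?thesis
        using n iy[of m]
        by (simp add: coneN_def coneM_def F_def op_mmat Suc_diff_le)
  qed
qed

end

context exact_realisation
begin

lemma realises_iff_dist:
  assumes "\<delta> \<in> carrier (ext G C A)"
  shows "realises n D r C A \<delta> X \<longleftrightarrow> dist X \<delta> \<and> ob X 0 = A \<and> ob X (Suc n) = C"
  using assms unfolding distinguished_def realises_def complexes_between_def by auto

lemma dist_triv:
  assumes n: "n \<ge> 1" and A: "A \<in> obj D"
  shows "dist (triv D 0 A) \<one>\<^bsub>ext G (zob D) A\<^esub>" "dist (triv D n A) \<one>\<^bsub>ext G A (zob D)\<^esub>"
proof -
  interpret l: group "ext G (zob D) A" by (rule ext_group) (simp_all add: A)
  interpret r: group "ext G A (zob D)" by (rule ext_group) (simp_all add: A)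
  have "realises n D r (zob D) A \<one>\<^bsub>ext G (zob D) A\<^esub> (triv D 0 A)"
    "realises n D r A (zob D) \<one>\<^bsub>ext G A (zob D)\<^esub> (triv D n A)"
    unfolding realises_def complexes_between_def R2_left[OF A] R2_right[OF A]
    using triv_complex[OF A, of 0] triv_complex[OF A, of n] n by (auto simp: triv_def Let_def)
  then show "dist (triv D 0 A) \<one>\<^bsub>ext G (zob D) A\<^esub>" "dist (triv D n A) \<one>\<^bsub>ext G A (zob D)\<^esub>"
    by (simp_all add: realises_iff_dist)
qed

lemma op_exact_realisation:
  assumes n: "n \<ge> 1"
  shows "exact_realisation n (op_category D) (op_functor G) (op_realisation n r)"
proof -
  interpret op: biadditive_functor "op_category D" "op_functor G" by (rule op_biadditive_functor)
  have op_realises: "realises n (op_category D) (op_realisation n r) C A \<delta> X \<longleftrightarrow>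
      dist (op_cpx n X) \<delta> \<and> ob X 0 = A \<and> ob X (Suc n) = C"
    if "A \<in> obj D" "C \<in> obj D" "\<delta> \<in> carrier (ext G A C)" for A C \<delta> X
    unfolding op_realises_iff[OF that] realises_iff_dist[OF that(3)] by auto
  show ?thesis
  proof (intro exact_realisation.intro exact_realisation_axioms.intro op_biadditive_functor, goal_cases)
    case (1 A C \<delta>)
    then have a: "A \<in> obj D" "C \<in> obj D" "\<delta> \<in> carrier (ext G A C)" by simp_all
    obtain X where "dist X \<delta>" "ob X 0 = C" "ob X (Suc n) = A"
      by (rule dist_exists[OF a(2,1,3)])
    then show ?case
      unfolding op_realises[OF a] using op_cpx_dist by (intro exI[of _ "op_cpx n X"]) simp
  next
    case (2 A B C C' \<delta> \<rho> X Y a c)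
    have X: "dist (op_cpx n X) \<delta>" "ob X 0 = A" "ob X (Suc n) = C"
      and Y: "dist (op_cpx n Y) \<rho>" "ob Y 0 = B" "ob Y (Suc n) = C'"
      using 2 op_realises[of A C \<delta> X] op_realises[of B C' \<rho> Y] by simp_all
    have ac: "ar a" "dm a = B" "cd a = A" "ar c" "dm c = C'" "cd c = C"
      "push D G B c \<rho> = pull D G C a \<delta>"
      using 2 unfolding ext_morphism_def by (simp_all add: mor_iff)
    have e: "dm c = ob (op_cpx n Y) 0" "cd c = ob (op_cpx n X) 0"
      "dm a = ob (op_cpx n Y) (Suc n)" "cd a = ob (op_cpx n X) (Suc n)"
      "push D G (ob (op_cpx n Y) (Suc n)) c \<rho> = pull D G (ob (op_cpx n X) 0) a \<delta>"
      using ac X Y by simp_all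
    obtain f where f: "chain_map n D (op_cpx n Y) (op_cpx n X) f" "f 0 = c" "f (Suc n) = a"
      by (rule dist_lift[OF Y(1) X(1) ac(4) e(1,2) ac(1) e(3-5)])
    have "chain_map n (op_category D) X Y (\<lambda>i. f (Suc n - i))"
      using op_chain_map[OF dist_dest(1)[OF Y(1)] dist_dest(1)[OF X(1)] f(1)]
        chain_map_cong[of n "op_cpx n (op_cpx n X)" X "op_cpx n (op_cpx n Y)" Y]
      by simp
    then show ?case using f(2,3) by (intro exI[of _ "\<lambda>i. f (Suc n - i)"]) simp
  next
    case (3 A C \<delta> X)
    then have "dist (op_cpx n X) \<delta>" using op_realises[of A C \<delta> X] by simp
    from op_n_exangle[OF n dist_dest(4)[OF this]]
    have x: "n_exangle n (op_category D) (op_functor G) (op_cpx n (op_cpx n X)) \<delta>" .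
    have "n_exangle n (op_category D) (op_functor G) (op_cpx n (op_cpx n X)) \<delta> \<longleftrightarrow>
        n_exangle n (op_category D) (op_functor G) X \<delta>"
      by (rule n_exangle_cong) (use n in simp_all)
    then show ?case using x by blast
  next
    case (4 A)
    then have A: "A \<in> obj D" by simp
    interpret g: group "ext G A (zob D)" by (rule ext_group) (simp_all add: A)
    have "dist (op_cpx n (triv (op_category D) 0 A)) \<one>\<^bsub>ext G A (zob D)\<^esub>"
      by (rule dist_same[OF dist_triv(2)[OF n A]]) (use n in \<open>auto simp: triv_def Let_def\<close>)
    then have "realises n (op_category D) (op_realisation n r) (zob D) A \<one>\<^bsub>ext G A (zob D)\<^esub>
        (triv (op_category D) 0 A)"
      using op_realises[of A "zob D"] A n by (simp add: triv_def Let_def)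
    then show ?case unfolding realises_def by simp
  next
    case (5 C)
    then have C: "C \<in> obj D" by simp
    interpret g: group "ext G (zob D) C" by (rule ext_group) (simp_all add: C)
    have "dist (op_cpx n (triv (op_category D) n C)) \<one>\<^bsub>ext G (zob D) C\<^esub>"
      by (rule dist_same[OF dist_triv(1)[OF n C]]) (use n in \<open>auto simp: triv_def Let_def\<close>)
    then have "realises n (op_category D) (op_realisation n r) C (zob D) \<one>\<^bsub>ext G (zob D) C\<^esub>
        (triv (op_category D) n C)"
      using op_realises[of "zob D" C] C n by (simp add: triv_def Let_def)
    then show ?case unfolding realises_def by simp
  qed
qed

lemma op_inflation: "inflation n (op_category D) (op_functor G) (op_realisation n r) f \<longleftrightarrow> deflation n D G r f"
  and op_deflation: "deflation n (op_category D) (op_functor G) (op_realisation n r) f \<longleftrightarrow> inflation n D G r f"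
  unfolding inflation_def deflation_def conflation_def op_distinguished_iff
  using op_cpx_dist op_cpx_simps(2) by (metis diff_zero diff_self_eq_0)+

end

lemma (in n_exangulated_category) op_n_exangulated_category:
  assumes n: "n \<ge> 1"
  shows "n_exangulated_category n (op_category D) (op_functor G) (op_realisation n r)"
proof (intro n_exangulated_category.intro n_exangulated_category_axioms.intro
    op_exact_realisation[OF n], goal_cases)
  case (1 A B C f g)
  then show ?case using EA1_op[of C B A g f] by (simp add: op_inflation)
next
  case (2 A B C f g)
  then show ?case using EA1[of C B A g f] by (simp add: op_deflation)
next
  case (3 X Y c \<rho>)
  let ?X = "op_cpx n X" and ?Y = "op_cpx n Y"
  have X: "dist ?X (push D G (ob Y 0) c \<rho>)" and Y: "dist ?Y \<rho>" and e: "ob X 0 = ob Y 0"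
    and c: "c \<in> mor D (ob Y (Suc n)) (ob X (Suc n))"
    using 3 by (simp_all add: op_distinguished_iff)
  obtain f where f: "chain_map n D ?Y ?X f" "f 0 = c" "f (Suc n) = idn D (ob Y 0)"
    and N: "dist (coneN n D ?Y ?X f) (pull D G (ob Y (Suc n)) (df X 0) \<rho>)"
    using EA2_op[of ?Y ?X c \<rho>] X Y c e by auto
  let ?F = "\<lambda>i. f (Suc n - i)"
  note Xc = dist_dest(1)[OF X] and Yc = dist_dest(1)[OF Y]
  have "chain_map n (op_category D) X Y ?F"
    using op_chain_map[OF Yc Xc f(1)] chain_map_cong[of n "op_cpx n ?X" X "op_cpx n ?Y" Y] by simp
  moreover have "dist (op_cpx n (coneM n (op_category D) X Y ?F)) (pull D G (ob Y (Suc n)) (df X 0) \<rho>)"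
    by (rule dist_same[OF N]) (rule op_coneM[OF n Xc Yc f(1)], assumption)+
  ultimately show ?case
    using f e by (intro exI[of _ ?F]) (simp add: op_distinguished_iff)
next
  case (4 X Y a \<delta>)
  let ?X = "op_cpx n X" and ?Y = "op_cpx n Y"
  have X: "dist ?X \<delta>" and Y: "dist ?Y (pull D G (ob X (Suc n)) a \<delta>)" and e: "ob X (Suc n) = ob Y (Suc n)"
    and a: "a \<in> mor D (ob Y 0) (ob X 0)"
    using 4 by (simp_all add: op_distinguished_iff)
  obtain f where f: "chain_map n D ?Y ?X f" "f (Suc n) = a" "f 0 = idn D (ob Y (Suc n))"
    and M: "dist (coneM n D ?Y ?X f) (push D G (ob X 0) (df Y n) \<delta>)"
    using EA2[of ?Y ?X a \<delta>] X Y a e by auto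
  let ?F = "\<lambda>i. f (Suc n - i)"
  note Xc = dist_dest(1)[OF X] and Yc = dist_dest(1)[OF Y]
  have "chain_map n (op_category D) X Y ?F"
    using op_chain_map[OF Yc Xc f(1)] chain_map_cong[of n "op_cpx n ?X" X "op_cpx n ?Y" Y] by simp
  moreover have "dist (op_cpx n (coneN n (op_category D) X Y ?F)) (push D G (ob X 0) (df Y n) \<delta>)"
    by (rule dist_same[OF M]) (rule op_coneN[OF n Xc Yc f(1)], assumption)+
  ultimately show ?case
    using f e by (intro exI[of _ ?F]) (simp add: op_distinguished_iff)
qed

section \<open>Extension closed subcategories\<close>

lemma full_subcategory_simps [simp]:
  "obj (full_subcategory D \<A>) = \<A>" "Hom (full_subcategory D \<A>) = Hom D"
  "idn (full_subcategory D \<A>) = idn D" "cmp (full_subcategory D \<A>) = cmp D"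
  "zob (full_subcategory D \<A>) = zob D" "dsum (full_subcategory D \<A>) = dsum D"
  "inj1 (full_subcategory D \<A>) = inj1 D" "inj2 (full_subcategory D \<A>) = inj2 D"
  "prj1 (full_subcategory D \<A>) = prj1 D" "prj2 (full_subcategory D \<A>) = prj2 D"
  by (simp_all add: full_subcategory_def)

lemma full_subcategory_derived [simp]:
  "push (full_subcategory D \<A>) G = push D G" "pull (full_subcategory D \<A>) G = pull D G"
  "chain_map n (full_subcategory D \<A>) = chain_map n D"
  "homotopy_equivalent n (full_subcategory D \<A>) = homotopy_equivalent n D"
  "mcol (full_subcategory D \<A>) = mcol D" "mrow (full_subcategory D \<A>) = mrow D"
  "mmat (full_subcategory D \<A>) = mmat D"
  "ext_morphism (full_subcategory D \<A>) = ext_morphism D"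
  by (unfold push_def pull_def chain_map_def homotopy_equivalent_def
      chain_map_between_def homotopic_def null_homotopic_def mcol_def mrow_def
      mmat_def ext_morphism_def full_subcategory_simps) (rule refl)+

lemma full_subcategory_complexes [simp]:
  "coneM n (full_subcategory D \<A>) = coneM n D" "coneN n (full_subcategory D \<A>) = coneN n D"
  "triv (full_subcategory D \<A>) = triv D"
  by (unfold coneM_def coneN_def triv_def full_subcategory_simps full_subcategory_derived) (rule refl)+

lemma is_complex_full_subcategory:
  "\<A> \<subseteq> obj D \<Longrightarrow>
    is_complex n (full_subcategory D \<A>) X \<longleftrightarrow> is_complex n D X \<and> (\<forall>i \<le> Suc n. ob X i \<in> \<A>)"
  unfolding is_complex_def by auto

locale extension_closed_subcategory = n_exangulated_category n D G r
  for n :: nat and D :: "('o, 'm) category_data" (structure)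
    and G :: "('o, 'm, 'e) bifunctor_data" and r :: "('o, 'm, 'e) realisation" +
  fixes \<A> :: "'o set"
  assumes n: "n \<ge> 1" and sub: "additive_subcategory D \<A>" and closed: "n_extension_closed n D G r \<A>"
begin

lemma sub_obj: "A \<in> \<A> \<Longrightarrow> A \<in> obj D"
  using sub unfolding additive_subcategory_def by blast

lemma sub_zob: "zob D \<in> \<A>"
  and sub_dsum: "A \<in> \<A> \<Longrightarrow> B \<in> \<A> \<Longrightarrow> dsum D A B \<in> \<A>"
  using sub unfolding additive_subcategory_def by auto

lemma op_extension_closed_subcategory:
  "extension_closed_subcategory n (op_category D) (op_functor G) (op_realisation n r) \<A>"
proof (intro extension_closed_subcategory.intro extension_closed_subcategory_axioms.intro
    op_n_exangulated_category[OF n] n)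
  have "isomorphic (op_category D) A B \<longleftrightarrow> isomorphic D A B" for A B
    unfolding isomorphic_def by auto
  then show "additive_subcategory (op_category D) \<A>"
    using sub unfolding additive_subcategory_def by auto
  show "n_extension_closed n (op_category D) (op_functor G) (op_realisation n r) \<A>"
    unfolding n_extension_closed_def op_distinguished_iff
  proof (intro ballI)
    fix A C \<delta> assume "A \<in> \<A>" "C \<in> \<A>" "\<delta> \<in> carrier (ext (op_functor G) C A)"
    then obtain X where "ob X 0 = C" "ob X (n + 1) = A" "dist X \<delta>" "\<forall>i \<le> n + 1. ob X i \<in> \<A>"
      using closed unfolding n_extension_closed_def by (metis op_functor_simps(1))
    then show "\<exists>X. ob X 0 = A \<and> ob X (n + 1) = C \<and> dist (op_cpx n X) \<delta> \<and> (\<forall>i \<le> n + 1. ob X i \<in> \<A>)"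
      by (intro exI[of _ "op_cpx n X"]) (simp add: op_cpx_dist)
  qed
qed

lemma sub_additive_category: "additive_category (full_subcategory D \<A>)"
proof (intro additive_category.intro additive_category_axioms.intro)
  show "preadditive_category (full_subcategory D \<A>)"
    by (rule preadditive_category.intro; unfold full_subcategory_simps;
        metis sub_obj mor_disjoint idn_mor cmp_mor cmp_idn idn_cmp cmp_assoc Hom_comm_group
          cmp_left_hom cmp_right_hom)
qed (simp_all add: sub_zob sub_dsum sub_obj mor_zob zob_mor inj1_mor inj2_mor prj1_mor prj2_mor dsum_idn)

lemma sub_biadditive_functor: "biadditive_functor (full_subcategory D \<A>) G"
  by (intro biadditive_functor.intro biadditive_functor_axioms.intro sub_additive_category; simp;
      meson sub_obj ext_comm_group act_hom act_idn act_cmp push_add pull_add)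

abbreviation "ind \<equiv> induced_realisation n D G r \<A>"

lemma sub_complexes_between:
  "X \<in> complexes_between n (full_subcategory D \<A>) A C \<longleftrightarrow>
    X \<in> complexes_between n D A C \<and> (\<forall>i \<le> Suc n. ob X i \<in> \<A>)"
  unfolding complexes_between_def using is_complex_full_subcategory[of \<A> D n X] sub_obj by auto

text \<open>
  Two complexes with terms in \<open>\<A>\<close> are homotopy equivalent in \<open>\<A>\<close> if and only if they are so in \<open>D\<close>,
  since \<open>\<A>\<close> is a full subcategory. Hence the choice of a complex in the definition of the induced
  realisation is immaterial.
\<close>

lemma sub_realises_iff:
  assumes "A \<in> \<A>" "C \<in> \<A>" "\<delta> \<in> carrier (ext G C A)"
  shows "realises n (full_subcategory D \<A>) ind C A \<delta> X \<longleftrightarrow>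
    dist X \<delta> \<and> ob X 0 = A \<and> ob X (Suc n) = C \<and> (\<forall>i \<le> Suc n. ob X i \<in> \<A>)"
proof -
  interpret S: additive_category "full_subcategory D \<A>" by (rule sub_additive_category)
  define Z where "Z = (SOME X. ob X 0 = A \<and> ob X (n + 1) = C \<and> dist X \<delta> \<and> (\<forall>i \<le> n + 1. ob X i \<in> \<A>))"
  have "ob Z 0 = A \<and> ob Z (n + 1) = C \<and> dist Z \<delta> \<and> (\<forall>i \<le> n + 1. ob Z i \<in> \<A>)"
    unfolding Z_def
    by (rule someI_ex) (use closed assms in \<open>unfold n_extension_closed_def, blast\<close>)
  then have Z0: "ob Z 0 = A" "ob Z (Suc n) = C" and Z: "dist Z \<delta>" and ZA: "\<forall>i \<le> Suc n. ob Z i \<in> \<A>"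
    by auto
  have Zb: "Z \<in> complexes_between n D A C" using dist_dest(7)[OF Z] Z0 by simp
  have ZS: "Z \<in> complexes_between n (full_subcategory D \<A>) A C"
    using Zb ZA sub_complexes_between by blast
  have ind: "ind C A \<delta> = homotopy_class n (full_subcategory D \<A>) A C Z"
    unfolding induced_realisation_def Z_def ..
  have r: "r C A \<delta> = homotopy_class n D A C Z"
    using Z realises_iff_dist[OF assms(3)] Z0 unfolding realises_def by blast
  have "homotopy_class n (full_subcategory D \<A>) A C X = ind C A \<delta> \<longleftrightarrow> homotopy_class n D A C X = r C A \<delta>"
    if "X \<in> complexes_between n (full_subcategory D \<A>) A C"
    using that S.homotopy_class_eq_iff[OF that ZS] homotopy_class_eq_iff[OF _ Zb, of X]
    unfolding ind r by (simp add: sub_complexes_between)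
  then have "realises n (full_subcategory D \<A>) ind C A \<delta> X \<longleftrightarrow>
      realises n D r C A \<delta> X \<and> (\<forall>i \<le> Suc n. ob X i \<in> \<A>)"
    unfolding realises_def using sub_complexes_between by blast
  then show ?thesis using realises_iff_dist[OF assms(3)] by auto
qed

lemma sub_distinguished_iff:
  "distinguished n (full_subcategory D \<A>) G ind X \<delta> \<longleftrightarrow> dist X \<delta> \<and> (\<forall>i \<le> Suc n. ob X i \<in> \<A>)"
proof
  assume X: "distinguished n (full_subcategory D \<A>) G ind X \<delta>"
  then have "realises n (full_subcategory D \<A>) ind (ob X (Suc n)) (ob X 0) \<delta> X"
    and \<delta>: "\<delta> \<in> carrier (ext G (ob X (Suc n)) (ob X 0))"
    unfolding distinguished_def by auto
  moreover from this have "\<forall>i \<le> Suc n. ob X i \<in> \<A>"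
    unfolding realises_def sub_complexes_between by blast
  ultimately show "dist X \<delta> \<and> (\<forall>i \<le> Suc n. ob X i \<in> \<A>)"
    using sub_realises_iff[of "ob X 0" "ob X (Suc n)" \<delta> X] by simp
next
  assume X: "dist X \<delta> \<and> (\<forall>i \<le> Suc n. ob X i \<in> \<A>)"
  then show "distinguished n (full_subcategory D \<A>) G ind X \<delta>"
    using sub_realises_iff[of "ob X 0" "ob X (Suc n)" \<delta> X] dist_dest(2)[of X \<delta>]
    unfolding distinguished_def by simp
qed

lemma sub_exact_realisation: "exact_realisation n (full_subcategory D \<A>) G ind"
proof (intro exact_realisation.intro exact_realisation_axioms.intro sub_biadditive_functor, goal_cases)
  case (1 A C \<delta>)
  then have "\<exists>X. ob X 0 = A \<and> ob X (n + 1) = C \<and> dist X \<delta> \<and> (\<forall>i \<le> n + 1. ob X i \<in> \<A>)"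
    using closed unfolding n_extension_closed_def by simp
  then show ?case using 1 sub_realises_iff[of A C \<delta>] by auto
next
  case (2 A B C C' \<delta> \<rho> X Y a c)
  have X: "realises n D r C A \<delta> X" and Y: "realises n D r C' B \<rho> Y"
    using 2 sub_realises_iff[of A C \<delta> X] sub_realises_iff[of B C' \<rho> Y]
      realises_iff_dist[of \<delta> C A X] realises_iff_dist[of \<rho> C' B Y] by simp_all
  then show ?case using 2 R0[of A B C C' \<delta> \<rho> X Y a c] sub_obj by simp
next
  case (3 A C \<delta> X)
  then have X: "dist X \<delta>" "\<forall>i \<le> Suc n. ob X i \<in> \<A>"
    using sub_realises_iff[of A C \<delta> X] by simp_all
  have "is_complex n (full_subcategory D \<A>) X"
    using is_complex_full_subcategory[of \<A> D n X] dist_dest(1)[OF X(1)] X(2) sub_obj by blast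
  then show ?case
    using dist_dest(4)[OF X(1)] sub_obj unfolding n_exangle_def by simp
next
  case (4 A)
  then have "realises n (full_subcategory D \<A>) ind (zob D) A \<one>\<^bsub>ext G (zob D) A\<^esub> (triv D 0 A)"
    using sub_obj sub_zob dist_triv(1)[OF n, of A] n ext_group[THEN group.is_monoid, THEN monoid.one_closed]
    by (subst sub_realises_iff) (auto simp: triv_def Let_def)
  then show ?case unfolding realises_def by simp
next
  case (5 C)
  then have "realises n (full_subcategory D \<A>) ind C (zob D) \<one>\<^bsub>ext G C (zob D)\<^esub> (triv D n C)"
    using sub_obj sub_zob dist_triv(2)[OF n, of C] n ext_group[THEN group.is_monoid, THEN monoid.one_closed]
    by (subst sub_realises_iff) (auto simp: triv_def Let_def)
  then show ?case unfolding realises_def by simp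
qed

lemma sub_inflation_cmp:
  assumes o: "A \<in> \<A>" "B \<in> \<A>" "C \<in> \<A>" and f: "f \<in> mor D A B" and g: "g \<in> mor D B C"
    and "inflation n (full_subcategory D \<A>) G ind f" "inflation n (full_subcategory D \<A>) G ind g"
  shows "inflation n (full_subcategory D \<A>) G ind (g \<cdot> f)"
proof -
  obtain X \<delta> Y \<rho> where X: "dist X \<delta>" "\<And>i. i \<le> Suc n \<Longrightarrow> ob X i \<in> \<A>" "df X 0 = f"
    and Y: "dist Y \<rho>" "\<And>i. i \<le> Suc n \<Longrightarrow> ob Y i \<in> \<A>" "df Y 0 = g"
    using assms(6,7) unfolding inflation_def conflation_def sub_distinguished_iff by auto
  have "ob Y 0 = ob X 1"
    using complex_dest(4)[OF dist_dest(1)[OF X(1)], of 0] complex_dest(3)[OF dist_dest(1)[OF Y(1)], of 0]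
      X(3) Y(3) f g o sub_obj by (simp add: mor_iff)
  from inflation_cmp_in_subcategory[OF n sub closed X(1) Y(1) this X(2) Y(2)]
  obtain U \<eta> where "dist U \<eta>" "df U 0 = g \<cdot> f" "\<And>i. i \<le> Suc n \<Longrightarrow> ob U i \<in> \<A>"
    using X(3) Y(3) by metis
  then show ?thesis unfolding inflation_def conflation_def sub_distinguished_iff by blast
qed

text \<open>
  A conflation in \<open>\<A>\<close> read backwards is a conflation in the opposite of \<open>\<A>\<close>, which is again
  extension closed.
\<close>

lemma sub_deflation_iff:
  "deflation n (full_subcategory D \<A>) G ind f \<longleftrightarrow>
    inflation n (full_subcategory (op_category D) \<A>) (op_functor G)
      (induced_realisation n (op_category D) (op_functor G) (op_realisation n r) \<A>) f"
proof -
  interpret op: extension_closed_subcategory n "op_category D" "op_functor G" "op_realisation n r" \<A>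
    by (rule op_extension_closed_subcategory)
  have "(\<exists>X \<delta>. dist X \<delta> \<and> (\<forall>i \<le> Suc n. ob X i \<in> \<A>) \<and> df X n = f) \<longleftrightarrow>
    (\<exists>X \<delta>. dist (op_cpx n X) \<delta> \<and> (\<forall>i \<le> Suc n. ob X i \<in> \<A>) \<and> df X 0 = f)" (is "?L \<longleftrightarrow> ?R")
  proof
    assume ?L
    then obtain X \<delta> where "dist X \<delta>" "\<forall>i \<le> Suc n. ob X i \<in> \<A>" "df X n = f" by blast
    then show ?R by (intro exI[of _ "op_cpx n X"] exI[of _ \<delta>]) (simp add: op_cpx_dist)
  next
    assume ?R
    then obtain X \<delta> where "dist (op_cpx n X) \<delta>" "\<forall>i \<le> Suc n. ob X i \<in> \<A>" "df X 0 = f" by blast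
    then show ?L by (intro exI[of _ "op_cpx n X"] exI[of _ \<delta>]) simp
  qed
  then show ?thesis
    unfolding deflation_def inflation_def conflation_def sub_distinguished_iff
      op.sub_distinguished_iff op_distinguished_iff by blast
qed

lemma sub_n_exangulated_category: "n_exangulated_category n (full_subcategory D \<A>) G ind"
proof (intro n_exangulated_category.intro n_exangulated_category_axioms.intro sub_exact_realisation,
    goal_cases)
  case (1 A B C f g)
  then show ?case using sub_inflation_cmp[of A B C f g] by simp
next
  case (2 A B C f g)
  interpret op: extension_closed_subcategory n "op_category D" "op_functor G" "op_realisation n r" \<A>
    by (rule op_extension_closed_subcategory)
  show ?case
    using 2 op.sub_inflation_cmp[of C B A g f] by (simp add: sub_deflation_iff)
next
  case (3 X Y c \<rho>)
  have X: "dist X (pull D G (ob Y 0) c \<rho>)" "\<forall>i \<le> Suc n. ob X i \<in> \<A>"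
    and Y: "dist Y \<rho>" "\<forall>i \<le> Suc n. ob Y i \<in> \<A>"
    using 3 by (simp_all add: sub_distinguished_iff)
  have "ob (coneM n D X Y f) i \<in> \<A>" if "i \<le> Suc n" for f i
    using that n X(2) Y(2) sub unfolding coneM_def additive_subcategory_def by auto
  then show ?case using 3 EA2[of X Y c \<rho>] X(1) Y(1) by (simp add: sub_distinguished_iff)
next
  case (4 X Y a \<delta>)
  have X: "dist X \<delta>" "\<forall>i \<le> Suc n. ob X i \<in> \<A>"
    and Y: "dist Y (push D G (ob X (Suc n)) a \<delta>)" "\<forall>i \<le> Suc n. ob Y i \<in> \<A>"
    using 4 by (simp_all add: sub_distinguished_iff)
  have "ob (coneN n D X Y f) i \<in> \<A>" if "i \<le> Suc n" for f i
    using that n X(2) Y(2) sub unfolding coneN_def additive_subcategory_def by auto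
  then show ?case using 4 EA2_op[of X Y a \<delta>] X(1) Y(1) by (simp add: sub_distinguished_iff)
qed

lemma inclusion_ext_transformation:
  "ext_transformation (full_subcategory D \<A>) G G inclusion_functor inclusion_transformation"
  unfolding ext_transformation_def inclusion_functor_def inclusion_transformation_def hom_def by auto

lemma inclusion_n_exangulated_functor:
  "n_exangulated_functor n (full_subcategory D \<A>) G ind D G r inclusion_functor inclusion_transformation"
proof (intro n_exangulated_functor.intro n_exangulated_functor_axioms.intro
    sub_n_exangulated_category inclusion_ext_transformation)
  show "n_exangulated_category n D G r" by unfold_locales
  show "additive_functor (full_subcategory D \<A>) D inclusion_functor"
    by (intro additive_functor.intro additive_functor_axioms.intro sub_additive_category)
       (unfold_locales, auto simp: inclusion_functor_def sub_obj hom_def)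
  fix A C \<delta> X
  assume a: "A \<in> obj (full_subcategory D \<A>)" "C \<in> obj (full_subcategory D \<A>)"
    "\<delta> \<in> carrier (ext G C A)" "realises n (full_subcategory D \<A>) ind C A \<delta> X"
  then have "realises n D r C A \<delta> X" using sub_realises_iff[of A C \<delta> X] realises_iff_dist by simp
  then show "realises n D r (fob inclusion_functor C) (fob inclusion_functor A)
      (inclusion_transformation C A \<delta>) (fcpx inclusion_functor X)"
    by (cases X) (simp add: inclusion_functor_def inclusion_transformation_def fcpx_def)
qed

end

theorem theorem1:
  fixes n :: nat
    and C :: "('o, 'm) category_data"
    and E :: "('o, 'm, 'e) bifunctor_data"
    and s :: "('o, 'm, 'e) realisation"
    and \<A> :: "'o set"
  assumes "n \<ge> 1"
    and "n_exangulated_category n C E s"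
    and "additive_subcategory C \<A>"
    and "n_extension_closed n C E s \<A>"
  shows "n_exangulated_category n (full_subcategory C \<A>) E (induced_realisation n C E s \<A>)
    \<and> n_exangulated_functor n (full_subcategory C \<A>) E (induced_realisation n C E s \<A>) C E s
        inclusion_functor inclusion_transformation
    \<and> fully_faithful (full_subcategory C \<A>) C inclusion_functor
    \<and> ext_isomorphism (full_subcategory C \<A>) E E inclusion_functor inclusion_transformation"
proof -
  interpret extension_closed_subcategory n C E s \<A>
    using assms by (intro extension_closed_subcategory.intro extension_closed_subcategory_axioms.intro)
  have "fully_faithful (full_subcategory C \<A>) C inclusion_functor"
    unfolding fully_faithful_def inclusion_functor_def by (simp add: bij_betw_def)
  moreover have "ext_isomorphism (full_subcategory C \<A>) E E inclusion_functor inclusion_transformation"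
    using inclusion_ext_transformation unfolding ext_isomorphism_def
    by (auto simp: iso_def ext_transformation_def inclusion_functor_def inclusion_transformation_def bij_betw_def inj_on_def)
  ultimately show ?thesis
    using sub_n_exangulated_category inclusion_n_exangulated_functor by blast
qed

end
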